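(* Let $A_{3\times 3}$ be the matrix defining the $3\times 3$ transportation problem. Then $u(A_{3\times 3})=g(A_{3\times 3})=9$.
   Context: $A_{3\times 3}\in\mathbb{Z}^{6\times 9}$ is the matrix of the linear map sending a $3\times 3$ table $(z_{ij})$ (regarded as a vector in $\mathbb{R}^9$) to its $3$ row sums and $3$ column sums. Graver basis: for $A\in\mathbb{Z}^{d\times n}$, $\mathcal{G}(A):=\bigcup_{j=1}^{2^n}H_j\setminus\{0\}$, where $H_j$ is the inclusion-minimal Hilbert basis of the pointed rational cone $\{z\in\mathbb{O}_j: Az=0\}$ (i.e. the minimal generating set of the monoid of its integer points), and $\mathbb{O}_1,\dots,\mathbb{O}_{2^n}$ are the orthants of $\mathbb{R}^n$. Universal Gröbner basis: the toric ideal of $A$ is $\mathcal{I}_A:=\langle x^u-x^v : Au=Av,\ u,v\in\mathbb{Z}^n_+\rangle$ in the polynomial ring in $x_1,\dots,x_n$ over a field. For a term ordering $\prec$, the reduced Gröbner basis of $\mathcal{I}_A$ has the form $\{x^{w^+}-x^{w^-}: w\in\mathcal{G}_\prec(A)\}$ with $\mathcal{G}_\prec(A)\subseteq\ker(A)\cap\mathbb{Z}^n$, where $w=w^+-w^-$ is the decomposition into positive and negative parts. $\mathcal{U}(A)$ is the union of the sets $\mathcal{G}_\prec(A)$ over all term orderings $\prec$, where binomials are taken up to sign, so that $\mathcal{U}(A)$ is symmetric: $w\in\mathcal{U}(A)$ implies $-w\in\mathcal{U}(A)$. Higher Lawrence liftings: for a positive integer $N$, $$A^{(N)}:=\begin{pmatrix}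 I_n & I_n & \cdots & I_n\\ A & & & \\ & A & & \\ & & \ddots & \\ & & & A\end{pmatrix}$$ with $N$ blocks, $I_n$ being the $n\times n$ identity matrix. For $x=(x^1,\dots,x^N)$ with $x^i\in\mathbb{Z}^n$, the $x^i$ are the layers of $x$, and the type of $x$ is $|\{i: x^i\ne 0\}|$. Complexities: the Graver complexity $g(A)$ is the maximal type of an element of $\mathcal{G}(A^{(N)})$ over all $N$. The Gröbner complexity $u(A)$ is the maximal type of an element of $\mathcal{U}(A^{(N)})$ over all $N$. *)

theory Defs
  imports
    "Jordan_Normal_Form.Matrix"
    "HOL-Algebra.Ideal"
    "HOL-Library.Poly_Mapping"
    "HOL-Library.Extended_Nat"
begin

section \<open>Graver bases\<close>

text \<open>The $2^n$ orthants are indexed by the sets of coordinates required to be nonpositive.\<close>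

definition orthant :: "nat \<Rightarrow> nat set \<Rightarrow> real vec set" where
  "orthant n J = {z \<in> carrier_vec n. \<forall>i<n. if i \<in> J then z $ i \<le> 0 else z $ i \<ge> 0}"

definition orthant_kernel :: "int mat \<Rightarrow> nat set \<Rightarrow> real vec set" where
  "orthant_kernel A J =
     {z \<in> orthant (dim_col A) J. map_mat real_of_int A *\<^sub>v z = 0\<^sub>v (dim_row A)}"

definition int_points :: "nat \<Rightarrow> real vec set \<Rightarrow> int vec set" where
  "int_points n C = {z \<in> carrier_vec n. map_vec real_of_int z \<in> C}"

definition is_submonoid :: "nat \<Rightarrow> int vec set \<Rightarrow> bool" where
  "is_submonoid n M \<longleftrightarrow>
     M \<subseteq> carrier_vec n \<and> 0\<^sub>v n \<in> M \<and> (\<forall>x\<in>M. \<forall>y\<in>M. x + y \<in> M)"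

definition generates_int_points :: "nat \<Rightarrow> real vec set \<Rightarrow> int vec set \<Rightarrow> bool" where
  "generates_int_points n C H \<longleftrightarrow>
     H \<subseteq> int_points n C \<and> is_submonoid n hull H = int_points n C"

definition is_minimal_hilbert_basis :: "nat \<Rightarrow> real vec set \<Rightarrow> int vec set \<Rightarrow> bool" where
  "is_minimal_hilbert_basis n C H \<longleftrightarrow>
     generates_int_points n C H \<and> (\<forall>H'. H' \<subset> H \<longrightarrow> \<not> generates_int_points n C H')"

text \<open>The cones \<^term>\<open>orthant_kernel A J\<close> are pointed, so the minimal Hilbert basis
  \<open>H\<close> of each of them is unique.\<close>

definition graver_basis :: "int mat \<Rightarrow> int vec set" where
  "graver_basis A =
     (\<Union>J \<in> Pow {..<dim_col A}.
        \<Union>{H. is_minimal_hilbert_basis (dim_col A) (orthant_kernel A J) H})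
     - {0\<^sub>v (dim_col A)}"

section \<open>Toric ideals and universal Groebner bases\<close>

text \<open>A power product in $x_0,\dots,x_{n-1}$ is its finitely supported exponent function, and
  a polynomial is a finitely supported function on power products.\<close>

type_synonym pp = "nat \<Rightarrow>\<^sub>0 nat"

definition pps :: "nat \<Rightarrow> pp set" where
  "pps n = {t. Poly_Mapping.keys t \<subseteq> {..<n}}"

definition polynomial_ring :: "'k::field itself \<Rightarrow> nat \<Rightarrow> (pp \<Rightarrow>\<^sub>0 'k) ring" where
  "polynomial_ring _ n =
     \<lparr>carrier = {p. Poly_Mapping.keys p \<subseteq> pps n}, mult = (*), one = 1, zero = 0, add = (+)\<rparr>"

text \<open>The exponent of $x^u$; only used for \<open>u \<ge> 0\<close>, where \<^const>\<open>nat\<close> does not truncate.\<close>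

definition exponent :: "int vec \<Rightarrow> pp" where
  "exponent u = (\<Sum>i<dim_vec u. Poly_Mapping.single i (nat (u $ i)))"

definition power_product :: "pp \<Rightarrow> (pp \<Rightarrow>\<^sub>0 'k::field)" where
  "power_product t = Poly_Mapping.single t 1"

definition toric_ideal :: "'k::field itself \<Rightarrow> int mat \<Rightarrow> (pp \<Rightarrow>\<^sub>0 'k) set" where
  "toric_ideal K A =
     Idl\<^bsub>polynomial_ring K (dim_col A)\<^esub>
       {power_product (exponent u) - power_product (exponent v) | u v.
          u \<in> carrier_vec (dim_col A) \<and> v \<in> carrier_vec (dim_col A) \<and>
          (\<forall>i<dim_col A. u $ i \<ge> 0 \<and> v $ i \<ge> 0) \<and> A *\<^sub>v u = A *\<^sub>v v}"

text \<open>\<open>(s, t) \<in> r\<close> means \<open>s \<preceq> t\<close>; addition of exponents is multiplication of power products,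
  and \<open>0\<close> is the power product \<open>1\<close>.\<close>

definition term_ordering :: "nat \<Rightarrow> pp rel \<Rightarrow> bool" where
  "term_ordering n r \<longleftrightarrow>
     linear_order_on (pps n) r \<and>
     (\<forall>t\<in>pps n. (0, t) \<in> r) \<and>
     (\<forall>s t. \<forall>c\<in>pps n. (s, t) \<in> r \<longrightarrow> (s + c, t + c) \<in> r)"

definition leading_pp :: "pp rel \<Rightarrow> (pp \<Rightarrow>\<^sub>0 'k::field) \<Rightarrow> pp" where
  "leading_pp r p =
     (THE t. t \<in> Poly_Mapping.keys p \<and> (\<forall>s\<in>Poly_Mapping.keys p. (s, t) \<in> r))"

definition initial_ideal ::
    "nat \<Rightarrow> pp rel \<Rightarrow> (pp \<Rightarrow>\<^sub>0 'k::field) set \<Rightarrow> (pp \<Rightarrow>\<^sub>0 'k) set" where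
  "initial_ideal n r F =
     Idl\<^bsub>polynomial_ring TYPE('k) n\<^esub> {power_product (leading_pp r f) | f. f \<in> F - {0}}"

definition is_groebner_basis ::
    "nat \<Rightarrow> pp rel \<Rightarrow> (pp \<Rightarrow>\<^sub>0 'k::field) set \<Rightarrow> (pp \<Rightarrow>\<^sub>0 'k) set \<Rightarrow> bool" where
  "is_groebner_basis n r I G \<longleftrightarrow>
     finite G \<and> G \<subseteq> I \<and> initial_ideal n r G = initial_ideal n r I"

definition pp_dvd :: "pp \<Rightarrow> pp \<Rightarrow> bool" where
  "pp_dvd s t \<longleftrightarrow> (\<exists>c. t = s + c)"

definition is_reduced_groebner_basis ::
    "nat \<Rightarrow> pp rel \<Rightarrow> (pp \<Rightarrow>\<^sub>0 'k::field) set \<Rightarrow> (pp \<Rightarrow>\<^sub>0 'k) set \<Rightarrow> bool" where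
  "is_reduced_groebner_basis n r I G \<longleftrightarrow>
     is_groebner_basis n r I G \<and>
     (\<forall>g\<in>G. g \<noteq> 0 \<and> Poly_Mapping.lookup g (leading_pp r g) = 1) \<and>
     (\<forall>g\<in>G. \<forall>h\<in>G - {g}. \<forall>t\<in>Poly_Mapping.keys g. \<not> pp_dvd (leading_pp r h) t)"

definition pos_part :: "int vec \<Rightarrow> int vec" where
  "pos_part w = map_vec (\<lambda>a. max a 0) w"

definition neg_part :: "int vec \<Rightarrow> int vec" where
  "neg_part w = map_vec (\<lambda>a. max (- a) 0) w"

text \<open>The reduced Groebner basis exists and is unique, so \<open>G\<close> below is the reduced
  Groebner basis of the toric ideal with respect to \<open>r\<close>.\<close>

definition groebner_vectors :: "'k::field itself \<Rightarrow> int mat \<Rightarrow> pp rel \<Rightarrow> int vec set" where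
  "groebner_vectors K A r =
     {w \<in> carrier_vec (dim_col A). A *\<^sub>v w = 0\<^sub>v (dim_row A) \<and>
        (\<exists>G :: (pp \<Rightarrow>\<^sub>0 'k) set.
           is_reduced_groebner_basis (dim_col A) r (toric_ideal K A) G \<and>
           power_product (exponent (pos_part w)) - power_product (exponent (neg_part w)) \<in> G)}"

definition universal_groebner_basis :: "'k::field itself \<Rightarrow> int mat \<Rightarrow> int vec set" where
  "universal_groebner_basis K A =
     (\<Union>r \<in> {r. term_ordering (dim_col A) r}.
        groebner_vectors K A r \<union> uminus ` groebner_vectors K A r)"

section \<open>Higher Lawrence liftings and complexities\<close>

definition higher_lawrence :: "nat \<Rightarrow> int mat \<Rightarrow> int mat" where
  "higher_lawrence N A =
     mat (dim_col A) (N * dim_col A) (\<lambda>(i, j). 1\<^sub>m (dim_col A) $$ (i, j mod dim_col A))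
     @\<^sub>r diag_block_mat (replicate N A)"

definition layer :: "nat \<Rightarrow> int vec \<Rightarrow> nat \<Rightarrow> int vec" where
  "layer n x i = vec n (\<lambda>j. x $ (i * n + j))"

definition vec_type :: "nat \<Rightarrow> nat \<Rightarrow> int vec \<Rightarrow> nat" where
  "vec_type n N x = card {i \<in> {..<N}. layer n x i \<noteq> 0\<^sub>v n}"

text \<open>The suprema are taken in \<^typ>\<open>enat\<close>, so that unbounded types give \<open>\<infinity>\<close>; a finite
  positive value is an attained maximum.\<close>

definition graver_complexity :: "int mat \<Rightarrow> enat" where
  "graver_complexity A =
     Sup {enat (vec_type (dim_col A) N x) | N x.
            N > 0 \<and> x \<in> graver_basis (higher_lawrence N A)}"

definition groebner_complexity :: "'k::field itself \<Rightarrow> int mat \<Rightarrow> enat" where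
  "groebner_complexity K A =
     Sup {enat (vec_type (dim_col A) N x) | N x.
            N > 0 \<and> x \<in> universal_groebner_basis K (higher_lawrence N A)}"

section \<open>The $3 \times 3$ transportation problem\<close>

text \<open>The entry $z_{ij}$ of a table has index \<open>3 * i + j\<close>, for \<open>i, j < 3\<close>; rows \<open>0,1,2\<close> of
  the matrix give the row sums and rows \<open>3,4,5\<close> the column sums.\<close>

definition transport33 :: "int mat" where
  "transport33 = mat 6 9 (\<lambda>(k, c).
     if k < 3 then (if c div 3 = k then 1 else 0) else (if c mod 3 = k - 3 then 1 else 0))"

lemma transport33_mult_table:
  assumes "i < 3"
  shows "(transport33 *\<^sub>v vec 9 (\<lambda>c. z (c div 3) (c mod 3))) $ i = (\<Sum>j<3. z i j)"
    and "(transport33 *\<^sub>v vec 9 (\<lambda>c. z (c div 3) (c mod 3))) $ (3 + i) = (\<Sum>j<3. z j i)"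
proof -
  have A: "transport33 \<in> carrier_mat 6 9" by (simp add: transport33_def)
  have transport33_entry: "transport33 $$ (k, c) =
      (if k < 3 then (if c div 3 = k then 1 else 0) else (if c mod 3 = k - 3 then 1 else 0))"
    if "k < 6" "c < 9" for k c
    using that by (simp add: transport33_def)
  have i: "i \<in> {0, 1, 2}" using assms by auto
  have row: "(transport33 *\<^sub>v vec 9 f) $ k = (\<Sum>c<9. transport33 $$ (k, c) * f c)" if "k < 6" for k f
    using that A by (simp add: scalar_prod_def atLeast0LessThan)
  have ninth: "(\<Sum>c<9. h c) = h 0 + h 1 + h 2 + h 3 + h 4 + h 5 + h 6 + h 7 + h 8"
    for h :: "nat \<Rightarrow> int" by (simp add: lessThan_nat_numeral lessThan_Suc numeral_eq_Suc)
  have third: "(\<Sum>c<3. h c) = h 0 + h 1 + h 2"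
    for h :: "nat \<Rightarrow> int" by (simp add: numeral_eq_Suc)
  show "(transport33 *\<^sub>v vec 9 (\<lambda>c. z (c div 3) (c mod 3))) $ i = (\<Sum>j<3. z i j)"
    using i by (auto simp: row ninth third transport33_entry simp del: index_mult_mat_vec)
  show "(transport33 *\<^sub>v vec 9 (\<lambda>c. z (c div 3) (c mod 3))) $ (3 + i) = (\<Sum>j<3. z j i)"
    using i by (auto simp: row ninth third transport33_entry simp del: index_mult_mat_vec)
qed

lemma higher_lawrence_carrier:
  "higher_lawrence N A \<in> carrier_mat (dim_col A + N * dim_row A) (N * dim_col A)"
proof -
  have "diag_block_mat (replicate N A) \<in> carrier_mat (N * dim_row A) (N * dim_col A)"
    by (auto simp: dim_diag_block_mat sum_list_replicate)
  then show ?thesis by (auto simp: higher_lawrence_def)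
qed

end

theory Submission
  imports Defs
begin

text \<open>
  The kernel of \<^const>\<open>transport33\<close> is generated by the differences $P_a - P_b$ of the six
  permutation matrices, and the only relation among the latter is that the even ones and the odd
  ones have the same sum. Hence every element of the kernel of a higher Lawrence lifting decomposes
  conformally into arcs $a \to b$ of a directed multigraph on six vertices, and a multiset of arcs
  sums to zero iff its divergence is a multiple $k$ of the parity charge (\<open>1\<close> at even, \<open>-1\<close> at
  odd vertices). Primitivity excludes proper subflows of this kind. This excludes directed cycles
  unless the flow is itself a cycle, which has at most six arcs, and it forces $|k| \le 1$, because
  a flow with $k > 0$ decomposes into paths among which one finds a perfect matching of the three
  sources with the three sinks. An acyclic flow has a topological numbering $h$, and it has at most
  $\sum (h(b) - h(a)) \le (3 + 4 + 5) - (0 + 1 + 2) = 9$ arcs.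

  Elements of reduced Groebner bases are primitive, so both complexities are at most 9. Equality
  is attained by the flow along a path that carries 1, 2, 3, 2, 1 units: giving weight one
  to all coordinates outside its support makes it an edge of its fiber.
\<close>

section \<open>Flows on six vertices\<close>

text \<open>The layers of a kernel element interact only through their sum, so the arcs of all
  layers can be pooled into one flow. Every nonzero layer contributes an arc, and a subflow summing
  to zero can be handed back to the layers as a conformal kernel element; hence a bound on the
  number of arcs bounds the type for every \<open>N\<close>. The numbers 1, 2, 3, 2, 1 are forced by
  equality in the numbering bound: the sources must be numbered 0, 1, 2, the sinks 3, 4, 5, and
  every arc must raise \<open>h\<close> by exactly one, so the arcs leaving level j carry the total
  charge of the levels 0 to j. The obstacle on the Groebner side is that reduced bases are defined
  through ideals and leading terms of arbitrary polynomials. The coefficients of a toric polynomial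
  sum to zero on every fiber, so the initial monomials are just those that are not least in their
  fiber; afterwards only comparisons inside fibers remain.\<close>

definition divergence :: "('v \<times> 'v) multiset \<Rightarrow> 'v \<Rightarrow> int" where
  "divergence F v = (\<Sum>e\<in>#F. of_bool (fst e = v) - of_bool (snd e = v))"

lemma divergence_empty [simp]: "divergence {#} v = 0"
  by (simp add: divergence_def)

lemma divergence_add_mset:
  "divergence (add_mset e F) v = of_bool (fst e = v) - of_bool (snd e = v) + divergence F v"
  by (simp add: divergence_def)

lemma divergence_swap: "divergence (image_mset prod.swap F) v = - divergence F v"
  by (induction F) (auto simp: divergence_add_mset)

text \<open>A surjection of a finite set onto itself is a permutation, so in its graph every vertex
  of \<open>C\<close> is left once and entered once.\<close>

lemma divergence_mset_set_graph:
  assumes "finite C" "f ` C = C"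
  shows "divergence (mset_set ((\<lambda>v. (v, f v)) ` C)) v = 0"
proof -
  have inj: "inj_on f C" using assms by (simp add: eq_card_imp_inj_on)
  have "divergence (mset_set ((\<lambda>v. (v, f v)) ` C)) v
      = (\<Sum>e\<in>(\<lambda>v. (v, f v)) ` C. of_bool (fst e = v) - of_bool (snd e = v))"
    by (simp add: divergence_def sum_unfold_sum_mset)
  also have "\<dots> = (\<Sum>c\<in>C. of_bool (c = v) - of_bool (f c = v))"
    by (subst sum.reindex) (auto simp: inj_on_def)
  also have "\<dots> = (\<Sum>c\<in>C. of_bool (c = v)) - (\<Sum>c\<in>C. of_bool (f c = v))"
    by (simp add: sum_subtractf)
  also have "(\<Sum>c\<in>C. of_bool (f c = v)) = (\<Sum>c\<in>f ` C. of_bool (c = v) :: int)"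
    using inj by (simp add: sum.reindex)
  finally show ?thesis using assms by simp
qed

text \<open>A chosen successor function \<open>f\<close> permutes any minimal nonempty subset of
  \<open>V\<close> closed under it. The graph of this permutation uses each arc once; its bounded
  size is what later makes it a proper subflow.\<close>

lemma exists_circulation:
  assumes "finite V" "V \<noteq> {}" and out: "\<And>v. v \<in> V \<Longrightarrow> \<exists>u\<in>V. (v, u) \<in># F"
  obtains C where "C \<subseteq># F" "C \<noteq> {#}" "size C \<le> card V" "\<And>v. divergence C v = 0"
proof -
  obtain f where f: "\<And>v. v \<in> V \<Longrightarrow> f v \<in> V \<and> (v, f v) \<in># F" using out by metis
  define closed where "closed = {C. C \<subseteq> V \<and> C \<noteq> {} \<and> f ` C \<subseteq> C}"
  have "V \<in> closed" using f assms(2) by (auto simp: closed_def)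
  moreover have "finite closed"
    using assms(1) by (auto simp: closed_def intro: finite_subset[of _ "Pow V"])
  ultimately obtain C where C: "C \<in> closed" and min: "\<And>D. D \<in> closed \<Longrightarrow> D \<subseteq> C \<Longrightarrow> D = C"
    using finite_has_minimal[of closed] by blast
  have CV: "C \<subseteq> V" "C \<noteq> {}" "f ` C \<subseteq> C" using C by (auto simp: closed_def)
  then have "f ` C \<in> closed" by (auto simp: closed_def)
  then have fC: "f ` C = C" using min CV(3) by blast
  have fin: "finite C" using CV(1) assms(1) finite_subset by blast
  let ?S = "(\<lambda>v. (v, f v)) ` C"
  have "mset_set ?S \<subseteq># mset_set (set_mset F)"
    using f CV fin by (intro subset_imp_msubset_mset_set) auto
  also have "\<dots> \<subseteq># F" by (rule mset_set_set_mset_msubset)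
  finally have 1: "mset_set ?S \<subseteq># F" .
  have 2: "mset_set ?S \<noteq> {#}" using CV(2) fin by (simp add: mset_set_empty_iff)
  have "size (mset_set ?S) \<le> card V"
    using card_image_le[OF fin, of "\<lambda>v. (v, f v)"] card_mono[OF assms(1) CV(1)] by simp
  then show ?thesis using that 1 2 divergence_mset_set_graph[OF fin fC] by blast
qed

text \<open>Numbers are given from the top: a vertex without arcs into the current subset
  \<open>W\<close> receives the largest number. If there were none, \<open>W\<close> would contain a
  circulation, whose size stays within the bound for \<open>V\<close>.\<close>

lemma topological_numbering:
  assumes "finite V"
    and acyclic: "\<And>C. C \<subseteq># F \<Longrightarrow> C \<noteq> {#} \<Longrightarrow> size C \<le> card V \<Longrightarrow> \<exists>v. divergence C v \<noteq> 0"
  obtains h :: "'v \<Rightarrow> nat" where "bij_betw h V {..<card V}"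
    "\<And>a b. a \<in> V \<Longrightarrow> b \<in> V \<Longrightarrow> (a, b) \<in># F \<Longrightarrow> h a < h b"
proof -
  have "\<exists>h. bij_betw h W {..<card W} \<and> (\<forall>a\<in>W. \<forall>b\<in>W. (a, b) \<in># F \<longrightarrow> h a < h b)" if "W \<subseteq> V" for W
    using that
  proof (induction "card W" arbitrary: W)
    case 0
    then have "W = {}" using assms(1) finite_subset[of W V] by simp
    then show ?case by (simp add: bij_betw_def)
  next
    case (Suc n)
    have fin: "finite W" and ne: "W \<noteq> {}" using Suc.hyps(2) by (auto intro: card_ge_0_finite)
    have "\<exists>s\<in>W. \<forall>u\<in>W. (s, u) \<notin># F"
    proof (rule ccontr)
      assume "\<not> ?thesis"
      then obtain C where "C \<subseteq># F" "C \<noteq> {#}" "size C \<le> card W" "\<And>v. divergence C v = 0"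
        using exists_circulation[OF fin ne, of F] by blast
      then show False
        using acyclic[of C] card_mono[OF assms(1) Suc.prems] by auto
    qed
    then obtain s where s: "s \<in> W" "\<forall>u\<in>W. (s, u) \<notin># F" by blast
    have card: "card (W - {s}) = n" using s Suc.hyps(2) by simp
    obtain h where h: "bij_betw h (W - {s}) {..<n}"
      "\<forall>a\<in>W - {s}. \<forall>b\<in>W - {s}. (a, b) \<in># F \<longrightarrow> h a < h b"
      using Suc.hyps(1)[of "W - {s}"] Suc.prems card by auto
    let ?h = "h(s := n)"
    have "bij_betw ?h (W - {s}) {..<n}"
      using h(1) by (subst bij_betw_cong[where g = h]) auto
    then have "bij_betw ?h (insert s (W - {s})) (insert n {..<n})"
      using bij_betw_combine[of ?h "{s}" "{n}" "W - {s}" "{..<n}"] by (simp add: bij_betw_def)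
    moreover have "insert s (W - {s}) = W" "insert n {..<n} = {..<card W}"
      using s Suc.hyps(2) by (auto simp flip: lessThan_Suc)
    moreover have "?h a < ?h b" if "a \<in> W" "b \<in> W" "(a, b) \<in># F" for a b
    proof -
      have "a \<noteq> s" using s that by auto
      moreover have "h a < n" using h(1) \<open>a \<noteq> s\<close> that(1) by (auto simp: bij_betw_def)
      ultimately show ?thesis using h(2) that by auto
    qed
    ultimately show ?case by metis
  qed
  from this[of V] show ?thesis using that by blast
qed

section \<open>Charged flows and the bound for acyclic ones\<close>

definition parity_charge :: "nat \<Rightarrow> int" where
  "parity_charge v = (if v < 3 then 1 else - 1)"

text \<open>Summation by parts. It serves for three potentials: a topological numbering bounds the
  number of arcs, a constant shows that the divergences add up to zero, and the matrix entries at a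
  fixed cell express the table of a flow through its divergence.\<close>

lemma sum_divergence_potential:
  assumes "finite V" "\<And>e. e \<in># F \<Longrightarrow> fst e \<in> V \<and> snd e \<in> V"
  shows "(\<Sum>v\<in>V. h v * divergence F v) = (\<Sum>e\<in>#F. h (fst e) - h (snd e))"
  using assms(2)
proof (induction F)
  case (add e F)
  have "(\<Sum>v\<in>V. h v * divergence (add_mset e F) v)
      = (\<Sum>v\<in>V. h v * of_bool (fst e = v)) - (\<Sum>v\<in>V. h v * of_bool (snd e = v))
        + (\<Sum>v\<in>V. h v * divergence F v)"
    by (simp add: divergence_add_mset algebra_simps sum.distrib sum_subtractf)
  also have "(\<Sum>v\<in>V. h v * of_bool (fst e = v)) = h (fst e)"
    using add.prems assms(1) by (simp add: of_bool_def if_distrib cong: if_cong)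
  also have "(\<Sum>v\<in>V. h v * of_bool (snd e = v)) = h (snd e)"
    using add.prems assms(1) by (simp add: of_bool_def if_distrib cong: if_cong)
  finally show ?case using add by simp
qed simp

lemma sum_lessThan_6:
  fixes f :: "nat \<Rightarrow> 'a :: comm_monoid_add"
  shows "(\<Sum>v<6. f v) = f 0 + f 1 + f 2 + f 3 + f 4 + f 5"
  by (simp add: numeral_eq_Suc)

lemma size_acyclic_flow_le:
  assumes verts: "\<And>e. e \<in># F \<Longrightarrow> fst e < 6 \<and> snd e < (6::nat)"
    and div: "\<And>v. v < 6 \<Longrightarrow> divergence F v = k * parity_charge v"
    and k: "0 \<le> k" "k \<le> 1"
    and acyclic: "\<And>C. C \<subseteq># F \<Longrightarrow> C \<noteq> {#} \<Longrightarrow> size C \<le> 6 \<Longrightarrow> \<exists>v. divergence C v \<noteq> 0"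
  shows "size F \<le> 9"
proof -
  obtain h :: "nat \<Rightarrow> nat" where h: "bij_betw h {..<6} {..<6}"
    and mono: "\<And>a b. a < 6 \<Longrightarrow> b < 6 \<Longrightarrow> (a, b) \<in># F \<Longrightarrow> h a < h b"
    using topological_numbering[of "{..<6}" F] acyclic by auto
  let ?h = "\<lambda>v. int (h v)"
  have "int (size F) = (\<Sum>e\<in>#F. 1)" by simp
  also have "\<dots> \<le> (\<Sum>e\<in>#F. ?h (snd e) - ?h (fst e))"
    using mono verts by (intro sum_mset_mono) force
  also have "\<dots> = - (\<Sum>e\<in>#F. ?h (fst e) - ?h (snd e))"
    by (induction F) auto
  also have "\<dots> = - (\<Sum>v<6. ?h v * divergence F v)"
    using sum_divergence_potential[of "{..<6}" F ?h] verts by simp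
  also have "\<dots> = k * (?h 3 + ?h 4 + ?h 5 - ?h 0 - ?h 1 - ?h 2)"
    by (simp add: sum_lessThan_6 div parity_charge_def algebra_simps)
  finally have size: "int (size F) \<le> k * (?h 3 + ?h 4 + ?h 5 - ?h 0 - ?h 1 - ?h 2)" .
  \<comment> \<open>The values of \<open>h\<close> are 0 to 5 in some order, with sum 15, so sinks
    minus sources is 15 minus twice the sum over the sources, and three distinct naturals sum to at
    least 3.\<close>
  have "(\<Sum>v<6. h v) = (\<Sum>v<6. v)" using sum.reindex_bij_betw[OF h, of "\<lambda>v. v"] .
  then have total: "h 0 + h 1 + h 2 + h 3 + h 4 + h 5 = 15" by (simp only: sum_lessThan_6)
  have "h v \<noteq> h w" if "v < 6" "w < 6" "v \<noteq> w" for v w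
    using that h by (auto simp: bij_betw_def inj_on_def)
  then have "h 0 \<noteq> h 1" "h 0 \<noteq> h 2" "h 1 \<noteq> h 2" by simp_all
  moreover have "x \<noteq> y \<Longrightarrow> x \<noteq> z \<Longrightarrow> y \<noteq> z \<Longrightarrow> x + y + z \<ge> 3" for x y z :: nat by arith
  ultimately have "h 0 + h 1 + h 2 \<ge> 3" by blast
  with total have "?h 3 + ?h 4 + ?h 5 - ?h 0 - ?h 1 - ?h 2 \<le> 9" by linarith
  moreover have "k = 0 \<or> k = 1" using k by arith
  ultimately have "int (size F) \<le> 9" using size by (elim disjE) simp_all
  then show ?thesis by simp
qed

text \<open>Birkhoff's argument in size 3. Rows are the sources 0, 1, 2, columns the sinks 3, 4, 5,
  and the six triples are the bijections between them. Row 0 has a positive entry, and any such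
  entry extends through its complementary minor.\<close>

lemma positive_transversal_3x3:
  fixes m :: "nat \<Rightarrow> nat \<Rightarrow> nat" and k :: nat
  assumes "k > 0"
    and row: "m 0 3 + m 0 4 + m 0 5 = k" "m 1 3 + m 1 4 + m 1 5 = k" "m 2 3 + m 2 4 + m 2 5 = k"
    and col: "m 0 3 + m 1 3 + m 2 3 = k" "m 0 4 + m 1 4 + m 2 4 = k" "m 0 5 + m 1 5 + m 2 5 = k"
  obtains a b c where "(a, b, c) \<in> {(3,4,5), (3,5,4), (4,3,5), (4,5,3), (5,3,4), (5,4,3 :: nat)}"
    "m 0 a > 0" "m 1 b > 0" "m 2 c > 0"
proof -
  \<comment> \<open>If both diagonals of the complementary 2 by 2 minor contained a zero, a row or
    column of the minor would vanish. The whole sum \<open>k\<close> of that line would then sit in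
    column \<open>a\<close> or in row 0, forcing \<open>m 0 a = 0\<close>.\<close>
  have minor: "m 1 b > 0 \<and> m 2 c > 0 \<or> m 1 c > 0 \<and> m 2 b > 0"
    if "m 0 a > 0" "m 0 a + m 0 b + m 0 c = k" "m 1 a + m 1 b + m 1 c = k" "m 2 a + m 2 b + m 2 c = k"
      "m 0 a + m 1 a + m 2 a = k" "m 0 b + m 1 b + m 2 b = k" "m 0 c + m 1 c + m 2 c = k" for a b c
  proof (rule ccontr)
    assume "\<not> ?thesis"
    then consider "m 1 b = 0" "m 1 c = 0" | "m 1 b = 0" "m 2 b = 0" | "m 2 c = 0" "m 1 c = 0"
      | "m 2 c = 0" "m 2 b = 0" by blast
    then show False using that by cases linarith+
  qed
  consider "m 0 3 > 0" | "m 0 4 > 0" | "m 0 5 > 0" using assms(1) row(1) by (metis add_0 gr0I)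
  then show ?thesis
  proof cases
    case 1
    then have "m 1 4 > 0 \<and> m 2 5 > 0 \<or> m 1 5 > 0 \<and> m 2 4 > 0"
      using minor[of 3 4 5] row col by simp
    then show ?thesis using 1 that[of 3 4 5] that[of 3 5 4] by auto
  next
    case 2
    then have "m 1 3 > 0 \<and> m 2 5 > 0 \<or> m 1 5 > 0 \<and> m 2 3 > 0"
      using minor[of 4 3 5] row col by simp
    then show ?thesis using 2 that[of 4 3 5] that[of 4 5 3] by auto
  next
    case 3
    then have "m 1 3 > 0 \<and> m 2 4 > 0 \<or> m 1 4 > 0 \<and> m 2 3 > 0"
      using minor[of 5 3 4] row col by simp
    then show ?thesis using 3 that[of 5 3 4] that[of 5 4 3] by auto
  qed
qed

lemma divergence_eq_counts:
  assumes "\<And>e. e \<in># F \<Longrightarrow> fst e \<in> V \<and> snd e \<in> V" "finite V"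
  shows "divergence F v = (\<Sum>w\<in>V. int (count F (v, w))) - (\<Sum>w\<in>V. int (count F (w, v)))"
  using assms(1)
proof (induction F)
  case (add e F)
  obtain a b where e: "e = (a, b)" by (cases e)
  have ab: "a \<in> V" "b \<in> V" using add.prems[of e] e by auto
  have count: "int (count (add_mset e F) x) = of_bool (fst x = a) * of_bool (snd x = b) + int (count F x)" for x
    by (cases x) (auto simp: e)
  have "(\<Sum>w\<in>V. int (count (add_mset e F) (v, w)))
      = of_bool (a = v) + (\<Sum>w\<in>V. int (count F (v, w)))"
    using ab assms(2) by (simp only: count sum.distrib flip: sum_distrib_left) auto
  moreover have "(\<Sum>w\<in>V. int (count (add_mset e F) (w, v)))
      = of_bool (b = v) + (\<Sum>w\<in>V. int (count F (w, v)))"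
    using ab assms(2) by (simp only: count sum.distrib flip: sum_distrib_right) auto
  ultimately show ?case using add by (auto simp: e divergence_add_mset)
qed simp

text \<open>Deleting loops and merging an arc into \<open>b\<close> with an arc out of \<open>b\<close> reduces to the case where all
  arcs lead from a source to a sink; then the arcs form a \<open>k\<close>-regular bipartite multigraph.\<close>

lemma unit_subflow:
  assumes "\<And>e. e \<in># F \<Longrightarrow> fst e < 6 \<and> snd e < (6::nat)"
    and "\<And>v. v < 6 \<Longrightarrow> divergence F v = k * parity_charge v" and "k > 0"
  shows "\<exists>D. D \<subseteq># F \<and> (\<forall>v<6. divergence D v = parity_charge v)"
  using assms(1,2)
proof (induction "size F" arbitrary: F rule: less_induct)
  case less
  \<comment> \<open>Each reduction removes one arc and keeps all divergences. The
    \<open>path\<close> case allows \<open>a = c\<close>: a 2-cycle then turns into a loop, to be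
    deleted later.\<close>
  consider (loop) a where "(a, a) \<in># F"
    | (path) a b c where "{#(a, b), (b, c)#} \<subseteq># F" "a \<noteq> b" "b \<noteq> c"
    | (bipartite) "\<And>a. (a, a) \<notin># F" "\<And>a b c. a \<noteq> b \<Longrightarrow> b \<noteq> c \<Longrightarrow> \<not> {#(a, b), (b, c)#} \<subseteq># F"
    by blast
  then show ?case
  proof cases
    case loop
    then obtain G where F: "F = add_mset (a, a) G" by (metis insert_DiffM)
    then obtain D where "D \<subseteq># G" "\<forall>v<6. divergence D v = parity_charge v"
      using less.hyps[of G] less.prems by (force simp: divergence_add_mset)
    then show ?thesis using F by (metis subset_mset.order_trans mset_subset_eq_add_right add_mset_add_single union_commute)
  next
    case path
    then obtain G where F: "F = {#(a, b), (b, c)#} + G" by (metis subset_mset.add_diff_inverse)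
    then have "\<exists>D. D \<subseteq># add_mset (a, c) G \<and> (\<forall>v<6. divergence D v = parity_charge v)"
      using less.prems by (intro less.hyps) (force simp: divergence_add_mset)+
    then obtain D where D: "D \<subseteq># add_mset (a, c) G" "\<forall>v<6. divergence D v = parity_charge v"
      by blast
    show ?thesis
    proof (cases "(a, c) \<in># D")
      case True
      \<comment> \<open>The copy of the merged arc in \<open>D\<close> is unrolled into the two arcs
        it stands for.\<close>
      then obtain E where E: "D = add_mset (a, c) E" by (metis insert_DiffM)
      with D F have "{#(a, b), (b, c)#} + E \<subseteq># F" by simp
      moreover have "\<forall>v<6. divergence ({#(a, b), (b, c)#} + E) v = parity_charge v"
        using D(2) E by (auto simp: divergence_add_mset)
      ultimately show ?thesis by blast
    next
      case False
      then have "D \<subseteq># G" using D(1)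
        by (metis diff_single_trivial subset_eq_diff_conv add_mset_add_single)
      then have "D \<subseteq># F" using F by (metis mset_subset_eq_add_right subset_mset.order_trans)
      then show ?thesis using D(2) by blast
    qed
  next
    case bipartite
    have counts: "divergence F v = (\<Sum>w<6. int (count F (v, w))) - (\<Sum>w<6. int (count F (w, v)))" for v
      using less.prems(1) by (intro divergence_eq_counts) auto
    \<comment> \<open>Since \<open>k > 0\<close>, a source has positive net outflow and thus an
      outgoing arc; dually for the sinks below.\<close>
    have src: "\<exists>w. (v, w) \<in># F" if "v < 3" for v
    proof (rule ccontr)
      assume "\<not> ?thesis"
      then have "(\<Sum>w<6. int (count F (v, w))) = 0" by (simp add: not_in_iff)
      then show False using counts[of v] less.prems(2)[of v] that \<open>k > 0\<close> sum_nonneg[of "{..<6}" "\<lambda>w. int (count F (w, v))"]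
        by (auto simp: parity_charge_def)
    qed
    have snk: "\<exists>w. (w, v) \<in># F" if "3 \<le> v" "v < 6" for v
    proof (rule ccontr)
      assume "\<not> ?thesis"
      then have "(\<Sum>w<6. int (count F (w, v))) = 0" by (simp add: not_in_iff)
      then show False using counts[of v] less.prems(2)[of v] that \<open>k > 0\<close> sum_nonneg[of "{..<6}" "\<lambda>w. int (count F (v, w))"]
        by (auto simp: parity_charge_def)
    qed
    have no_path: "\<not> ((a, b) \<in># F \<and> (b, c) \<in># F)" for a b c
    proof
      assume ab: "(a, b) \<in># F \<and> (b, c) \<in># F"
      then have "a \<noteq> b" "b \<noteq> c" using bipartite(1) by auto
      then have "{#(a, b), (b, c)#} \<subseteq># F"
        using ab by (simp add: insert_subset_eq_iff in_diff_count)
      then show False using bipartite(2) \<open>a \<noteq> b\<close> \<open>b \<noteq> c\<close> by blast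
    qed
    \<comment> \<open>An arc into a source could be continued by an arc out of it, and an arc out of
      a sink could be preceded by an arc into it; both contradict \<open>no_path\<close>.\<close>
    have zero: "count F (w, v) = 0" if "v < 3 \<or> 3 \<le> w" "w < 6" for v w
      using that src snk no_path by (meson not_in_iff)
    define m where "m a b = count F (a, b)" for a b
    have eqs: "int (m 0 3) + int (m 0 4) + int (m 0 5) = k" "int (m 1 3) + int (m 1 4) + int (m 1 5) = k"
      "int (m 2 3) + int (m 2 4) + int (m 2 5) = k" "int (m 0 3) + int (m 1 3) + int (m 2 3) = k"
      "int (m 0 4) + int (m 1 4) + int (m 2 4) = k" "int (m 0 5) + int (m 1 5) + int (m 2 5) = k"
      using counts[of 0] counts[of 1] counts[of 2] counts[of 3] counts[of 4] counts[of 5]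
        less.prems(2)[of 0] less.prems(2)[of 1] less.prems(2)[of 2]
        less.prems(2)[of 3] less.prems(2)[of 4] less.prems(2)[of 5]
      by (simp_all add: sum_lessThan_6 zero m_def parity_charge_def)
    obtain a b c where abc: "(a, b, c) \<in> {(3,4,5), (3,5,4), (4,3,5), (4,5,3), (5,3,4), (5,4,3 :: nat)}"
      "m 0 a > 0" "m 1 b > 0" "m 2 c > 0"
      by (rule positive_transversal_3x3[of "nat k" m]) (use eqs \<open>k > 0\<close> in auto)
    let ?D = "{#(0, a), (1, b), (2, c)#}"
    have "?D \<subseteq># F" using abc(2-4) by (auto simp: m_def insert_subset_eq_iff in_diff_count)
    moreover have "divergence ?D v = parity_charge v" if "v < 6" for v
    proof -
      have "divergence ?D v = (of_bool (0 = v) - of_bool (a = v))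
          + ((of_bool (1 = v) - of_bool (b = v)) + (of_bool (2 = v) - of_bool (c = v)))"
        by (simp only: divergence_add_mset divergence_empty fst_conv snd_conv add_0_right)
      also have "\<dots> = of_bool (0 = v) + of_bool (1 = v) + of_bool (2 = v)
          - (of_bool (a = v) + of_bool (b = v) + of_bool (c = v))"
        by (simp only: algebra_simps)
      also have "of_bool (a = v) + of_bool (b = v) + of_bool (c = v)
          = of_bool (v = 3) + of_bool (v = 4) + (of_bool (v = 5) :: int)"
        using abc(1) by (simp only: insert_iff prod.inject empty_iff)
          (elim disjE conjE FalseE; simp only: eq_commute[of _ v] ac_simps)
      also have "of_bool (0 = v) + of_bool (1 = v) + of_bool (2 = v)
          - (of_bool (v = 3) + of_bool (v = 4) + of_bool (v = 5)) = parity_charge v"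
        using that unfolding parity_charge_def by (cases "v < 3") (auto simp: of_bool_def)
      finally show ?thesis .
    qed
    ultimately show ?thesis by (intro exI[of _ ?D] conjI allI impI)
  qed
qed

text \<open>More than nine arcs exceed both the circulations of at most six arcs and the acyclic
  bound for charge at most 1. For nonnegative charge, either a small circulation is a proper subflow
  with \<open>l = 0\<close>, or \<open>k \<ge> 2\<close> and a unit subflow is proper because its
  divergence at vertex 0 is 1.\<close>

lemma proper_subflow:
  assumes verts: "\<And>e. e \<in># F \<Longrightarrow> fst e < 6 \<and> snd e < (6::nat)"
    and div: "\<And>v. v < 6 \<Longrightarrow> divergence F v = k * parity_charge v"
    and size: "size F > 9"
  obtains D l where "D \<subseteq># F" "D \<noteq> {#}" "D \<noteq> F" "\<And>v. v < 6 \<Longrightarrow> divergence D v = l * parity_charge v"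
proof -
  have nonneg: "\<exists>D l. D \<subseteq># F \<and> D \<noteq> {#} \<and> D \<noteq> F \<and> (\<forall>v<6. divergence D v = l * parity_charge v)"
    if verts: "\<And>e. e \<in># F \<Longrightarrow> fst e < 6 \<and> snd e < (6::nat)"
      and div: "\<And>v. v < 6 \<Longrightarrow> divergence F v = k * parity_charge v"
      and size: "size F > 9" and k: "k \<ge> 0" for F k
  proof (rule ccontr)
    assume none: "\<not> ?thesis"
    have acyclic: "\<exists>v. divergence C v \<noteq> 0" if "C \<subseteq># F" "C \<noteq> {#}" "size C \<le> 6" for C
    proof (rule ccontr)
      assume "\<not> ?thesis"
      then have "\<forall>v<6. divergence C v = 0 * parity_charge v" by simp
      moreover have "C \<noteq> F" using that(3) size by auto
      ultimately show False using none that by blast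
    qed
    have "\<not> k \<le> 1" using size_acyclic_flow_le[OF verts div k _ acyclic] size by linarith
    then obtain D where D: "D \<subseteq># F" "\<forall>v<6. divergence D v = parity_charge v"
      using unit_subflow[OF verts div] by auto
    then have "divergence D 0 = 1" by (simp add: parity_charge_def)
    moreover have "divergence F 0 = k" using div[of 0] by (simp add: parity_charge_def)
    ultimately have "D \<noteq> {#}" "D \<noteq> F" using \<open>\<not> k \<le> 1\<close> by auto
    moreover have "\<forall>v<6. divergence D v = 1 * parity_charge v" using D(2) by simp
    ultimately show False using none D(1) by blast
  qed
  show ?thesis
  proof (cases "k \<ge> 0")
    case True
    then show ?thesis using nonneg[OF verts div size] that by blast
  next
    case False
    \<comment> \<open>Reversing all arcs negates every divergence and so exchanges sources and
      sinks.\<close>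
    let ?rev = "image_mset prod.swap"
    have "\<exists>D l. D \<subseteq># ?rev F \<and> D \<noteq> {#} \<and> D \<noteq> ?rev F \<and> (\<forall>v<6. divergence D v = l * parity_charge v)"
      using verts div size False by (intro nonneg[of _ "- k"]) (auto simp: divergence_swap)
    then obtain D l where D: "D \<subseteq># ?rev F" "D \<noteq> {#}" "D \<noteq> ?rev F" "\<forall>v<6. divergence D v = l * parity_charge v"
      by blast
    have rev_rev: "?rev (?rev G) = G" for G :: "(nat \<times> nat) multiset" by (simp add: multiset.map_comp)
    show ?thesis
    proof (rule that[of "?rev D" "- l"])
      show "?rev D \<subseteq># F" using image_mset_subseteq_mono[OF D(1), of prod.swap] rev_rev by simp
      show "?rev D \<noteq> F" using D(3) rev_rev by metis
    qed (use D in \<open>auto simp: divergence_swap\<close>)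
  qed
qed

section \<open>Graver bases and primitive vectors\<close>

definition int_kernel :: "int mat \<Rightarrow> int vec set" where
  "int_kernel A = {z \<in> carrier_vec (dim_col A). A *\<^sub>v z = 0\<^sub>v (dim_row A)}"

definition conformal :: "int vec \<Rightarrow> int vec \<Rightarrow> bool" where
  "conformal y x \<longleftrightarrow> dim_vec y = dim_vec x \<and>
     (\<forall>i<dim_vec x. 0 \<le> y $ i \<and> y $ i \<le> x $ i \<or> x $ i \<le> y $ i \<and> y $ i \<le> 0)"

text \<open>The usual intrinsic description of Graver basis elements: nonzero kernel vectors that
  are minimal in the conformal order. The combinatorial arguments use this form instead of Hilbert
  bases; the equivalence is \<open>primitive_imp_graver\<close> and
  \<open>graver_imp_primitive\<close>.\<close>

definition primitive_vec :: "int mat \<Rightarrow> int vec \<Rightarrow> bool" where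
  "primitive_vec A x \<longleftrightarrow> x \<in> int_kernel A \<and> x \<noteq> 0\<^sub>v (dim_col A) \<and>
     (\<forall>y\<in>int_kernel A. conformal y x \<longrightarrow> y = 0\<^sub>v (dim_col A) \<or> y = x)"

definition l1_norm :: "int vec \<Rightarrow> nat" where
  "l1_norm z = (\<Sum>i<dim_vec z. nat \<bar>z $ i\<bar>)"

lemma int_kernel_carrier: "z \<in> int_kernel A \<Longrightarrow> z \<in> carrier_vec (dim_col A)"
  by (simp add: int_kernel_def)

lemma int_kernel_zero: "0\<^sub>v (dim_col A) \<in> int_kernel A"
  by (auto simp: int_kernel_def)

lemma int_kernel_add: "y \<in> int_kernel A \<Longrightarrow> z \<in> int_kernel A \<Longrightarrow> y + z \<in> int_kernel A"
  by (auto simp: int_kernel_def mult_add_distrib_mat_vec[of A "dim_row A" "dim_col A"])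

lemma int_kernel_diff: "y \<in> int_kernel A \<Longrightarrow> z \<in> int_kernel A \<Longrightarrow> y - z \<in> int_kernel A"
  by (auto simp: int_kernel_def mult_minus_distrib_mat_vec[of A "dim_row A" "dim_col A"])

definition orthant_lattice :: "int mat \<Rightarrow> nat set \<Rightarrow> int vec set" where
  "orthant_lattice A J =
     {z \<in> int_kernel A. \<forall>i<dim_col A. if i \<in> J then z $ i \<le> 0 else z $ i \<ge> 0}"

lemma int_points_orthant_kernel:
  "int_points (dim_col A) (orthant_kernel A J) = orthant_lattice A J"
proof -
  have "map_mat real_of_int A *\<^sub>v map_vec real_of_int z = 0\<^sub>v (dim_row A)
      \<longleftrightarrow> A *\<^sub>v z = 0\<^sub>v (dim_row A)" if "z \<in> carrier_vec (dim_col A)" for z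
  proof -
    have "map_mat real_of_int A *\<^sub>v map_vec real_of_int z = map_vec real_of_int (A *\<^sub>v z)"
      by (rule of_int_hom.mult_mat_vec_hom[symmetric, where n = "dim_col A" and nr = "dim_row A"])
        (use that in auto)
    then show ?thesis by (auto simp: vec_eq_iff)
  qed
  then show ?thesis
    by (auto simp: int_points_def orthant_kernel_def orthant_def orthant_lattice_def int_kernel_def)
qed

lemma is_submonoid_orthant_lattice: "is_submonoid (dim_col A) (orthant_lattice A J)"
proof -
  have "x + y \<in> orthant_lattice A J" if xy: "x \<in> orthant_lattice A J" "y \<in> orthant_lattice A J" for x y
  proof -
    have yc: "y \<in> carrier_vec (dim_col A)" using xy by (auto simp: orthant_lattice_def int_kernel_def)
    have "if i \<in> J then (x + y) $ i \<le> 0 else (x + y) $ i \<ge> 0" if "i < dim_col A" for i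
    proof (cases "i \<in> J")
      case True
      then have "x $ i \<le> 0" "y $ i \<le> 0" using xy that by (auto simp: orthant_lattice_def)
      then show ?thesis using True that yc by simp
    next
      case False
      then have "x $ i \<ge> 0" "y $ i \<ge> 0" using xy that by (auto simp: orthant_lattice_def)
      then show ?thesis using False that yc by simp
    qed
    then show ?thesis using xy int_kernel_add[of x A y] by (simp add: orthant_lattice_def)
  qed
  then show ?thesis
    using int_kernel_zero by (auto simp: is_submonoid_def orthant_lattice_def int_kernel_def)
qed

text \<open>Within one orthant no coordinate cancels. Additivity makes the norm a measure for
  inductions over decompositions.\<close>

lemma l1_norm_add_orthant_lattice:
  assumes "x \<in> orthant_lattice A J" "y \<in> orthant_lattice A J"
  shows "l1_norm (x + y) = l1_norm x + l1_norm y"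
proof -
  have "nat \<bar>x $ i + y $ i\<bar> = nat \<bar>x $ i\<bar> + nat \<bar>y $ i\<bar>" if "i < dim_col A" for i
  proof (cases "i \<in> J")
    case True
    then have "x $ i \<le> 0" "y $ i \<le> 0" using assms that by (auto simp: orthant_lattice_def)
    then show ?thesis by linarith
  next
    case False
    then have "x $ i \<ge> 0" "y $ i \<ge> 0" using assms that by (auto simp: orthant_lattice_def)
    then show ?thesis by linarith
  qed
  moreover have "dim_vec x = dim_col A" "dim_vec y = dim_col A"
    using assms by (auto simp: orthant_lattice_def int_kernel_def)
  ultimately show ?thesis by (simp add: l1_norm_def sum.distrib)
qed

lemma l1_norm_eq_0: "l1_norm x = 0 \<longleftrightarrow> x = 0\<^sub>v (dim_vec x)"
  by (auto simp: l1_norm_def vec_eq_iff)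

text \<open>With \<open>conformal_summand\<close>, this identifies the conformal splittings of
  \<open>x\<close> with its decompositions into two summands in the monoid of its orthant, and thus
  primitivity with irreducibility.\<close>

lemma conformal_orthant_lattice:
  assumes "x \<in> orthant_lattice A J" "y \<in> int_kernel A" "conformal y x"
  shows "y \<in> orthant_lattice A J" "x - y \<in> orthant_lattice A J"
proof -
  have dim: "dim_vec x = dim_col A" "dim_vec y = dim_col A"
    using assms by (auto simp: orthant_lattice_def int_kernel_def)
  have sgn: "if i \<in> J then y $ i \<le> 0 \<and> x $ i \<le> y $ i else y $ i \<ge> 0 \<and> y $ i \<le> x $ i" if "i < dim_col A" for i
    using assms that dim by (cases "i \<in> J") (fastforce simp: orthant_lattice_def conformal_def)+
  show "y \<in> orthant_lattice A J"
    using sgn assms(2) by (auto simp: orthant_lattice_def split: if_splits)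
  have "x \<in> int_kernel A" using assms(1) by (simp add: orthant_lattice_def)
  then show "x - y \<in> orthant_lattice A J"
    using sgn assms(2) dim int_kernel_diff[of x A y]
    by (auto simp: orthant_lattice_def split: if_splits)
qed

lemma conformal_summand:
  assumes "x \<in> orthant_lattice A J" "y \<in> orthant_lattice A J"
  shows "conformal x (x + y)"
proof -
  have dim: "dim_vec x = dim_col A" "dim_vec y = dim_col A"
    using assms by (auto simp: orthant_lattice_def int_kernel_def)
  show ?thesis unfolding conformal_def
  proof (intro conjI allI impI)
    fix i assume "i < dim_vec (x + y)"
    then have i: "i < dim_col A" using dim by simp
    show "0 \<le> x $ i \<and> x $ i \<le> (x + y) $ i \<or> (x + y) $ i \<le> x $ i \<and> x $ i \<le> 0"
      using assms i dim by (cases "i \<in> J") (auto simp: orthant_lattice_def)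
  qed (simp add: dim)
qed

lemma is_submonoid_hull: "A \<subseteq> carrier_vec n \<Longrightarrow> is_submonoid n (is_submonoid n hull A)"
proof -
  assume A: "A \<subseteq> carrier_vec n"
  have "is_submonoid n (carrier_vec n)" by (auto simp: is_submonoid_def)
  with A show ?thesis unfolding hull_def is_submonoid_def by blast
qed

lemma diff_add_cancel_vec:
  "x \<in> carrier_vec n \<Longrightarrow> y \<in> carrier_vec n \<Longrightarrow> y + (x - y) = (x :: int vec)"
  by (intro eq_vecI) auto

text \<open>In the orthant given by the signs of \<open>x\<close>, the primitive vectors form a
  minimal Hilbert basis: a nonzero point that is not primitive splits into two of smaller norm,
  while a primitive one cannot be generated by others.\<close>

lemma primitive_imp_graver:
  assumes "primitive_vec A x"
  shows "x \<in> graver_basis A"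
proof -
  define n where "n = dim_col A"
  define J where "J = {i. i < n \<and> x $ i < 0}"
  define M where "M = orthant_lattice A J"
  define H where "H = {z \<in> M. primitive_vec A z}"
  have M: "is_submonoid n M" unfolding M_def n_def by (rule is_submonoid_orthant_lattice)
  have xM: "x \<in> M"
    using assms by (auto simp: M_def J_def n_def primitive_vec_def orthant_lattice_def)
  have inH: "z \<in> T" if "z \<in> M" "is_submonoid n T" "H \<subseteq> T" for z T
    using that(1)
  proof (induction "l1_norm z" arbitrary: z rule: less_induct)
    case less
    have z: "z \<in> carrier_vec n" "z \<in> int_kernel A"
      using less.prems by (auto simp: M_def n_def orthant_lattice_def int_kernel_def)
    consider "z = 0\<^sub>v n" | "z \<in> H"
      | y where "y \<in> int_kernel A" "conformal y z" "y \<noteq> 0\<^sub>v n" "y \<noteq> z"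
      using less.prems z by (auto simp: H_def primitive_vec_def n_def)
    then show ?case
    proof cases
      case 3
      have y: "y \<in> M" "z - y \<in> M"
        using conformal_orthant_lattice[of z A J y] 3 less.prems by (auto simp: M_def)
      have yc: "y \<in> carrier_vec n" using 3(1) int_kernel_carrier by (auto simp: n_def)
      have sum: "y + (z - y) = z" using yc z by (intro diff_add_cancel_vec)
      have "z - y \<noteq> 0\<^sub>v n"
        using 3(4) yc z sum by (metis right_zero_vec)
      then have "l1_norm (z - y) \<noteq> 0" "l1_norm y \<noteq> 0"
        using 3(3) yc z by (auto simp: l1_norm_eq_0)
      moreover have "l1_norm z = l1_norm y + l1_norm (z - y)"
        using l1_norm_add_orthant_lattice[of y A J "z - y"] y sum by (simp add: M_def)
      ultimately have "y \<in> T" "z - y \<in> T" using less.hyps y by auto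
      then show ?thesis using that(2) sum by (metis is_submonoid_def)
    qed (use that in \<open>auto simp: is_submonoid_def\<close>)
  qed
  have gen: "generates_int_points n (orthant_kernel A J) H"
  proof -
    have "is_submonoid n hull H \<subseteq> M" using M by (intro hull_minimal) (auto simp: H_def)
    moreover have "M \<subseteq> is_submonoid n hull H" using inH by (auto simp: hull_def)
    ultimately show ?thesis
      unfolding generates_int_points_def n_def int_points_orthant_kernel by (auto simp: M_def H_def)
  qed
  have min: "\<not> generates_int_points n (orthant_kernel A J) H'" if sub: "H' \<subset> H" for H'
  proof
    assume "generates_int_points n (orthant_kernel A J) H'"
    then have H': "is_submonoid n hull H' = M"
      by (simp add: generates_int_points_def n_def int_points_orthant_kernel M_def)
    obtain h where h: "h \<in> H" "h \<notin> H'" using sub by blast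
    \<comment> \<open>A primitive \<open>h\<close> is not a sum of two elements of \<open>M\<close>
      different from \<open>h\<close>, so removing it leaves a submonoid, which contains everything
      that \<open>H'\<close> generates.\<close>
    have "is_submonoid n (M - {h})"
      unfolding is_submonoid_def
    proof (intro conjI ballI)
      show "0\<^sub>v n \<in> M - {h}" using h M by (auto simp: H_def is_submonoid_def primitive_vec_def n_def)
      show "M - {h} \<subseteq> carrier_vec n" using M by (auto simp: is_submonoid_def)
      fix a b assume ab: "a \<in> M - {h}" "b \<in> M - {h}"
      then have c: "a \<in> int_kernel A" "a \<in> carrier_vec n" "b \<in> carrier_vec n"
        by (auto simp: M_def n_def orthant_lattice_def int_kernel_def)
      have "a + b \<noteq> h"
      proof
        assume eq: "a + b = h"
        then have "conformal a h" using conformal_summand[of a A J b] ab by (auto simp: M_def)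
        then have "a = 0\<^sub>v n \<or> a = h" using h(1) c by (auto simp: H_def primitive_vec_def n_def)
        then show False using ab eq c by auto
      qed
      then show "a + b \<in> M - {h}" using ab M by (auto simp: is_submonoid_def)
    qed
    then have "is_submonoid n hull H' \<subseteq> M - {h}"
      using h sub by (intro hull_minimal) (auto simp: H_def)
    then show False using H' h by (auto simp: H_def)
  qed
  have "x \<in> H" using xM assms by (simp add: H_def)
  moreover have "J \<in> Pow {..<n}" by (auto simp: J_def)
  moreover have "is_minimal_hilbert_basis n (orthant_kernel A J) H"
    using gen min by (auto simp: is_minimal_hilbert_basis_def)
  moreover have "x \<noteq> 0\<^sub>v n" using assms by (simp add: primitive_vec_def n_def)
  ultimately show ?thesis unfolding graver_basis_def n_def by blast
qed

text \<open>If \<open>x\<close> split conformally, both parts would have smaller norm and would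
  hence be generated without \<open>x\<close>; then \<open>H - {x}\<close> would generate as
  well.\<close>

lemma graver_imp_primitive:
  assumes "x \<in> graver_basis A"
  shows "primitive_vec A x"
proof -
  define n where "n = dim_col A"
  obtain J H where H: "is_minimal_hilbert_basis n (orthant_kernel A J) H" "x \<in> H"
    and x0: "x \<noteq> 0\<^sub>v n"
    using assms unfolding graver_basis_def n_def by blast
  define M where "M = orthant_lattice A J"
  have M: "is_submonoid n M" unfolding M_def n_def by (rule is_submonoid_orthant_lattice)
  have HM: "H \<subseteq> M" "is_submonoid n hull H = M"
    using H(1) by (auto simp: is_minimal_hilbert_basis_def generates_int_points_def n_def
        int_points_orthant_kernel M_def)
  have xM: "x \<in> M" using H(2) HM by blast
  show ?thesis
  proof (rule ccontr)
    assume "\<not> ?thesis"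
    moreover have xk: "x \<in> int_kernel A" using xM by (simp add: M_def orthant_lattice_def)
    ultimately obtain y where y: "y \<in> int_kernel A" "conformal y x" "y \<noteq> 0\<^sub>v n" "y \<noteq> x"
      using x0 by (auto simp: primitive_vec_def n_def)
    have yM: "y \<in> M" "x - y \<in> M"
      using conformal_orthant_lattice[of x A J y] y xM by (auto simp: M_def)
    have c: "y \<in> carrier_vec n" "x \<in> carrier_vec n" using y xk int_kernel_carrier by (auto simp: n_def)
    have sum: "y + (x - y) = x" using c by (intro diff_add_cancel_vec)
    have "x - y \<noteq> 0\<^sub>v n" using y(4) c sum by (metis right_zero_vec)
    then have "l1_norm (x - y) \<noteq> 0" "l1_norm y \<noteq> 0" using y(3) c by (auto simp: l1_norm_eq_0)
    moreover have "l1_norm x = l1_norm y + l1_norm (x - y)"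
      using l1_norm_add_orthant_lattice[of y A J "x - y"] yM sum by (simp add: M_def)
    ultimately have less: "l1_norm y < l1_norm x" "l1_norm (x - y) < l1_norm x" by auto
    let ?T = "is_submonoid n hull (H - {x})"
    have "H - {x} \<subseteq> carrier_vec n" using HM M by (auto simp: is_submonoid_def)
    then have T: "is_submonoid n ?T" by (rule is_submonoid_hull)
    \<comment> \<open>A point of norm below that of \<open>x\<close> cannot use the generator
      \<open>x\<close>. The guarded set expresses this by hull minimality: \<open>x\<close> belongs
      to it vacuously, and additivity of the norm closes it under sums.\<close>
    have "is_submonoid n {m \<in> M. l1_norm m < l1_norm x \<longrightarrow> m \<in> ?T}"
      using M T l1_norm_add_orthant_lattice[of _ A J] by (auto simp: is_submonoid_def M_def)
    moreover have "H \<subseteq> {m \<in> M. l1_norm m < l1_norm x \<longrightarrow> m \<in> ?T}"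
      using HM(1) by (auto intro: hull_inc)
    ultimately have "M \<subseteq> {m \<in> M. l1_norm m < l1_norm x \<longrightarrow> m \<in> ?T}"
      using HM(2) hull_minimal by blast
    then have "y \<in> ?T" "x - y \<in> ?T" using yM less by auto
    then have "x \<in> ?T" using T sum by (metis is_submonoid_def)
    then have "H \<subseteq> ?T" by (auto intro: hull_inc)
    then have "M \<subseteq> ?T" using HM(2) T hull_minimal by blast
    moreover have "?T \<subseteq> M" using HM(2) by (metis Diff_subset hull_mono)
    ultimately have "generates_int_points n (orthant_kernel A J) (H - {x})"
      using HM by (auto simp: generates_int_points_def n_def int_points_orthant_kernel M_def)
    moreover have "H - {x} \<subset> H" using H(2) by blast
    ultimately show False using H(1) by (auto simp: is_minimal_hilbert_basis_def)
  qed
qed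

section \<open>Polynomials and monomial ideals\<close>

lemma pps_add_iff: "s + t \<in> pps n \<longleftrightarrow> s \<in> pps n \<and> t \<in> pps n"
  by (auto simp: pps_def in_keys_iff lookup_add subset_eq)

lemma zero_in_pps [simp]: "0 \<in> pps n"
  by (simp add: pps_def)

lemma keys_power_product [simp]: "Poly_Mapping.keys (power_product t :: pp \<Rightarrow>\<^sub>0 'k::field) = {t}"
  by (simp add: power_product_def)

lemma polynomial_ring_simps [simp]:
  "carrier (polynomial_ring K n) = {p. Poly_Mapping.keys p \<subseteq> pps n}"
  "mult (polynomial_ring K n) = (*)" "add (polynomial_ring K n) = (+)"
  "one (polynomial_ring K n) = 1" "zero (polynomial_ring K n) = 0"
  by (simp_all add: polynomial_ring_def)

lemma keys_mult_pps:
  fixes p q :: "pp \<Rightarrow>\<^sub>0 'k::field"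
  assumes "Poly_Mapping.keys p \<subseteq> pps n" "Poly_Mapping.keys q \<subseteq> pps n"
  shows "Poly_Mapping.keys (p * q) \<subseteq> pps n"
  using keys_mult[of p q] assms by (fastforce simp: pps_add_iff)

lemma cring_polynomial_ring: "cring (polynomial_ring (K :: 'k::field itself) n)"
proof (rule cringI)
  show "abelian_group (polynomial_ring K n)"
  proof (rule abelian_groupI)
    fix x assume "x \<in> carrier (polynomial_ring K n)"
    then show "\<exists>y\<in>carrier (polynomial_ring K n). y \<oplus>\<^bsub>polynomial_ring K n\<^esub> x = \<zero>\<^bsub>polynomial_ring K n\<^esub>"
      by (intro bexI[of _ "- x"]) (auto simp: in_keys_iff)
  qed (use keys_add in \<open>auto simp: ac_simps dest!: subsetD[OF keys_add]\<close>)
  show "comm_monoid (polynomial_ring K n)"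
    using keys_mult_pps by (intro comm_monoidI) (auto simp: ac_simps)
qed (simp add: algebra_simps)

lemma ring_polynomial_ring: "ring (polynomial_ring (K :: 'k::field itself) n)"
  using cring_polynomial_ring by (rule cring.axioms(1))

lemma ideal_polynomial_ringI:
  fixes J :: "(pp \<Rightarrow>\<^sub>0 'k::field) set"
  assumes "\<And>p. p \<in> J \<Longrightarrow> Poly_Mapping.keys p \<subseteq> pps n" "0 \<in> J"
    and "\<And>p q. p \<in> J \<Longrightarrow> q \<in> J \<Longrightarrow> p + q \<in> J"
    and mult: "\<And>p q. p \<in> J \<Longrightarrow> Poly_Mapping.keys q \<subseteq> pps n \<Longrightarrow> q * p \<in> J"
  shows "ideal J (polynomial_ring (K :: 'k itself) n)"
proof -
  interpret cring "polynomial_ring K n" by (rule cring_polynomial_ring)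
  have "inv\<^bsub>add_monoid (polynomial_ring K n)\<^esub> p \<in> J" if p: "p \<in> J" for p
  proof -
    have "\<ominus>\<^bsub>polynomial_ring K n\<^esub> p = - p"
      using assms(1)[OF p] by (intro minus_equality) (auto simp: in_keys_iff)
    moreover have "- p = Poly_Mapping.single 0 (- 1) * p"
      by (simp add: single_uminus)
    ultimately show ?thesis using mult[OF p, of "Poly_Mapping.single 0 (- 1)"] by (simp add: a_inv_def)
  qed
  then have "subgroup J (add_monoid (polynomial_ring K n))"
    using assms by (intro subgroup.intro) auto
  then show ?thesis using mult by (intro idealI) (auto intro: ring_polynomial_ring simp: mult.commute)
qed

lemma power_product_mult:
  "power_product s * power_product t = (power_product (s + t) :: pp \<Rightarrow>\<^sub>0 'k::field)"
  by (simp add: power_product_def mult_single)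

text \<open>The polynomials all of whose power products are multiples of elements of
  \<open>M\<close> form an ideal containing the generators, so membership of a monomial in a
  monomial ideal is divisibility.\<close>

lemma power_product_in_Idl_iff:
  assumes M: "M \<subseteq> pps n" and t: "t \<in> pps n"
  shows "power_product t \<in> Idl\<^bsub>polynomial_ring (K :: 'k::field itself) n\<^esub> (power_product ` M)
    \<longleftrightarrow> (\<exists>m\<in>M. pp_dvd m t)"
proof
  interpret ring "polynomial_ring K n" by (rule ring_polynomial_ring)
  have gens: "power_product ` M \<subseteq> carrier (polynomial_ring K n)" using M by auto
  let ?J = "{p :: pp \<Rightarrow>\<^sub>0 'k. Poly_Mapping.keys p \<subseteq> pps n \<and> (\<forall>s\<in>Poly_Mapping.keys p. \<exists>m\<in>M. pp_dvd m s)}"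
  {
    have "ideal ?J (polynomial_ring K n)"
    proof (rule ideal_polynomial_ringI)
      fix p q :: "pp \<Rightarrow>\<^sub>0 'k" assume "p \<in> ?J" "Poly_Mapping.keys q \<subseteq> pps n"
      moreover have "\<exists>m\<in>M. pp_dvd m (a + b)" if "\<exists>m\<in>M. pp_dvd m b" for a b
        using that by (metis pp_dvd_def add.assoc add.commute)
      ultimately show "q * p \<in> ?J"
        using keys_mult_pps[of q n p] keys_mult[of q p] by blast
    next
      fix p q :: "pp \<Rightarrow>\<^sub>0 'k" assume "p \<in> ?J" "q \<in> ?J"
      then show "p + q \<in> ?J" using keys_add[of p q] by blast
    qed auto
    moreover have "power_product ` M \<subseteq> ?J"
      using M by (auto simp: pp_dvd_def intro!: bexI exI[of _ 0])
    ultimately have "Idl\<^bsub>polynomial_ring K n\<^esub> (power_product ` M) \<subseteq> ?J" by (rule genideal_minimal)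
    moreover assume "power_product t \<in> Idl\<^bsub>polynomial_ring K n\<^esub> (power_product ` M)"
    ultimately show "\<exists>m\<in>M. pp_dvd m t" by auto
  next
    assume "\<exists>m\<in>M. pp_dvd m t"
    then obtain m c where m: "m \<in> M" "t = m + c" by (auto simp: pp_dvd_def)
    then have c: "c \<in> pps n" using t by (simp add: pps_add_iff)
    have "power_product m \<in> Idl\<^bsub>polynomial_ring K n\<^esub> (power_product ` M)"
      using genideal_self[OF gens] m(1) by blast
    then have "power_product m \<otimes>\<^bsub>polynomial_ring K n\<^esub> power_product c \<in> Idl\<^bsub>polynomial_ring K n\<^esub> (power_product ` M)"
      using c by (intro ideal.I_r_closed genideal_ideal[OF gens]) auto
    then show "power_product t \<in> Idl\<^bsub>polynomial_ring K n\<^esub> (power_product ` M)"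
      by (simp add: m(2) power_product_mult)
  }
qed

section \<open>Leading power products\<close>

context
  fixes n :: nat and r :: "pp rel"
  assumes order: "term_ordering n r"
begin

lemma term_ordering_refl: "t \<in> pps n \<Longrightarrow> (t, t) \<in> r"
  using order by (auto simp: term_ordering_def linear_order_on_def partial_order_on_def preorder_on_def refl_on_def)

lemma term_ordering_antisym: "(s, t) \<in> r \<Longrightarrow> (t, s) \<in> r \<Longrightarrow> s = t"
  using order by (auto simp: term_ordering_def linear_order_on_def partial_order_on_def antisym_def)

lemma term_ordering_trans: "(s, t) \<in> r \<Longrightarrow> (t, u) \<in> r \<Longrightarrow> (s, u) \<in> r"
  using order by (auto simp: term_ordering_def linear_order_on_def partial_order_on_def preorder_on_def elim: transE)

lemma term_ordering_total: "s \<in> pps n \<Longrightarrow> t \<in> pps n \<Longrightarrow> (s, t) \<in> r \<or> (t, s) \<in> r"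
  using order term_ordering_refl[of s] by (cases "s = t") (auto simp: term_ordering_def linear_order_on_def total_on_def)

lemma term_ordering_add: "(s, t) \<in> r \<Longrightarrow> c \<in> pps n \<Longrightarrow> (s + c, t + c) \<in> r"
  using order by (auto simp: term_ordering_def)

lemma term_ordering_zero: "t \<in> pps n \<Longrightarrow> (0, t) \<in> r"
  using order by (auto simp: term_ordering_def)

lemma finite_term_ordering_max:
  assumes "finite S" "S \<noteq> {}" "S \<subseteq> pps n"
  shows "\<exists>t\<in>S. \<forall>s\<in>S. (s, t) \<in> r"
  using assms
proof (induction S rule: finite_ne_induct)
  case (singleton x)
  then show ?case using term_ordering_refl by auto
next
  case (insert x S)
  then obtain t where t: "t \<in> S" "\<forall>s\<in>S. (s, t) \<in> r" by auto
  show ?case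
  proof (cases "(x, t) \<in> r")
    case False
    then have "(t, x) \<in> r" using term_ordering_total[of x t] insert.prems t by auto
    then show ?thesis using t insert.prems term_ordering_refl term_ordering_trans by blast
  qed (use t in auto)
qed

lemma finite_term_ordering_min:
  assumes "finite S" "S \<noteq> {}" "S \<subseteq> pps n"
  shows "\<exists>t\<in>S. \<forall>s\<in>S. (t, s) \<in> r"
  using assms
proof (induction S rule: finite_ne_induct)
  case (singleton x)
  then show ?case using term_ordering_refl by auto
next
  case (insert x S)
  then obtain t where t: "t \<in> S" "\<forall>s\<in>S. (t, s) \<in> r" by auto
  show ?case
  proof (cases "(t, x) \<in> r")
    case False
    then have "(x, t) \<in> r" using term_ordering_total[of x t] insert.prems t by auto
    then show ?thesis using t insert.prems term_ordering_refl term_ordering_trans by blast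
  qed (use t in auto)
qed

lemma leading_pp_eqI:
  assumes "t \<in> Poly_Mapping.keys p" "\<And>s. s \<in> Poly_Mapping.keys p \<Longrightarrow> (s, t) \<in> r"
  shows "leading_pp r p = t"
  unfolding leading_pp_def using assms term_ordering_antisym by (intro the_equality) auto

lemma leading_pp_in_keys:
  assumes "p \<noteq> 0" "Poly_Mapping.keys p \<subseteq> pps n"
  shows "leading_pp r p \<in> Poly_Mapping.keys p"
    and "s \<in> Poly_Mapping.keys p \<Longrightarrow> (s, leading_pp r p) \<in> r"
proof -
  obtain t where t: "t \<in> Poly_Mapping.keys p" "\<forall>s\<in>Poly_Mapping.keys p. (s, t) \<in> r"
    using finite_term_ordering_max[of "Poly_Mapping.keys p"] assms by auto
  then have "leading_pp r p = t" by (intro leading_pp_eqI) auto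
  with t show "leading_pp r p \<in> Poly_Mapping.keys p"
    "s \<in> Poly_Mapping.keys p \<Longrightarrow> (s, leading_pp r p) \<in> r" by auto
qed

lemma power_product_in_initial_ideal_iff:
  fixes F :: "(pp \<Rightarrow>\<^sub>0 'k::field) set"
  assumes F: "\<And>f. f \<in> F \<Longrightarrow> Poly_Mapping.keys f \<subseteq> pps n" and t: "t \<in> pps n"
  shows "power_product t \<in> initial_ideal n r F \<longleftrightarrow> (\<exists>f\<in>F - {0}. pp_dvd (leading_pp r f) t)"
proof -
  have "leading_pp r ` (F - {0}) \<subseteq> pps n" using leading_pp_in_keys(1) F by blast
  moreover have "{power_product (leading_pp r f) |f. f \<in> F - {0}}
      = (power_product ` leading_pp r ` (F - {0}) :: (pp \<Rightarrow>\<^sub>0 'k) set)" by auto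
  ultimately show ?thesis
    using power_product_in_Idl_iff[of "leading_pp r ` (F - {0})" n t "TYPE('k)"] t
    by (simp add: initial_ideal_def)
qed

end

section \<open>Toric ideals\<close>

lemma keys_binomial:
  "s \<noteq> t \<Longrightarrow> Poly_Mapping.keys (power_product s - power_product t :: pp \<Rightarrow>\<^sub>0 'k::field) = {s, t}"
  by (auto simp: in_keys_iff power_product_def lookup_minus lookup_single when_def split: if_splits)

lemma binomial_nonzero: "s \<noteq> t \<Longrightarrow> power_product s - power_product t \<noteq> (0 :: pp \<Rightarrow>\<^sub>0 'k::field)"
  using keys_binomial[of s t] by (metis keys_zero insert_not_empty)

definition pp_vec :: "nat \<Rightarrow> pp \<Rightarrow> int vec" where
  "pp_vec n t = vec n (\<lambda>i. int (Poly_Mapping.lookup t i))"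

text \<open>The fibers are the degree classes of the grading by \<open>A\<close>
  (\<open>same_fiber_iff\<close>), for which the toric ideal is homogeneous.\<close>

definition same_fiber :: "int mat \<Rightarrow> pp \<Rightarrow> pp \<Rightarrow> bool" where
  "same_fiber A s t \<longleftrightarrow> pp_vec (dim_col A) s - pp_vec (dim_col A) t \<in> int_kernel A"

lemma pp_vec_carrier [simp]: "pp_vec n t \<in> carrier_vec n"
  by (simp add: pp_vec_def)

lemma dim_pp_vec [simp]: "dim_vec (pp_vec n t) = n"
  by (simp add: pp_vec_def)

lemma lookup_exponent:
  "Poly_Mapping.lookup (exponent u) i = (if i < dim_vec u then nat (u $ i) else 0)"
  by (auto simp: exponent_def lookup_sum lookup_single when_def if_distrib cong: if_cong)

lemma exponent_in_pps [simp]: "u \<in> carrier_vec n \<Longrightarrow> exponent u \<in> pps n"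
  by (auto simp: pps_def in_keys_iff lookup_exponent split: if_splits)

lemma exponent_pp_vec: "t \<in> pps n \<Longrightarrow> exponent (pp_vec n t) = t"
  by (intro poly_mapping_eqI) (auto simp: lookup_exponent pp_vec_def pps_def in_keys_iff subset_eq)

lemma pp_vec_exponent:
  "u \<in> carrier_vec n \<Longrightarrow> (\<And>i. i < n \<Longrightarrow> u $ i \<ge> 0) \<Longrightarrow> pp_vec n (exponent u) = u"
  by (intro eq_vecI) (auto simp: lookup_exponent pp_vec_def)

lemma same_fiber_iff:
  "same_fiber A s t \<longleftrightarrow> A *\<^sub>v pp_vec (dim_col A) s = A *\<^sub>v pp_vec (dim_col A) t"
proof -
  have "A *\<^sub>v (pp_vec (dim_col A) s - pp_vec (dim_col A) t)
      = A *\<^sub>v pp_vec (dim_col A) s - A *\<^sub>v pp_vec (dim_col A) t"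
    by (rule mult_minus_distrib_mat_vec[of A "dim_row A" "dim_col A"]) auto
  moreover have "a - b = 0\<^sub>v m \<longleftrightarrow> a = b" if "a \<in> carrier_vec m" "b \<in> carrier_vec m" for a b :: "int vec" and m
    using that diff_add_cancel_vec[of a m b] by auto
  moreover have "A *\<^sub>v pp_vec (dim_col A) u \<in> carrier_vec (dim_row A)" for u
    by (intro mult_mat_vec_carrier[of A _ "dim_col A"]) auto
  ultimately show ?thesis by (simp add: same_fiber_def int_kernel_def)
qed

lemma same_fiber_refl [simp]: "same_fiber A s s"
  by (simp add: same_fiber_iff)

lemma same_fiber_sym: "same_fiber A s t \<Longrightarrow> same_fiber A t s"
  by (simp add: same_fiber_iff)

lemma same_fiber_trans: "same_fiber A s t \<Longrightarrow> same_fiber A t u \<Longrightarrow> same_fiber A s u"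
  by (simp add: same_fiber_iff)

lemma same_fiber_add_cancel: "same_fiber A (c + s) (c + t) \<longleftrightarrow> same_fiber A s t"
proof -
  have "pp_vec (dim_col A) (c + s) - pp_vec (dim_col A) (c + t) = pp_vec (dim_col A) s - pp_vec (dim_col A) t"
    by (intro eq_vecI) (auto simp: pp_vec_def lookup_add)
  then show ?thesis by (simp add: same_fiber_def)
qed

section \<open>Coefficient sums over fibers\<close>

lemma poly_eq_sum_singles:
  "f = (\<Sum>s\<in>Poly_Mapping.keys f. Poly_Mapping.single s (Poly_Mapping.lookup f s))"
proof (rule poly_mapping_eqI)
  fix k
  show "Poly_Mapping.lookup f k
      = Poly_Mapping.lookup (\<Sum>s\<in>Poly_Mapping.keys f. Poly_Mapping.single s (Poly_Mapping.lookup f s)) k"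
    by (simp add: lookup_sum lookup_single when_def in_keys_iff)
qed

text \<open>A coefficient of the image of \<open>f\<close> under the homomorphism sending
  \<open>x^s\<close> to \<open>y^(A s)\<close>, whose kernel is the toric ideal. Working with
  coefficients avoids a target ring with possibly negative exponents.\<close>

definition fiber_sum :: "int mat \<Rightarrow> pp \<Rightarrow> (pp \<Rightarrow>\<^sub>0 'k::field) \<Rightarrow> 'k" where
  "fiber_sum A t f = (\<Sum>s\<in>Poly_Mapping.keys f. if same_fiber A s t then Poly_Mapping.lookup f s else 0)"

lemma fiber_sum_zero [simp]: "fiber_sum A t 0 = 0"
  by (simp add: fiber_sum_def)

lemma fiber_sum_add: "fiber_sum A t (f + g) = fiber_sum A t f + fiber_sum A t g"
  unfolding fiber_sum_def
  by (rule setsum_keys_plus_distrib[of "\<lambda>s c. if same_fiber A s t then c else 0"]) auto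

lemma fiber_sum_sum: "fiber_sum A t (\<Sum>i\<in>I. f i) = (\<Sum>i\<in>I. fiber_sum A t (f i))"
  by (induction I rule: infinite_finite_induct) (auto simp: fiber_sum_add)

lemma fiber_sum_single: "fiber_sum A t (Poly_Mapping.single s c) = (if same_fiber A s t then c else 0)"
  by (cases "c = 0") (auto simp: fiber_sum_def)

lemma fiber_sum_mult:
  assumes zero: "\<And>t. fiber_sum A t f = 0"
  shows "fiber_sum A t (g * f) = 0"
proof -
  have "g * f = (\<Sum>a\<in>Poly_Mapping.keys g. \<Sum>b\<in>Poly_Mapping.keys f.
      Poly_Mapping.single (a + b) (Poly_Mapping.lookup g a * Poly_Mapping.lookup f b))"
    by (subst poly_eq_sum_singles[of g], subst poly_eq_sum_singles[of f])
      (simp add: sum_product mult_single)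
  then have "fiber_sum A t (g * f) = (\<Sum>a\<in>Poly_Mapping.keys g. \<Sum>b\<in>Poly_Mapping.keys f.
      if same_fiber A (a + b) t then Poly_Mapping.lookup g a * Poly_Mapping.lookup f b else 0)"
    by (simp add: fiber_sum_sum fiber_sum_single)
  also have "\<dots> = (\<Sum>a\<in>Poly_Mapping.keys g. Poly_Mapping.lookup g a * (\<Sum>b\<in>Poly_Mapping.keys f.
      if same_fiber A (a + b) t then Poly_Mapping.lookup f b else 0))"
    by (simp add: sum_distrib_left if_distrib cong: if_cong)
  also have "\<dots> = (\<Sum>a\<in>Poly_Mapping.keys g. Poly_Mapping.lookup g a * 0)"
  proof (intro sum.cong arg_cong2[where f = "(*)"] refl)
    fix a
    show "(\<Sum>b\<in>Poly_Mapping.keys f. if same_fiber A (a + b) t then Poly_Mapping.lookup f b else 0) = 0"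
    \<comment> \<open>Multiplication by the power product \<open>a\<close> preserves and reflects
      the fiber relation, so the \<open>b\<close> with \<open>a + b\<close> in the fiber of
      \<open>t\<close> form one fiber or none.\<close>
    proof (cases "\<exists>b0. same_fiber A (a + b0) t")
      case True
      then obtain b0 where "same_fiber A (a + b0) t" by blast
      then have "same_fiber A (a + b) t \<longleftrightarrow> same_fiber A b b0" for b
        using same_fiber_add_cancel same_fiber_trans same_fiber_sym by meson
      then show ?thesis using zero[of b0] by (simp add: fiber_sum_def)
    qed simp
  qed
  finally show ?thesis by simp
qed

definition toric_generators :: "int mat \<Rightarrow> (pp \<Rightarrow>\<^sub>0 'k::field) set" where
  "toric_generators A =
     {power_product s - power_product t | s t. s \<in> pps (dim_col A) \<and> t \<in> pps (dim_col A) \<and> same_fiber A s t}"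

lemma toric_ideal_eq:
  "toric_ideal (K :: 'k::field itself) A
    = Idl\<^bsub>polynomial_ring K (dim_col A)\<^esub> (toric_generators A :: (pp \<Rightarrow>\<^sub>0 'k) set)"
proof -
  have "{power_product (exponent u) - power_product (exponent v) | u v.
          u \<in> carrier_vec (dim_col A) \<and> v \<in> carrier_vec (dim_col A) \<and>
          (\<forall>i<dim_col A. u $ i \<ge> 0 \<and> v $ i \<ge> 0) \<and> A *\<^sub>v u = A *\<^sub>v v}
      = (toric_generators A :: (pp \<Rightarrow>\<^sub>0 'k) set)"
    (is "?L = _")
  proof (intro equalityI subsetI)
    fix p :: "pp \<Rightarrow>\<^sub>0 'k" assume "p \<in> ?L"
    then obtain u v where p: "p = power_product (exponent u) - power_product (exponent v)"
      and u: "u \<in> carrier_vec (dim_col A)" "\<And>i. i < dim_col A \<Longrightarrow> u $ i \<ge> 0"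
      and v: "v \<in> carrier_vec (dim_col A)" "\<And>i. i < dim_col A \<Longrightarrow> v $ i \<ge> 0"
      and eq: "A *\<^sub>v u = A *\<^sub>v v" by blast
    have "same_fiber A (exponent u) (exponent v)"
      using eq unfolding same_fiber_iff by (simp only: pp_vec_exponent[OF u] pp_vec_exponent[OF v])
    then show "p \<in> toric_generators A"
      unfolding toric_generators_def using p exponent_in_pps[OF u(1)] exponent_in_pps[OF v(1)] by blast
  next
    fix p :: "pp \<Rightarrow>\<^sub>0 'k" assume "p \<in> toric_generators A"
    then obtain s t where p: "p = power_product s - power_product t" and s: "s \<in> pps (dim_col A)"
      and t: "t \<in> pps (dim_col A)" and eq: "same_fiber A s t" by (auto simp: toric_generators_def)
    have "p = power_product (exponent (pp_vec (dim_col A) s)) - power_product (exponent (pp_vec (dim_col A) t))"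
      using p s t by (simp only: exponent_pp_vec)
    moreover have "\<forall>i<dim_col A. pp_vec (dim_col A) s $ i \<ge> 0 \<and> pp_vec (dim_col A) t $ i \<ge> 0"
      by (simp add: pp_vec_def)
    ultimately show "p \<in> ?L" using eq pp_vec_carrier unfolding same_fiber_iff by blast
  qed
  then show ?thesis unfolding toric_ideal_def by (rule arg_cong)
qed

lemma toric_generators_carrier:
  "toric_generators A \<subseteq> carrier (polynomial_ring (K :: 'k::field itself) (dim_col A))"
proof
  fix p :: "pp \<Rightarrow>\<^sub>0 'k" assume "p \<in> toric_generators A"
  then obtain s t where "p = power_product s - power_product t" "s \<in> pps (dim_col A)" "t \<in> pps (dim_col A)"
    by (auto simp: toric_generators_def)
  then show "p \<in> carrier (polynomial_ring K (dim_col A))"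
    using keys_diff[of "power_product s :: pp \<Rightarrow>\<^sub>0 'k" "power_product t"] by auto
qed

lemma binomial_in_toric_ideal:
  fixes K :: "'k::field itself"
  assumes "s \<in> pps (dim_col A)" "t \<in> pps (dim_col A)" "same_fiber A s t"
  shows "power_product s - power_product t \<in> toric_ideal K A"
proof -
  interpret ring "polynomial_ring K (dim_col A)" by (rule ring_polynomial_ring)
  show ?thesis
    unfolding toric_ideal_eq using genideal_self[OF toric_generators_carrier] assms
    by (force simp: toric_generators_def)
qed

text \<open>Vanishing of all fiber sums defines an ideal, and it contains the generating binomials
  because their two terms cancel inside one fiber.\<close>

lemma toric_ideal_subset:
  fixes K :: "'k::field itself"
  assumes "f \<in> toric_ideal K A"
  shows "Poly_Mapping.keys f \<subseteq> pps (dim_col A)" "fiber_sum A t f = 0"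
proof -
  interpret ring "polynomial_ring K (dim_col A)" by (rule ring_polynomial_ring)
  let ?J = "{f :: pp \<Rightarrow>\<^sub>0 'k. Poly_Mapping.keys f \<subseteq> pps (dim_col A) \<and> (\<forall>t. fiber_sum A t f = 0)}"
  have "ideal ?J (polynomial_ring K (dim_col A))"
  proof (rule ideal_polynomial_ringI)
    fix p q :: "pp \<Rightarrow>\<^sub>0 'k" assume "p \<in> ?J" "q \<in> ?J"
    then show "p + q \<in> ?J" using keys_add[of p q] by (auto simp: fiber_sum_add)
  next
    fix p q :: "pp \<Rightarrow>\<^sub>0 'k" assume "p \<in> ?J" "Poly_Mapping.keys q \<subseteq> pps (dim_col A)"
    then show "q * p \<in> ?J" using keys_mult_pps[of q "dim_col A" p] by (auto simp: fiber_sum_mult)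
  qed auto
  moreover have "toric_generators A \<subseteq> ?J"
  proof
    fix p :: "pp \<Rightarrow>\<^sub>0 'k" assume p: "p \<in> toric_generators A"
    then obtain s t where st: "p = power_product s - power_product t" "same_fiber A s t"
      by (auto simp: toric_generators_def)
    have "p = Poly_Mapping.single s 1 + Poly_Mapping.single t (- 1)"
      by (simp add: st power_product_def single_uminus)
    moreover have "same_fiber A s u \<longleftrightarrow> same_fiber A t u" for u
      using st(2) by (simp add: same_fiber_iff)
    ultimately have "fiber_sum A u p = 0" for u
      by (simp add: fiber_sum_add fiber_sum_single)
    moreover have "Poly_Mapping.keys p \<subseteq> pps (dim_col A)"
      using toric_generators_carrier[of A K] p by auto
    ultimately show "p \<in> ?J" by simp
  qed
  ultimately have "toric_ideal K A \<subseteq> ?J" unfolding toric_ideal_eq by (rule genideal_minimal)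
  then show "Poly_Mapping.keys f \<subseteq> pps (dim_col A)" "fiber_sum A t f = 0" using assms by auto
qed

section \<open>Groebner bases of toric ideals\<close>

text \<open>By \<open>power_product_in_initial_toric_iff\<close> these are exactly the monomials of
  the initial ideal. Questions about leading terms of arbitrary toric polynomials thereby become
  comparisons within a fiber.\<close>

definition nonstandard :: "int mat \<Rightarrow> pp rel \<Rightarrow> pp \<Rightarrow> bool" where
  "nonstandard A r t \<longleftrightarrow> (\<exists>s\<in>pps (dim_col A). same_fiber A s t \<and> s \<noteq> t \<and> (s, t) \<in> r)"

text \<open>The coefficients of \<open>f\<close> on the fiber of its leading power product sum to
  zero, so a second power product of \<open>f\<close> lies in that fiber, and it is smaller.\<close>

lemma leading_pp_toric_nonstandard:
  fixes K :: "'k::field itself"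
  assumes order: "term_ordering (dim_col A) r" and f: "f \<in> toric_ideal K A" "f \<noteq> 0"
  shows "nonstandard A r (leading_pp r f)"
proof -
  let ?t = "leading_pp r f"
  note carr = toric_ideal_subset(1)[OF f(1)]
  note lead = leading_pp_in_keys[OF order f(2) carr]
  have "\<exists>s\<in>Poly_Mapping.keys f. s \<noteq> ?t \<and> same_fiber A s ?t"
  proof (rule ccontr)
    assume none: "\<not> ?thesis"
    have "fiber_sum A ?t f = (\<Sum>s\<in>Poly_Mapping.keys f. if s = ?t then Poly_Mapping.lookup f s else 0)"
      unfolding fiber_sum_def using none by (intro sum.cong) auto
    also have "\<dots> = Poly_Mapping.lookup f ?t" using lead(1) by simp
    finally show False using toric_ideal_subset(2)[OF f(1)] lead(1) by (simp add: in_keys_iff)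
  qed
  then show ?thesis using lead(2) carr by (auto simp: nonstandard_def)
qed

lemma leading_pp_binomial:
  assumes order: "term_ordering n r" and st: "s \<in> pps n" "(s, t) \<in> r" "s \<noteq> t" "t \<in> pps n"
  shows "leading_pp r (power_product t - power_product s :: pp \<Rightarrow>\<^sub>0 'k::field) = t"
  using st term_ordering_refl[OF order] by (intro leading_pp_eqI[OF order]) (auto simp: keys_binomial)

lemma nonstandard_add:
  assumes order: "term_ordering (dim_col A) r" and "nonstandard A r t" "c \<in> pps (dim_col A)"
  shows "nonstandard A r (t + c)"
proof -
  obtain s where s: "s \<in> pps (dim_col A)" "same_fiber A s t" "s \<noteq> t" "(s, t) \<in> r"
    using assms(2) by (auto simp: nonstandard_def)
  then have "same_fiber A (s + c) (t + c)"
    using same_fiber_add_cancel[of A c s t] by (simp add: add.commute)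
  then show ?thesis
    unfolding nonstandard_def using s assms(3) term_ordering_add[OF order]
    by (intro bexI[of _ "s + c"]) (auto simp: pps_add_iff)
qed

lemma power_product_in_initial_toric_iff:
  fixes K :: "'k::field itself"
  assumes order: "term_ordering (dim_col A) r" and t: "t \<in> pps (dim_col A)"
  shows "power_product t \<in> initial_ideal (dim_col A) r (toric_ideal K A) \<longleftrightarrow> nonstandard A r t"
proof -
  have "(\<exists>f\<in>toric_ideal K A - {0}. pp_dvd (leading_pp r f) t) \<longleftrightarrow> nonstandard A r t"
  proof
    assume "\<exists>f\<in>toric_ideal K A - {0}. pp_dvd (leading_pp r f) t"
    then obtain f c where f: "f \<in> toric_ideal K A" "f \<noteq> 0" "t = leading_pp r f + c"
      by (auto simp: pp_dvd_def)
    then show "nonstandard A r t"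
      using nonstandard_add[OF order leading_pp_toric_nonstandard[OF order f(1,2)]] t
      by (simp add: pps_add_iff)
  next
    assume "nonstandard A r t"
    then obtain s where s: "s \<in> pps (dim_col A)" "same_fiber A s t" "s \<noteq> t" "(s, t) \<in> r"
      by (auto simp: nonstandard_def)
    let ?f = "power_product t - power_product s :: pp \<Rightarrow>\<^sub>0 'k"
    have "?f \<in> toric_ideal K A - {0}"
      using binomial_in_toric_ideal[OF t s(1) same_fiber_sym[OF s(2)], of K] binomial_nonzero[of t s] s(3)
      by blast
    moreover have "pp_dvd (leading_pp r ?f) t"
      by (subst leading_pp_binomial[OF order s(1,4,3) t]) (auto simp: pp_dvd_def intro: exI[of _ 0])
    ultimately show "\<exists>f\<in>toric_ideal K A - {0}. pp_dvd (leading_pp r f) t" by blast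
  qed
  then show ?thesis
    using toric_ideal_subset(1)[of _ K A]
    by (subst power_product_in_initial_ideal_iff[OF order _ t]) auto
qed

lemma groebner_basis_nonstandard_iff:
  fixes K :: "'k::field itself"
  assumes order: "term_ordering (dim_col A) r"
    and G: "is_groebner_basis (dim_col A) r (toric_ideal K A) G" and t: "t \<in> pps (dim_col A)"
  shows "nonstandard A r t \<longleftrightarrow> (\<exists>g\<in>G - {0}. pp_dvd (leading_pp r g) t)"
proof -
  have "power_product t \<in> initial_ideal (dim_col A) r G \<longleftrightarrow> (\<exists>g\<in>G - {0}. pp_dvd (leading_pp r g) t)"
    using G toric_ideal_subset(1)
    by (intro power_product_in_initial_ideal_iff[OF order _ t]) (auto simp: is_groebner_basis_def)
  then show ?thesis
    using G power_product_in_initial_toric_iff[OF order t, of K] by (simp add: is_groebner_basis_def)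
qed

section \<open>Binomials of reduced Groebner bases are primitive\<close>

lemma pos_part_carrier [simp]: "pos_part w \<in> carrier_vec n \<longleftrightarrow> w \<in> carrier_vec n"
  and neg_part_carrier [simp]: "neg_part w \<in> carrier_vec n \<longleftrightarrow> w \<in> carrier_vec n"
  by (simp_all add: pos_part_def neg_part_def)

lemma lookup_exponent_parts:
  "i < dim_vec w \<Longrightarrow> Poly_Mapping.lookup (exponent (pos_part w)) i = nat (w $ i)"
  "i < dim_vec w \<Longrightarrow> Poly_Mapping.lookup (exponent (neg_part w)) i = nat (- (w $ i))"
  "i \<ge> dim_vec w \<Longrightarrow> Poly_Mapping.lookup (exponent (pos_part w)) i = 0"
  "i \<ge> dim_vec w \<Longrightarrow> Poly_Mapping.lookup (exponent (neg_part w)) i = 0"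
  by (auto simp: lookup_exponent pos_part_def neg_part_def)

lemma same_fiber_parts:
  assumes "w \<in> int_kernel A"
  shows "same_fiber A (exponent (pos_part w)) (exponent (neg_part w))"
proof -
  have c: "w \<in> carrier_vec (dim_col A)" using assms by (rule int_kernel_carrier)
  have "pp_vec (dim_col A) (exponent (pos_part w)) - pp_vec (dim_col A) (exponent (neg_part w)) = w"
    using c by (intro eq_vecI) (auto simp: pp_vec_def lookup_exponent_parts)
  then show ?thesis using assms by (simp add: same_fiber_def)
qed

lemma exponent_parts_neq:
  assumes "w \<in> carrier_vec n" "w \<noteq> 0\<^sub>v n"
  shows "exponent (pos_part w) \<noteq> exponent (neg_part w)"
proof
  assume eq: "exponent (pos_part w) = exponent (neg_part w)"
  have "w $ i = 0" if "i < n" for i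
    using arg_cong[OF eq, of "\<lambda>p. Poly_Mapping.lookup p i"] that assms(1) by (auto simp: lookup_exponent_parts)
  then show False using assms by (auto intro!: eq_vecI)
qed

lemma pp_dvd_iff: "pp_dvd s t \<longleftrightarrow> (\<forall>i. Poly_Mapping.lookup s i \<le> Poly_Mapping.lookup t i)"
proof
  assume "\<forall>i. Poly_Mapping.lookup s i \<le> Poly_Mapping.lookup t i"
  then have "t = s + (t - s)" by (intro poly_mapping_eqI) (simp add: lookup_add lookup_minus)
  then show "pp_dvd s t" unfolding pp_dvd_def by blast
qed (auto simp: pp_dvd_def lookup_add)

lemma pp_dvd_antisym: "pp_dvd s t \<Longrightarrow> pp_dvd t s \<Longrightarrow> s = t"
  by (auto simp: pp_dvd_iff intro!: poly_mapping_eqI le_antisym)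

lemma pp_dvd_trans: "pp_dvd s t \<Longrightarrow> pp_dvd t u \<Longrightarrow> pp_dvd s u"
  by (meson pp_dvd_iff order_trans)

lemma conformal_parts_dvd:
  assumes "conformal v w"
  shows "pp_dvd (exponent (pos_part v)) (exponent (pos_part w))"
    and "pp_dvd (exponent (neg_part v)) (exponent (neg_part w))"
proof -
  have "nat (v $ i) \<le> nat (w $ i) \<and> nat (- (v $ i)) \<le> nat (- (w $ i))" if "i < dim_vec w" for i
    using assms that unfolding conformal_def by force
  moreover have dim: "dim_vec v = dim_vec w" using assms by (simp add: conformal_def)
  ultimately have "Poly_Mapping.lookup (exponent (pos_part v)) i \<le> Poly_Mapping.lookup (exponent (pos_part w)) i
    \<and> Poly_Mapping.lookup (exponent (neg_part v)) i \<le> Poly_Mapping.lookup (exponent (neg_part w)) i" for i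
    by (cases "i < dim_vec w") (simp_all add: lookup_exponent_parts)
  then show "pp_dvd (exponent (pos_part v)) (exponent (pos_part w))"
    "pp_dvd (exponent (neg_part v)) (exponent (neg_part w))"
    unfolding pp_dvd_iff by blast+
qed

text \<open>In characteristic two the leading power product of $x^{w^+} - x^{w^-}$ may be $x^{w^-}$,
  since then the binomial equals its negative; hence the two cases for \<open>p\<close>.\<close>

lemma groebner_vector_primitive:
  fixes K :: "'k::field itself"
  assumes order: "term_ordering (dim_col A) r" and w: "w \<in> groebner_vectors K A r"
  shows "primitive_vec A w"
proof -
  define n where "n = dim_col A"
  let ?P = "\<lambda>v. exponent (pos_part v)" and ?N = "\<lambda>v. exponent (neg_part v)"
  define g :: "pp \<Rightarrow>\<^sub>0 'k" where "g = power_product (?P w) - power_product (?N w)"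
  obtain G where G: "is_reduced_groebner_basis n r (toric_ideal K A) G" "g \<in> G"
    and wk: "w \<in> int_kernel A"
    using w by (auto simp: groebner_vectors_def n_def g_def int_kernel_def)
  have gb: "is_groebner_basis (dim_col A) r (toric_ideal K A) G"
    using G(1) by (simp add: is_reduced_groebner_basis_def n_def)
  have reduced: "\<And>h t. h \<in> G \<Longrightarrow> t \<in> Poly_Mapping.keys g \<Longrightarrow> pp_dvd (leading_pp r h) t \<Longrightarrow> h = g"
    using G by (auto simp: is_reduced_groebner_basis_def)
  have "g \<noteq> 0" using G by (auto simp: is_reduced_groebner_basis_def)
  have wc: "w \<in> carrier_vec n" using wk by (simp add: int_kernel_carrier n_def)
  have "?P w \<noteq> ?N w" using \<open>g \<noteq> 0\<close> by (auto simp: g_def)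
  then have keys: "Poly_Mapping.keys g = {?P w, ?N w}" by (simp add: g_def keys_binomial)
  have pps: "?P v \<in> pps n" "?N v \<in> pps n" if "v \<in> int_kernel A" for v
    using int_kernel_carrier[OF that] by (simp_all add: n_def)
  define p where "p = leading_pp r g"
  have order': "term_ordering n r" using order by (simp add: n_def)
  have kp: "Poly_Mapping.keys g \<subseteq> pps n" using keys pps wk by simp
  have p: "p = ?P w \<or> p = ?N w" "\<And>s. s \<in> Poly_Mapping.keys g \<Longrightarrow> (s, p) \<in> r"
    using leading_pp_in_keys[OF order' \<open>g \<noteq> 0\<close> kp] keys by (auto simp: p_def)
  have w0: "w \<noteq> 0\<^sub>v n"
    using \<open>?P w \<noteq> ?N w\<close> by (auto simp: pos_part_def neg_part_def intro!: arg_cong[of _ _ exponent])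
  have p0: "p \<noteq> 0"
  proof
    assume "p = 0"
    then have "s = 0" if "s \<in> Poly_Mapping.keys g" for s
      using p(2)[OF that] term_ordering_zero[OF order', of s] kp that term_ordering_antisym[OF order'] by auto
    then have "?P w = 0" "?N w = 0" using keys by simp_all
    then show False using \<open>?P w \<noteq> ?N w\<close> by simp
  qed
  have disjoint: "\<not> (pp_dvd p (?P w) \<and> pp_dvd p (?N w))"
  proof
    assume dvd: "pp_dvd p (?P w) \<and> pp_dvd p (?N w)"
    have "Poly_Mapping.lookup p i = 0" for i
    proof -
      have "Poly_Mapping.lookup (?P w) i = 0 \<or> Poly_Mapping.lookup (?N w) i = 0"
        by (cases "i < dim_vec w") (auto simp: lookup_exponent_parts)
      then show ?thesis using dvd by (metis pp_dvd_iff le_zero_eq)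
    qed
    then show False using p0 by (auto intro!: poly_mapping_eqI)
  qed
  \<comment> \<open>One of the two monomials of \<open>v\<close> is nonstandard, hence divisible by
    the leading power product of some \<open>h\<close> in \<open>G\<close>. It also divides a
    monomial of \<open>g\<close>, so \<open>h = g\<close> by reducedness. Thus \<open>p\<close>
    divides a monomial of \<open>v\<close>; as \<open>p\<close> is coprime to the other monomial of
    \<open>g\<close>, the vector \<open>v\<close> agrees with \<open>w\<close> on the part that
    carries \<open>p\<close>.\<close>
  have step: "(p = ?P w \<longrightarrow> ?P v = ?P w) \<and> (p = ?N w \<longrightarrow> ?N v = ?N w)"
    if v: "v \<in> int_kernel A" "conformal v w" "v \<noteq> 0\<^sub>v n" for v
  proof -
    note dvd = conformal_parts_dvd[OF v(2)]
    have vc: "v \<in> carrier_vec n" using v(1) by (simp add: int_kernel_carrier n_def)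
    have neq: "?P v \<noteq> ?N v" using exponent_parts_neq[OF vc v(3)] .
    have lead: "pp_dvd p t" if t: "t \<in> pps n" "nonstandard A r t" "s \<in> Poly_Mapping.keys g" "pp_dvd t s" for s t
    proof -
      obtain h where "h \<in> G" "pp_dvd (leading_pp r h) t"
        using groebner_basis_nonstandard_iff[OF order gb, of t] t by (auto simp: n_def)
      then show ?thesis using reduced[of h s] pp_dvd_trans t p_def by blast
    qed
    have "(?P v, ?N v) \<in> r \<or> (?N v, ?P v) \<in> r" using term_ordering_total[OF order'] pps[OF v(1)] by blast
    moreover have "nonstandard A r (?P v)" if "(?N v, ?P v) \<in> r"
      unfolding nonstandard_def
      using same_fiber_sym[OF same_fiber_parts[OF v(1)]] neq[symmetric] pps(2)[OF v(1)] that n_def by blast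
    moreover have "nonstandard A r (?N v)" if "(?P v, ?N v) \<in> r"
      unfolding nonstandard_def using same_fiber_parts[OF v(1)] neq pps(1)[OF v(1)] that n_def by blast
    ultimately have "nonstandard A r (?P v) \<or> nonstandard A r (?N v)" by blast
    then have "pp_dvd p (?P v) \<or> pp_dvd p (?N v)"
      using lead[of "?P v" "?P w"] lead[of "?N v" "?N w"] pps[OF v(1)] dvd keys by auto
    moreover have "?P v = p" if "pp_dvd p (?P v)" "p = ?P w"
      using pp_dvd_antisym that dvd(1) by simp
    moreover have "?N v = p" if "pp_dvd p (?N v)" "p = ?N w"
      using pp_dvd_antisym that dvd(2) by simp
    moreover have "\<not> pp_dvd p (?N v)" if "p = ?P w"
      using disjoint pp_dvd_trans[OF _ dvd(2)] that by (auto simp: pp_dvd_iff)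
    moreover have "\<not> pp_dvd p (?P v)" if "p = ?N w"
      using disjoint pp_dvd_trans[OF _ dvd(1)] that by (auto simp: pp_dvd_iff)
    ultimately show ?thesis by metis
  qed
  show ?thesis
    unfolding primitive_vec_def
  proof (intro conjI ballI impI wk)
    show "w \<noteq> 0\<^sub>v (dim_col A)" using w0 by (simp add: n_def)
    fix y assume y: "y \<in> int_kernel A" "conformal y w"
    have yc: "y \<in> carrier_vec n" using y(1) by (simp add: int_kernel_carrier n_def)
    show "y = 0\<^sub>v (dim_col A) \<or> y = w"
    proof (rule ccontr)
      assume "\<not> ?thesis"
      then have y0: "y \<noteq> 0\<^sub>v n" "y \<noteq> w" by (auto simp: n_def)
      have zk: "w - y \<in> int_kernel A" using int_kernel_diff[OF wk y(1)] .
      have zc: "conformal (w - y) w"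
        using y(2) wc yc unfolding conformal_def by auto
      have "w - y \<noteq> 0\<^sub>v n" using y0(2) diff_add_cancel_vec[OF wc yc] yc by (metis right_zero_vec)
      \<comment> \<open>Both \<open>y\<close> and \<open>w - y\<close> would contain the whole
        leading part of \<open>w\<close>, although they add up to \<open>w\<close> without
        cancellation; that part would be zero, against \<open>p0\<close>.\<close>
      note s = step[OF y y0(1)] step[OF zk zc this]
      have *: "Poly_Mapping.lookup a i = Poly_Mapping.lookup b i" if "a = b" for a b :: pp and i using that by simp
      have c: "0 \<le> y $ i \<and> y $ i \<le> w $ i \<or> w $ i \<le> y $ i \<and> y $ i \<le> 0" if "i < n" for i
        using y(2) wc that unfolding conformal_def by simp
      have vanish: "nat b = 0" if "nat a = nat b" "nat (b - a) = nat b"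
        "0 \<le> a \<and> a \<le> b \<or> b \<le> a \<and> a \<le> 0" for a b :: int
        using that by arith
      have "Poly_Mapping.lookup p i = 0" for i
      proof (cases "i < n")
        case True
        show ?thesis
          using p(1)
        proof
          assume pP: "p = ?P w"
          then have "nat (y $ i) = nat (w $ i)" "nat (w $ i - y $ i) = nat (w $ i)"
            using *[of "?P y" "?P w" i] *[of "?P (w - y)" "?P w" i] s pP True wc yc
              lookup_exponent_parts(1,2)[of i y] lookup_exponent_parts(1,2)[of i "w - y"] lookup_exponent_parts(1,2)[of i w]
            by (simp_all del: minus_diff_eq)
          then have "nat (w $ i) = 0" using vanish c[OF True] by blast
          then show ?thesis using pP True wc lookup_exponent_parts(1)[of i w] by simp
        next
          assume pN: "p = ?N w"
          then have "nat (- (y $ i)) = nat (- (w $ i))" "nat (- (w $ i - y $ i)) = nat (- (w $ i))"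
            using *[of "?N y" "?N w" i] *[of "?N (w - y)" "?N w" i] s pN True wc yc
              lookup_exponent_parts(1,2)[of i y] lookup_exponent_parts(1,2)[of i "w - y"] lookup_exponent_parts(1,2)[of i w]
            by (simp_all del: minus_diff_eq)
          then have "nat (- (w $ i)) = 0" using vanish[of "- (y $ i)" "- (w $ i)"] c[OF True] by simp
          then show ?thesis using pN True wc lookup_exponent_parts(2)[of i w] by simp
        qed
      next
        case False
        then show ?thesis using p(1) wc by (auto simp: lookup_exponent_parts)
      qed
      then show False using p0 by (auto intro!: poly_mapping_eqI)
    qed
  qed
qed

section \<open>Dickson's lemma and the reduced Groebner basis of a toric ideal\<close>

lemma nat_seq_mono_subseq:
  fixes f :: "nat \<Rightarrow> nat"
  obtains g :: "nat \<Rightarrow> nat" where "strict_mono g" "mono (f \<circ> g)"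
proof -
  \<comment> \<open>Jumping to a position of least value among all later ones gives values that
    never decrease, since each is least on a tail containing its successors.\<close>
  define next_min where "next_min k = (ARG_MIN f j. j > k)" for k
  have gt: "next_min k > k" and least: "\<And>j. j > k \<Longrightarrow> f (next_min k) \<le> f j" for k
    using arg_min_nat_lemma[of "\<lambda>j. j > k" "Suc k" f] by (auto simp: next_min_def)
  define g where "g = rec_nat (next_min 0) (\<lambda>_. next_min)"
  have g: "g 0 = next_min 0" "\<And>k. g (Suc k) = next_min (g k)" by (simp_all add: g_def)
  have sm: "strict_mono g" using gt g by (simp add: strict_mono_Suc_iff)
  have "f (g k) \<le> f (g (Suc k))" for k
  proof (cases k)
    case 0
    have "g 1 > 0" using gt[of "g 0"] g by simp
    then show ?thesis using least[of 0 "g 1"] 0 g(1) by simp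
  next
    case (Suc l)
    have "g (Suc k) > g l" using sm Suc by (simp add: strict_mono_less)
    then show ?thesis using least[of "g l"] Suc g(2) by simp
  qed
  then have "mono (f \<circ> g)" by (simp add: mono_iff_le_Suc)
  then show ?thesis using that sm by blast
qed

text \<open>Dickson's lemma. An infinite sequence has a subsequence that is nondecreasing in every
  exponent, extracted one variable at a time, and its first two members are comparable.\<close>

lemma finite_pp_antichain:
  assumes B: "B \<subseteq> pps n" and antichain: "\<And>s t. s \<in> B \<Longrightarrow> t \<in> B \<Longrightarrow> pp_dvd s t \<Longrightarrow> s = t"
  shows "finite B"
proof (rule ccontr)
  assume "infinite B"
  then obtain f :: "nat \<Rightarrow> pp" where f: "inj f" "range f \<subseteq> B"
    using infinite_countable_subset by blast
  have "\<exists>g :: nat \<Rightarrow> nat. strict_mono g \<and> (\<forall>i<k. mono (\<lambda>j. Poly_Mapping.lookup (f (g j)) i))" for k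
  proof (induction k)
    case 0
    show ?case by (intro exI[of _ id]) (simp add: strict_mono_def)
  next
    case (Suc k)
    then obtain g :: "nat \<Rightarrow> nat" where g: "strict_mono g" "\<forall>i<k. mono (\<lambda>j. Poly_Mapping.lookup (f (g j)) i)" by blast
    obtain h :: "nat \<Rightarrow> nat" where h: "strict_mono h" "mono ((\<lambda>j. Poly_Mapping.lookup (f (g j)) k) \<circ> h)"
      by (rule nat_seq_mono_subseq)
    have "mono (\<lambda>j. Poly_Mapping.lookup (f (g (h j))) i)" if "i < Suc k" for i
    proof (cases "i = k")
      case False
      then have "mono (\<lambda>j. Poly_Mapping.lookup (f (g j)) i)" using g(2) that by simp
      moreover have "mono h" using h(1) by (rule strict_mono_mono)
      ultimately show ?thesis by (simp add: mono_def)
    qed (use h(2) in \<open>simp add: comp_def\<close>)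
    moreover have "strict_mono (g \<circ> h)" using g(1) h(1) by (rule strict_mono_o)
    ultimately show ?case by (intro exI[of _ "g \<circ> h"]) (simp add: comp_def)
  qed
  then obtain g :: "nat \<Rightarrow> nat" where g: "strict_mono g"
    "\<forall>i<n. mono (\<lambda>j. Poly_Mapping.lookup (f (g j)) i)" by blast
  have "Poly_Mapping.lookup (f (g 0)) i \<le> Poly_Mapping.lookup (f (g 1)) i" for i
  proof (cases "i < n")
    case True
    then show ?thesis using g(2) by (auto simp: mono_def)
  next
    case False
    have "f (g 0) \<in> pps n" using f(2) B by blast
    then have "Poly_Mapping.lookup (f (g 0)) i = 0" using False by (auto simp: pps_def in_keys_iff)
    then show ?thesis by simp
  qed
  then have "pp_dvd (f (g 0)) (f (g 1))" by (simp add: pp_dvd_iff)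
  then have "f (g 0) = f (g 1)" using antichain f(2) by blast
  then have "g 0 = g 1" using f(1) by (simp add: inj_eq)
  then show False using g(1) by (simp add: strict_mono_eq)
qed

text \<open>The minimal generators of the initial ideal, which become the leading power products of
  the reduced basis.\<close>

definition minimal_nonstandard :: "int mat \<Rightarrow> pp rel \<Rightarrow> pp \<Rightarrow> bool" where
  "minimal_nonstandard A r t \<longleftrightarrow> t \<in> pps (dim_col A) \<and> nonstandard A r t \<and>
     (\<forall>s. nonstandard A r s \<longrightarrow> pp_dvd s t \<longrightarrow> s = t)"

lemma pp_dvd_pps: "pp_dvd s t \<Longrightarrow> t \<in> pps n \<Longrightarrow> s \<in> pps n"
  by (auto simp: pp_dvd_def pps_add_iff)

lemma minimal_nonstandard_dvd:
  assumes "t \<in> pps (dim_col A)" "nonstandard A r t"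
  shows "\<exists>m. minimal_nonstandard A r m \<and> pp_dvd m t"
  using assms
proof (induction "\<Sum>i<dim_col A. Poly_Mapping.lookup t i" arbitrary: t rule: less_induct)
  case less
  show ?case
  proof (cases "minimal_nonstandard A r t")
    case True
    moreover have "pp_dvd t t" by (simp add: pp_dvd_iff)
    ultimately show ?thesis by blast
  next
    case False
    then obtain s where s: "nonstandard A r s" "pp_dvd s t" "s \<noteq> t"
      using less.prems unfolding minimal_nonstandard_def by blast
    have sp: "s \<in> pps (dim_col A)" using pp_dvd_pps[OF s(2)] less.prems by blast
    have le: "Poly_Mapping.lookup s i \<le> Poly_Mapping.lookup t i" for i using s(2) by (simp add: pp_dvd_iff)
    obtain i where i: "Poly_Mapping.lookup s i \<noteq> Poly_Mapping.lookup t i" using s(3) poly_mapping_eqI[of s t] by blast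
    then have lt: "Poly_Mapping.lookup s i < Poly_Mapping.lookup t i" using le[of i] by simp
    then have "i \<in> Poly_Mapping.keys t" by (simp add: in_keys_iff)
    then have i: "i < dim_col A" using less.prems(1) by (auto simp: pps_def)
    then have "(\<Sum>i<dim_col A. Poly_Mapping.lookup s i) < (\<Sum>i<dim_col A. Poly_Mapping.lookup t i)"
      using le lt i by (intro sum_strict_mono_ex1) auto
    then obtain m where "minimal_nonstandard A r m" "pp_dvd m s" using less.hyps sp s(1) by blast
    then show ?thesis using pp_dvd_trans[OF _ s(2)] by blast
  qed
qed

lemma initial_ideal_mono:
  fixes F F' :: "(pp \<Rightarrow>\<^sub>0 'k::field) set"
  assumes order: "term_ordering n r" and F': "\<And>f. f \<in> F' \<Longrightarrow> Poly_Mapping.keys f \<subseteq> pps n"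
    and "\<And>f. f \<in> F \<Longrightarrow> f \<noteq> 0 \<Longrightarrow> power_product (leading_pp r f) \<in> initial_ideal n r F'"
  shows "initial_ideal n r F \<subseteq> initial_ideal n r F'"
proof -
  interpret ring "polynomial_ring TYPE('k) n" by (rule ring_polynomial_ring)
  have "ideal (initial_ideal n r F') (polynomial_ring TYPE('k) n)"
    unfolding initial_ideal_def using leading_pp_in_keys(1)[OF order _ F'] F' by (intro genideal_ideal) fastforce
  then show ?thesis
    unfolding initial_ideal_def[of n r F] using assms(3) by (intro genideal_minimal) auto
qed

text \<open>Of two distinct members of a fiber the larger is nonstandard. A standard power product
  is therefore the normal form of its fiber; the next lemma finds it as the minimum of a finite
  fiber.\<close>

lemma standard_in_fiber_unique:
  assumes order: "term_ordering (dim_col A) r"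
    and "s \<in> pps (dim_col A)" "t \<in> pps (dim_col A)" "same_fiber A s t"
    and "\<not> nonstandard A r s" "\<not> nonstandard A r t"
  shows "s = t"
  using assms term_ordering_total[OF order, of s t] same_fiber_sym[of A s t]
  unfolding nonstandard_def by blast

lemma standard_in_fiber_exists:
  assumes order: "term_ordering (dim_col A) r" and t: "t \<in> pps (dim_col A)"
    and fin: "finite {s \<in> pps (dim_col A). same_fiber A s t}"
  shows "\<exists>s\<in>pps (dim_col A). same_fiber A s t \<and> \<not> nonstandard A r s"
proof -
  let ?S = "{s \<in> pps (dim_col A). same_fiber A s t}"
  have "t \<in> ?S" using t by simp
  then obtain m where m: "m \<in> ?S" "\<forall>s\<in>?S. (m, s) \<in> r"
    using finite_term_ordering_min[OF order fin] by blast
  have "\<not> nonstandard A r m"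
  proof
    assume "nonstandard A r m"
    then obtain s where s: "s \<in> pps (dim_col A)" "same_fiber A s m" "s \<noteq> m" "(s, m) \<in> r"
      unfolding nonstandard_def by blast
    then have "s \<in> ?S" using m(1) same_fiber_trans by blast
    then show False using m(2) s term_ordering_antisym[OF order] by blast
  qed
  then show ?thesis using m by blast
qed

text \<open>The basis consists of each minimal generator of the initial ideal minus the normal form
  of its fiber. Finite fibers supply the normal forms and Dickson's lemma the finiteness of the
  basis. The second conclusion allows a concrete binomial to be recognized as a member.\<close>

lemma reduced_groebner_basis_exists:
  fixes K :: "'k::field itself"
  assumes order: "term_ordering (dim_col A) r"
    and fin: "\<And>t. t \<in> pps (dim_col A) \<Longrightarrow> finite {s \<in> pps (dim_col A). same_fiber A s t}"
  obtains G where "is_reduced_groebner_basis (dim_col A) r (toric_ideal K A) G"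
    "\<And>s t. minimal_nonstandard A r t \<Longrightarrow> s \<in> pps (dim_col A) \<Longrightarrow> same_fiber A s t \<Longrightarrow>
      \<not> nonstandard A r s \<Longrightarrow> power_product t - power_product s \<in> G"
proof -
  define n where "n = dim_col A"
  have order': "term_ordering n r" using order by (simp add: n_def)
  define B where "B = {t. minimal_nonstandard A r t}"
  define nf where "nf t = (SOME s. s \<in> pps n \<and> same_fiber A s t \<and> \<not> nonstandard A r s)" for t
  define b :: "pp \<Rightarrow> (pp \<Rightarrow>\<^sub>0 'k)" where "b t = power_product t - power_product (nf t)" for t
  have B: "t \<in> pps n" "nonstandard A r t" if "t \<in> B" for t
    using that by (auto simp: B_def minimal_nonstandard_def n_def)
  have nf: "nf t \<in> pps n \<and> same_fiber A (nf t) t \<and> \<not> nonstandard A r (nf t)" if "t \<in> B" for t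
    unfolding nf_def using standard_in_fiber_exists[OF order _ fin] B(1)[OF that]
    by (intro someI_ex[where P = "\<lambda>s. s \<in> pps n \<and> same_fiber A s t \<and> \<not> nonstandard A r s"]) (auto simp: n_def)
  have nf_neq: "t \<noteq> nf t" if "t \<in> B" for t using nf[OF that] B(2)[OF that] by auto
  have nf_less: "(nf t, t) \<in> r" if t: "t \<in> B" for t
  proof (rule ccontr)
    assume "(nf t, t) \<notin> r"
    then have "(t, nf t) \<in> r" using term_ordering_total[OF order'] nf[OF t] B(1)[OF t] by blast
    then have "nonstandard A r (nf t)"
      unfolding nonstandard_def using nf_neq[OF t] same_fiber_sym nf[OF t] B(1)[OF t] n_def by blast
    then show False using nf[OF t] by blast
  qed
  have lead: "leading_pp r (b t) = t" if t: "t \<in> B" for t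
    unfolding b_def using nf[OF t] nf_less[OF t] nf_neq[OF t] B(1)[OF t]
    by (intro leading_pp_binomial[OF order']) simp_all
  have keys: "Poly_Mapping.keys (b t) = {t, nf t}" if "t \<in> B" for t
    using nf_neq[OF that] by (simp add: b_def keys_binomial)
  have b_nz: "b t \<noteq> 0" if "t \<in> B" for t
    using keys[OF that] by auto
  have toric: "b t \<in> toric_ideal K A" if "t \<in> B" for t
    unfolding b_def using nf[OF that] B(1)[OF that] same_fiber_sym[of A "nf t" t]
    by (intro binomial_in_toric_ideal) (simp_all add: n_def)
  have fin_B: "finite B"
  proof (rule finite_pp_antichain)
    show "B \<subseteq> pps n" using B(1) by blast
    fix s t assume "s \<in> B" "t \<in> B" "pp_dvd s t"
    then show "s = t" using B(2)[of s] unfolding B_def minimal_nonstandard_def by blast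
  qed
  have init: "initial_ideal n r (b ` B) = initial_ideal n r (toric_ideal K A)"
  proof (intro equalityI initial_ideal_mono[OF order'])
    fix f assume "f \<in> toric_ideal K A"
    then show "Poly_Mapping.keys f \<subseteq> pps n" using toric_ideal_subset(1) n_def by blast
  next
    fix f assume "f \<in> b ` B"
    then show "Poly_Mapping.keys f \<subseteq> pps n" using keys nf B(1) by auto
  next
    fix f assume "f \<in> b ` B"
    then obtain t where t: "f = b t" "t \<in> B" by blast
    then show "power_product (leading_pp r f) \<in> initial_ideal n r (toric_ideal K A)"
      using power_product_in_initial_toric_iff[OF order, of t K] B[OF t(2)] lead[OF t(2)] by (simp add: n_def)
  next
    fix f assume f: "f \<in> toric_ideal K A" "f \<noteq> 0"
    have ns: "nonstandard A r (leading_pp r f)" using leading_pp_toric_nonstandard[OF order f] .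
    have pp: "leading_pp r f \<in> pps n"
      using leading_pp_in_keys(1)[OF order f(2)] toric_ideal_subset(1)[OF f(1)] n_def by blast
    obtain m where m: "m \<in> B" "pp_dvd m (leading_pp r f)"
      using minimal_nonstandard_dvd[OF _ ns] pp by (auto simp: n_def B_def)
    have carr: "Poly_Mapping.keys g \<subseteq> pps n" if "g \<in> b ` B" for g using that keys nf B(1) by auto
    have "b m \<in> b ` B - {0}" "pp_dvd (leading_pp r (b m)) (leading_pp r f)"
      using m lead b_nz by auto
    then show "power_product (leading_pp r f) \<in> initial_ideal n r (b ` B)"
      using power_product_in_initial_ideal_iff[OF order' carr pp] by blast
  qed
  have "is_reduced_groebner_basis n r (toric_ideal K A) (b ` B)"
    unfolding is_reduced_groebner_basis_def is_groebner_basis_def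
  proof (intro conjI ballI)
    show "finite (b ` B)" using fin_B by simp
    show "b ` B \<subseteq> toric_ideal K A" using toric by blast
    show "initial_ideal n r (b ` B) = initial_ideal n r (toric_ideal K A)" by (rule init)
  next
    fix g assume "g \<in> b ` B"
    then obtain t where t: "g = b t" "t \<in> B" by blast
    show "g \<noteq> 0" using b_nz t by simp
    show "Poly_Mapping.lookup g (leading_pp r g) = 1"
      using lead[OF t(2)] nf_neq[OF t(2)] by (simp add: t(1) b_def power_product_def lookup_minus lookup_single)
    fix h u assume h: "h \<in> b ` B - {g}" and u: "u \<in> Poly_Mapping.keys g"
    obtain s where s: "h = b s" "s \<in> B" "s \<noteq> t" using h t by blast
    show "\<not> pp_dvd (leading_pp r h) u"
    proof
      assume "pp_dvd (leading_pp r h) u"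
      then have dvd: "pp_dvd s u" using s lead by simp
      have "u = t \<or> u = nf t" using u keys[OF t(2)] t(1) by simp
      then show False
      proof
        assume "u = t"
        then show False using dvd s t B(2)[OF s(2)] by (auto simp: B_def minimal_nonstandard_def)
      next
        \<comment> \<open>Multiples of nonstandard power products are nonstandard, so no leading
          power product divides a standard tail.\<close>
        assume "u = nf t"
        then obtain c where c: "nf t = s + c" using dvd by (auto simp: pp_dvd_def)
        have "c \<in> pps n" using nf[OF t(2)] c by (simp add: pps_add_iff)
        then have "nonstandard A r (nf t)"
          using nonstandard_add[OF order B(2)[OF s(2)], of c] c by (simp add: n_def)
        then show False using nf[OF t(2)] by blast
      qed
    qed
  qed
  moreover have "power_product t - power_product s \<in> b ` B"
    if t: "minimal_nonstandard A r t" and s: "s \<in> pps (dim_col A)" "same_fiber A s t" "\<not> nonstandard A r s" for s t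
  proof -
    have tB: "t \<in> B" using t by (simp add: B_def)
    have "s = nf t"
      using nf[OF tB] s(3) same_fiber_trans[OF s(2) same_fiber_sym[of A "nf t" t]]
      by (intro standard_in_fiber_unique[OF order s(1)]) (simp_all add: n_def)
    then show ?thesis using tB by (auto simp: b_def)
  qed
  ultimately show ?thesis using that n_def by blast
qed

section \<open>Kernels of higher Lawrence liftings\<close>

lemma layer_carrier [simp]: "layer n x i \<in> carrier_vec n"
  by (simp add: layer_def)

lemma dim_col_higher_lawrence [simp]: "dim_col (higher_lawrence N A) = N * dim_col A"
  using higher_lawrence_carrier[of N A] by auto

lemma layer_index_less:
  assumes "i < N" "j < n"
  shows "i * n + j < N * (n :: nat)"
proof -
  have "i * n + j < Suc i * n" using assms(2) by simp
  also have "\<dots> \<le> N * n" using assms(1) by (intro mult_le_mono1) simp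
  finally show ?thesis .
qed

text \<open>Induction splits off the first block; the layers of the remaining vector are those of
  \<open>x\<close> shifted by one.\<close>

lemma diag_block_mat_replicate_mult_eq_0_iff:
  assumes A: "A \<in> carrier_mat m n" and "x \<in> carrier_vec (N * n)"
  shows "diag_block_mat (replicate N A) *\<^sub>v x = 0\<^sub>v (N * m) \<longleftrightarrow> (\<forall>i<N. A *\<^sub>v layer n x i = 0\<^sub>v m)"
  using assms(2)
proof (induction N arbitrary: x)
  case 0
  then show ?case by (auto intro!: eq_vecI)
next
  case (Suc N)
  define a where "a = vec_first x n"
  define d where "d = vec_last x (N * n)"
  have a: "a \<in> carrier_vec n" and d: "d \<in> carrier_vec (N * n)" by (simp_all add: a_def d_def)
  have x: "x = a @\<^sub>v d"
    using vec_first_last_append[of x n "N * n"] Suc.prems by (simp add: a_def d_def)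
  let ?D = "diag_block_mat (replicate N A)"
  have D: "?D \<in> carrier_mat (N * m) (N * n)"
    using A by (auto simp: dim_diag_block_mat sum_list_replicate)
  have dims: "dim_row A = m" "dim_col A = n" "dim_row ?D = N * m" "dim_col ?D = N * n" using A D by auto
  have "diag_block_mat (replicate (Suc N) A) *\<^sub>v x
      = four_block_mat A (0\<^sub>m m (N * n)) (0\<^sub>m (N * m) n) ?D *\<^sub>v (a @\<^sub>v d)"
    by (simp add: x dims Let_def)
  also have "\<dots> = (A *\<^sub>v a + 0\<^sub>m m (N * n) *\<^sub>v d) @\<^sub>v (0\<^sub>m (N * m) n *\<^sub>v a + ?D *\<^sub>v d)"
    by (rule four_block_mat_mult_vec[OF A _ _ D a d]) auto
  also have "\<dots> = (A *\<^sub>v a) @\<^sub>v (?D *\<^sub>v d)"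
  proof -
    have "A *\<^sub>v a \<in> carrier_vec m" "?D *\<^sub>v d \<in> carrier_vec (N * m)" using A D a d by (metis mult_mat_vec_carrier)+
    moreover have "0\<^sub>m m (N * n) *\<^sub>v d = 0\<^sub>v m" "0\<^sub>m (N * m) n *\<^sub>v a = 0\<^sub>v (N * m)"
      using a d by (auto intro!: eq_vecI)
    ultimately show ?thesis by simp
  qed
  finally have eq: "diag_block_mat (replicate (Suc N) A) *\<^sub>v x = (A *\<^sub>v a) @\<^sub>v (?D *\<^sub>v d)" .
  have zero: "0\<^sub>v (Suc N * m) = 0\<^sub>v m @\<^sub>v (0\<^sub>v (N * m) :: int vec)" by (intro eq_vecI) auto
  have "diag_block_mat (replicate (Suc N) A) *\<^sub>v x = 0\<^sub>v (Suc N * m)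
      \<longleftrightarrow> A *\<^sub>v a = 0\<^sub>v m \<and> ?D *\<^sub>v d = 0\<^sub>v (N * m)"
    unfolding eq zero using A a by (subst append_vec_eq[of _ m]) auto
  also have "?D *\<^sub>v d = 0\<^sub>v (N * m) \<longleftrightarrow> (\<forall>i<N. A *\<^sub>v layer n d i = 0\<^sub>v m)"
    by (rule Suc.IH[OF d])
  also have "layer n x 0 = a"
    using a d by (intro eq_vecI) (auto simp: layer_def x)
  then have "a = layer n x 0" by simp
  also have layers: "layer n d i = layer n x (Suc i)" if "i < N" for i
    using a d layer_index_less[OF that] by (intro eq_vecI) (auto simp: layer_def x)
  have "(\<forall>i<N. A *\<^sub>v layer n d i = 0\<^sub>v m) \<longleftrightarrow> (\<forall>i<N. A *\<^sub>v layer n x (Suc i) = 0\<^sub>v m)"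
    using layers by simp
  finally show ?case by (simp add: All_less_Suc2)
qed

text \<open>The identity blocks say that the layers sum to zero, the diagonal blocks that each layer
  lies in the kernel of \<open>A\<close>.\<close>

lemma int_kernel_higher_lawrence:
  "x \<in> int_kernel (higher_lawrence N A) \<longleftrightarrow> x \<in> carrier_vec (N * dim_col A) \<and>
     (\<forall>j<dim_col A. (\<Sum>i<N. x $ (i * dim_col A + j)) = 0) \<and>
     (\<forall>i<N. layer (dim_col A) x i \<in> int_kernel A)"
proof (cases "x \<in> carrier_vec (N * dim_col A)")
  case True
  define n where "n = dim_col A"
  define T where "T = mat n (N * n) (\<lambda>(i, j). (1\<^sub>m n :: int mat) $$ (i, j mod n))"
  let ?D = "diag_block_mat (replicate N A)"
  have x: "x \<in> carrier_vec (N * n)" using True by (simp add: n_def)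
  have T: "T \<in> carrier_mat n (N * n)" by (simp add: T_def)
  have D: "?D \<in> carrier_mat (N * dim_row A) (N * n)"
    by (auto simp: dim_diag_block_mat sum_list_replicate n_def)
  have split: "higher_lawrence N A *\<^sub>v x = (T *\<^sub>v x) @\<^sub>v (?D *\<^sub>v x)"
    unfolding higher_lawrence_def n_def[symmetric] T_def[symmetric] by (rule mat_mult_append[OF T D x])
  have "(T *\<^sub>v x) $ j = (\<Sum>i<N. x $ (i * n + j))" if j: "j < n" for j
  proof -
    have "(T *\<^sub>v x) $ j = (\<Sum>c<N * n. (if c mod n = j then x $ c else 0))"
    proof -
      have "(T *\<^sub>v x) $ j = (\<Sum>c<N * n. T $$ (j, c) * x $ c)"
        using j x T by (simp add: scalar_prod_def atLeast0LessThan)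
      also have "\<dots> = (\<Sum>c<N * n. (if c mod n = j then x $ c else 0))"
        using j by (intro sum.cong) (auto simp: T_def)
      finally show ?thesis .
    qed
    \<comment> \<open>The columns are grouped into blocks of length \<open>n\<close>, each of which
      has exactly one column congruent to \<open>j\<close>.\<close>
    also have "\<dots> = (\<Sum>i<N. \<Sum>c\<in>{i * n..<i * n + n}. (if c mod n = j then x $ c else 0))"
      by (simp add: sum.nat_group)
    also have "\<dots> = (\<Sum>i<N. x $ (i * n + j))"
    proof (rule sum.cong[OF refl])
      fix i
      have "(\<Sum>c\<in>{i * n..<i * n + n}. (if c mod n = j then x $ c else 0))
          = (\<Sum>c<n. (if c = j then x $ (i * n + c) else 0))"
        by (simp add: sum.atLeastLessThan_shift_0[of _ "i * n"] atLeast0LessThan cong: sum.cong_simp)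
      then show "(\<Sum>c\<in>{i * n..<i * n + n}. (if c mod n = j then x $ c else 0)) = x $ (i * n + j)"
        using j by simp
    qed
    finally show ?thesis .
  qed
  moreover have "dim_vec (T *\<^sub>v x) = n" using T by simp
  ultimately have top: "T *\<^sub>v x = 0\<^sub>v n \<longleftrightarrow> (\<forall>j<n. (\<Sum>i<N. x $ (i * n + j)) = 0)"
    by (simp add: vec_eq_iff)
  have "0\<^sub>v (dim_row (higher_lawrence N A)) = 0\<^sub>v n @\<^sub>v (0\<^sub>v (N * dim_row A) :: int vec)"
    using higher_lawrence_carrier[of N A] by (intro eq_vecI) (auto simp: n_def)
  moreover have "T *\<^sub>v x \<in> carrier_vec n" using T x by (rule mult_mat_vec_carrier)
  ultimately have "higher_lawrence N A *\<^sub>v x = 0\<^sub>v (dim_row (higher_lawrence N A))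
      \<longleftrightarrow> T *\<^sub>v x = 0\<^sub>v n \<and> ?D *\<^sub>v x = 0\<^sub>v (N * dim_row A)"
    by (simp add: split append_vec_eq[of _ n])
  moreover have "?D *\<^sub>v x = 0\<^sub>v (N * dim_row A) \<longleftrightarrow> (\<forall>i<N. A *\<^sub>v layer n x i = 0\<^sub>v (dim_row A))"
    by (rule diag_block_mat_replicate_mult_eq_0_iff[OF _ x]) (auto simp: n_def)
  ultimately show ?thesis using x top by (simp add: int_kernel_def n_def)
next
  case False
  then show ?thesis by (auto simp: int_kernel_def)
qed

section \<open>Circuits of the transportation matrix\<close>

text \<open>The six permutation matrices, the even ones being numbered \<open>0, 1, 2\<close> and the odd ones
  \<open>3, 4, 5\<close>. Both parity classes sum to the all-ones table.\<close>

definition perm_table :: "nat \<Rightarrow> nat \<Rightarrow> int" where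
  "perm_table a c = of_bool (if a < 3 then (c div 3 + a) mod 3 = c mod 3
     else (c div 3 + c mod 3) mod 3 = a mod 3)"

lemma all_less_6: "(\<forall>a<6. P a) \<longleftrightarrow> P 0 \<and> P 1 \<and> P 2 \<and> P 3 \<and> P 4 \<and> P (5 :: nat)"
  by (simp add: All_less_Suc numeral_eq_Suc conj_ac)

lemma all_less_9:
  "(\<forall>c<9. P c) \<longleftrightarrow> P 0 \<and> P 1 \<and> P 2 \<and> P 3 \<and> P 4 \<and> P 5 \<and> P 6 \<and> P 7 \<and> P (8 :: nat)"
  by (simp add: All_less_Suc numeral_eq_Suc conj_ac)

lemma sum_lessThan_9:
  fixes f :: "nat \<Rightarrow> 'a :: comm_monoid_add"
  shows "(\<Sum>c<9. f c) = f 0 + f 1 + f 2 + f 3 + f 4 + f 5 + f 6 + f 7 + f 8"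
  by (simp add: numeral_eq_Suc)

lemma int_kernel_transport33:
  "z \<in> int_kernel transport33 \<longleftrightarrow> z \<in> carrier_vec 9 \<and>
     z $ 0 + z $ 1 + z $ 2 = 0 \<and> z $ 3 + z $ 4 + z $ 5 = 0 \<and> z $ 6 + z $ 7 + z $ 8 = 0 \<and>
     z $ 0 + z $ 3 + z $ 6 = 0 \<and> z $ 1 + z $ 4 + z $ 7 = 0 \<and> z $ 2 + z $ 5 + z $ 8 = 0"
proof (cases "z \<in> carrier_vec 9")
  case True
  have A: "transport33 \<in> carrier_mat 6 9" by (simp add: transport33_def)
  have "(transport33 *\<^sub>v z) $ k = (\<Sum>c<9. transport33 $$ (k, c) * z $ c)" if "k < 6" for k
    using that A True by (simp add: scalar_prod_def atLeast0LessThan)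
  then have row: "(transport33 *\<^sub>v z) $ k = (\<Sum>c<9. (if k < 3 then (if c div 3 = k then 1 else 0)
      else (if c mod 3 = k - 3 then 1 else 0)) * z $ c)" if "k < 6" for k
    using that by (auto simp: transport33_def intro!: sum.cong)
  have "transport33 *\<^sub>v z = 0\<^sub>v 6 \<longleftrightarrow> (\<forall>k<6. (transport33 *\<^sub>v z) $ k = 0)"
    using A by (auto simp: vec_eq_iff)
  also have "\<dots> \<longleftrightarrow> z $ 0 + z $ 1 + z $ 2 = 0 \<and> z $ 3 + z $ 4 + z $ 5 = 0 \<and> z $ 6 + z $ 7 + z $ 8 = 0 \<and>
     z $ 0 + z $ 3 + z $ 6 = 0 \<and> z $ 1 + z $ 4 + z $ 7 = 0 \<and> z $ 2 + z $ 5 + z $ 8 = 0"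
    unfolding all_less_6 by (simp add: row sum_lessThan_9 del: index_mult_mat_vec)
  finally show ?thesis using True A by (simp add: int_kernel_def)
next
  case False
  then show ?thesis by (simp add: int_kernel_def transport33_def)
qed

definition flow_table :: "(nat \<times> nat) multiset \<Rightarrow> nat \<Rightarrow> int" where
  "flow_table F c = (\<Sum>e\<in>#F. perm_table (fst e) c - perm_table (snd e) c)"

lemma flow_table_empty [simp]: "flow_table {#} c = 0"
  by (simp add: flow_table_def)

lemma flow_table_add_mset:
  "flow_table (add_mset e F) c = perm_table (fst e) c - perm_table (snd e) c + flow_table F c"
  by (simp add: flow_table_def)

lemma flow_table_union: "flow_table (F + G) c = flow_table F c + flow_table G c"
  by (simp add: flow_table_def)

lemma flow_table_sum: "flow_table (\<Sum>i\<in>I. F i) c = (\<Sum>i\<in>I. flow_table (F i) c)"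
  by (induction I rule: infinite_finite_induct) (auto simp: flow_table_union)

text \<open>At a fixed cell the matrix entries are a potential on the vertices, so the table of a
  flow depends only on its divergence.\<close>

lemma flow_table_divergence:
  assumes "\<And>e. e \<in># F \<Longrightarrow> fst e < 6 \<and> snd e < 6"
  shows "flow_table F c = (\<Sum>v<6. perm_table v c * divergence F v)"
  unfolding flow_table_def using assms by (subst sum_divergence_potential) auto

lemma flow_table_kernel:
  assumes "\<And>e. e \<in># F \<Longrightarrow> fst e < 6 \<and> snd e < 6"
  shows "vec 9 (flow_table F) \<in> int_kernel transport33"
proof -
  have "(\<Sum>v<6. divergence F v) = 0"
    using sum_divergence_potential[of "{..<6}" F "\<lambda>_. 1"] assms by simp
  then show ?thesis
    unfolding int_kernel_transport33
    by (simp add: flow_table_divergence[OF assms] sum_lessThan_6 perm_table_def algebra_simps)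
qed

text \<open>An even and an odd permutation matrix of size 3 share exactly one cell, so the divergences
  at any even and any odd vertex cancel.\<close>

lemma flow_table_zero_iff:
  assumes "\<And>e. e \<in># F \<Longrightarrow> fst e < 6 \<and> snd e < 6"
  shows "(\<forall>c<9. flow_table F c = 0) \<longleftrightarrow> (\<exists>k. \<forall>v<6. divergence F v = k * parity_charge v)"
proof -
  \<comment> \<open>Each cell lies in one even and one odd matrix, and its equation says that the
    divergences at these two vertices add up to zero. As vertex 0 has charge 1, its divergence is
    the factor.\<close>
  have "(\<forall>c<9. flow_table F c = 0) \<longleftrightarrow> (\<forall>v<6. divergence F v = divergence F 0 * parity_charge v)"
    unfolding all_less_9 all_less_6
    by (simp add: flow_table_divergence[OF assms] sum_lessThan_6 perm_table_def parity_charge_def) linarith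
  also have "\<dots> \<longleftrightarrow> (\<exists>k. \<forall>v<6. divergence F v = k * parity_charge v)"
    by (auto simp: parity_charge_def all_less_6)
  finally show ?thesis .
qed

text \<open>Cells are edges of the complete bipartite graph on rows and columns. A nonzero table
  with zero line sums contains a cycle of length 4 or 6 whose cells alternate in sign, and every
  such cycle is a difference of two permutation matrices.\<close>

lemma circuit_in_sign_pattern:
  fixes z :: "nat \<Rightarrow> int"
  assumes "z 0 + z 1 + z 2 = 0" "z 3 + z 4 + z 5 = 0" "z 6 + z 7 + z 8 = 0"
    and "z 0 + z 3 + z 6 = 0" "z 1 + z 4 + z 7 = 0" "z 2 + z 5 + z 8 = 0"
    and "c < 9" "z c \<noteq> 0"
  obtains a b where "a < 6" "b < 6" "a \<noteq> b"
    "\<And>c. c < 9 \<Longrightarrow> perm_table a c > perm_table b c \<Longrightarrow> z c > 0"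
    "\<And>c. c < 9 \<Longrightarrow> perm_table a c < perm_table b c \<Longrightarrow> z c < 0"
proof -
  \<comment> \<open>Only signs are needed: in a line with sum zero, a nonzero entry is accompanied
    by one of opposite sign. These implications for the six lines refute the negated claim
    propositionally.\<close>
  define p n where "p c \<longleftrightarrow> z c > 0" and "n c \<longleftrightarrow> z c < 0" for c
  have line: "(p i \<longrightarrow> n j \<or> n k) \<and> (p j \<longrightarrow> n i \<or> n k) \<and> (p k \<longrightarrow> n i \<or> n j) \<and>
      (n i \<longrightarrow> p j \<or> p k) \<and> (n j \<longrightarrow> p i \<or> p k) \<and> (n k \<longrightarrow> p i \<or> p j)"
    if "z i + z j + z k = 0" for i j k
    using that unfolding p_def n_def by linarith
  note lines = line[OF assms(1)] line[OF assms(2)] line[OF assms(3)]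
    line[OF assms(4)] line[OF assms(5)] line[OF assms(6)]
  have "p c \<or> n c" using assms(8) by (auto simp: p_def n_def)
  then have "\<not> (\<forall>c<9. \<not> p c \<and> \<not> n c)" using assms(7) by blast
  then have nonzero: "p 0 \<or> p 1 \<or> p 2 \<or> p 3 \<or> p 4 \<or> p 5 \<or> p 6 \<or> p 7 \<or> p 8 \<or>
      n 0 \<or> n 1 \<or> n 2 \<or> n 3 \<or> n 4 \<or> n 5 \<or> n 6 \<or> n 7 \<or> n 8"
    unfolding all_less_9 by blast
  have "\<exists>a<6. \<exists>b<6. a \<noteq> b \<and> (\<forall>c<9. perm_table a c > perm_table b c \<longrightarrow> p c) \<and>
      (\<forall>c<9. perm_table a c < perm_table b c \<longrightarrow> n c)"
  proof (rule ccontr)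
    assume "\<not> ?thesis"
    then have "\<forall>a<6. \<forall>b<6. a \<noteq> b \<longrightarrow> \<not> ((\<forall>c<9. perm_table a c > perm_table b c \<longrightarrow> p c) \<and>
      (\<forall>c<9. perm_table a c < perm_table b c \<longrightarrow> n c))" by blast
    note clauses = this[unfolded all_less_6 all_less_9]
    show False
      using clauses lines nonzero by (simp add: perm_table_def del: One_nat_def) satx
  qed
  then show ?thesis using that unfolding p_def n_def by blast
qed

lemma dim_col_transport33 [simp]: "dim_col transport33 = 9"
  by (simp add: transport33_def)

lemma perm_table_bounds: "0 \<le> perm_table a c" "perm_table a c \<le> 1"
  by (simp_all add: perm_table_def)

lemma perm_table_distinct:
  assumes "a < 6" "b < 6" "a \<noteq> b"
  shows "\<exists>c<9. perm_table a c \<noteq> perm_table b c"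
proof -
  have "\<forall>a<6. \<forall>b<6. a \<noteq> b \<longrightarrow> \<not> (\<forall>c<9. perm_table a c = perm_table b c)"
    unfolding all_less_6 all_less_9 by (simp add: perm_table_def)
  then show ?thesis using assms by blast
qed

section \<open>Conformal decomposition into circuits\<close>

text \<open>Where \<open>z\<close> vanishes both implications apply, so the arcs vanish there too.
  Only the signs of \<open>z\<close> enter, which lets subflows inherit the property; excluding
  loops gives every arc a nonzero table.\<close>

definition coherent :: "(nat \<times> nat) multiset \<Rightarrow> (nat \<Rightarrow> int) \<Rightarrow> bool" where
  "coherent F z \<longleftrightarrow> (\<forall>e\<in>#F. fst e < 6 \<and> snd e < 6 \<and> fst e \<noteq> snd e \<and>
     (\<forall>c<9. (z c \<ge> 0 \<longrightarrow> perm_table (snd e) c \<le> perm_table (fst e) c) \<and>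
            (z c \<le> 0 \<longrightarrow> perm_table (fst e) c \<le> perm_table (snd e) c)))"

lemma coherent_mono: "coherent F z \<Longrightarrow> D \<subseteq># F \<Longrightarrow> coherent D z"
  unfolding coherent_def by (meson mset_subset_eqD)

lemma coherent_flow_sign:
  assumes "coherent F z" "c < 9"
  shows "z c \<ge> 0 \<Longrightarrow> flow_table F c \<ge> 0" "z c \<le> 0 \<Longrightarrow> flow_table F c \<le> 0"
proof -
  have "(z c \<ge> 0 \<longrightarrow> flow_table F c \<ge> 0) \<and> (z c \<le> 0 \<longrightarrow> flow_table F c \<le> 0)"
    using assms
  proof (induction F)
    case (add e F)
    have "coherent F z" using add.prems(1) by (rule coherent_mono) simp
    then have IH: "(z c \<ge> 0 \<longrightarrow> flow_table F c \<ge> 0) \<and> (z c \<le> 0 \<longrightarrow> flow_table F c \<le> 0)"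
      using add.IH add.prems(2) by blast
    have "(z c \<ge> 0 \<longrightarrow> perm_table (snd e) c \<le> perm_table (fst e) c) \<and>
        (z c \<le> 0 \<longrightarrow> perm_table (fst e) c \<le> perm_table (snd e) c)"
      using add.prems by (simp add: coherent_def)
    with IH show ?case unfolding flow_table_add_mset by linarith
  qed simp
  then show "z c \<ge> 0 \<Longrightarrow> flow_table F c \<ge> 0" "z c \<le> 0 \<Longrightarrow> flow_table F c \<le> 0" by blast+
qed

text \<open>Coherent arcs do not cancel, so a cell where one arc is nonzero stays nonzero in the
  sum. This converts statements about tables back into statements about multisets of arcs.\<close>

lemma coherent_flow_zero:
  assumes "coherent F z" and zero: "\<And>c. c < 9 \<Longrightarrow> flow_table F c = 0"
  shows "F = {#}"
proof (rule ccontr)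
  assume "F \<noteq> {#}"
  then obtain e G where F: "F = add_mset e G" by (metis multiset_cases)
  have e: "fst e < 6" "snd e < 6" "fst e \<noteq> snd e" using assms(1) by (auto simp: F coherent_def)
  obtain c where c: "c < 9" "perm_table (fst e) c \<noteq> perm_table (snd e) c"
    using perm_table_distinct[OF e] by blast
  have sgn: "(z c \<ge> 0 \<longrightarrow> perm_table (snd e) c \<le> perm_table (fst e) c) \<and>
        (z c \<le> 0 \<longrightarrow> perm_table (fst e) c \<le> perm_table (snd e) c)"
    using assms(1) c(1) by (simp add: F coherent_def)
  have G: "coherent G z" using assms(1) unfolding F by (rule coherent_mono) simp
  have "perm_table (fst e) c - perm_table (snd e) c + flow_table G c = 0"
    using zero[OF c(1)] by (simp add: F flow_table_add_mset)
  then show False using sgn c(2) coherent_flow_sign[OF G c(1)] by linarith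
qed

text \<open>A circuit inside the sign pattern has entries -1, 0, 1. Subtracting it lowers the norm
  and leaves every entry zero or with its former sign, so arcs coherent with the remainder are
  coherent with \<open>z\<close>.\<close>

lemma coherent_decomposition:
  assumes "z \<in> int_kernel transport33"
  shows "\<exists>F. coherent F (\<lambda>c. z $ c) \<and> (\<forall>c<9. flow_table F c = z $ c)"
  using assms
proof (induction "l1_norm z" arbitrary: z rule: less_induct)
  case less
  have zc: "z \<in> carrier_vec 9" using int_kernel_carrier[OF less.prems] by simp
  show ?case
  proof (cases "\<exists>c<9. z $ c \<noteq> 0")
    case False
    then show ?thesis by (intro exI[of _ "{#}"]) (simp add: coherent_def)
  next
    case True
    then obtain c0 where c0: "c0 < 9" "z $ c0 \<noteq> 0" by blast
    obtain a b where ab: "a < 6" "b < 6" "a \<noteq> b"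
      and pos: "\<And>c. c < 9 \<Longrightarrow> perm_table a c > perm_table b c \<Longrightarrow> z $ c > 0"
      and neg: "\<And>c. c < 9 \<Longrightarrow> perm_table a c < perm_table b c \<Longrightarrow> z $ c < 0"
      using circuit_in_sign_pattern[of "\<lambda>c. z $ c" c0] less.prems c0
      unfolding int_kernel_transport33 by blast
    let ?w = "vec 9 (flow_table {#(a, b)#})"
    have w: "?w $ c = perm_table a c - perm_table b c" if "c < 9" for c
      using that by (simp add: flow_table_def)
    have wk: "?w \<in> int_kernel transport33" using ab by (intro flow_table_kernel) auto
    let ?z = "z - ?w"
    have zk: "?z \<in> int_kernel transport33" using less.prems wk by (rule int_kernel_diff)
    have z': "?z $ c = z $ c - (perm_table a c - perm_table b c)" if "c < 9" for c
      using that zc by (simp add: flow_table_def)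
    have step: "0 \<le> perm_table a c - perm_table b c \<and> 0 \<le> ?z $ c \<and> z $ c \<ge> 0 \<or>
        perm_table a c - perm_table b c \<le> 0 \<and> ?z $ c \<le> 0 \<and> z $ c \<le> 0" if "c < 9" for c
      using pos[OF that] neg[OF that] z'[OF that] perm_table_bounds[of a c] perm_table_bounds[of b c] by linarith
    have le: "nat \<bar>?z $ c\<bar> \<le> nat \<bar>z $ c\<bar>" if "c < 9" for c
      using step[OF that] z'[OF that] by linarith
    obtain c1 where c1: "c1 < 9" "perm_table a c1 \<noteq> perm_table b c1" using perm_table_distinct[OF ab] by blast
    have "nat \<bar>?z $ c1\<bar> < nat \<bar>z $ c1\<bar>" using step[OF c1(1)] z'[OF c1(1)] c1(2) by linarith
    then have "(\<Sum>c<9. nat \<bar>?z $ c\<bar>) < (\<Sum>c<9. nat \<bar>z $ c\<bar>)"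
      using le c1(1) by (intro sum_strict_mono_ex1) auto
    then have "l1_norm ?z < l1_norm z" using zc by (simp add: l1_norm_def)
    then obtain F where F: "coherent F (\<lambda>c. ?z $ c)" "\<forall>c<9. flow_table F c = ?z $ c"
      using less.hyps zk by blast
    have "coherent (add_mset (a, b) F) (\<lambda>c. z $ c)"
      unfolding coherent_def
    proof
      fix e assume "e \<in># add_mset (a, b) F"
      then consider "e = (a, b)" | "e \<in># F" by auto
      then show "fst e < 6 \<and> snd e < 6 \<and> fst e \<noteq> snd e \<and>
          (\<forall>c<9. (z $ c \<ge> 0 \<longrightarrow> perm_table (snd e) c \<le> perm_table (fst e) c) \<and>
            (z $ c \<le> 0 \<longrightarrow> perm_table (fst e) c \<le> perm_table (snd e) c))"
      proof cases
        case 1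
        have "(z $ c \<ge> 0 \<longrightarrow> perm_table b c \<le> perm_table a c) \<and>
            (z $ c \<le> 0 \<longrightarrow> perm_table a c \<le> perm_table b c)" if "c < 9" for c
          using pos[OF that] neg[OF that] by linarith
        then show ?thesis using 1 ab by simp
      next
        case 2
        have *: "(?z $ c \<ge> 0 \<longrightarrow> perm_table (snd e) c \<le> perm_table (fst e) c) \<and>
            (?z $ c \<le> 0 \<longrightarrow> perm_table (fst e) c \<le> perm_table (snd e) c)" if "c < 9" for c
          using F(1) 2 that unfolding coherent_def by blast
        have "(z $ c \<ge> 0 \<longrightarrow> perm_table (snd e) c \<le> perm_table (fst e) c) \<and>
            (z $ c \<le> 0 \<longrightarrow> perm_table (fst e) c \<le> perm_table (snd e) c)" if "c < 9" for c
          using *[OF that] step[OF that] z'[OF that] by linarith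
        moreover have "fst e < 6 \<and> snd e < 6 \<and> fst e \<noteq> snd e" using F(1) 2 unfolding coherent_def by blast
        ultimately show ?thesis by blast
      qed
    qed
    moreover have "\<forall>c<9. flow_table (add_mset (a, b) F) c = z $ c"
      using F(2) z' by (simp add: flow_table_add_mset)
    ultimately show ?thesis by blast
  qed
qed

text \<open>Greedy distribution: the first \<open>N\<close> summands absorb the intersection of
  \<open>D\<close> with their sum, and what is left over fits into the last one.\<close>

lemma subseteq_mset_sum_split:
  fixes N :: nat
  assumes "D \<subseteq># (\<Sum>i<N. M i)"
  shows "\<exists>E. (\<forall>i<N. E i \<subseteq># M i) \<and> D = (\<Sum>i<N. E i)"
  using assms
proof (induction N arbitrary: D)
  case (Suc N)
  let ?S = "\<Sum>i<N. M i"
  have "D \<inter># ?S \<subseteq># ?S" by simp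
  then obtain E where E: "\<forall>i<N. E i \<subseteq># M i" "D \<inter># ?S = (\<Sum>i<N. E i)" using Suc.IH by blast
  let ?E = "E(N := D - ?S)"
  have "D - ?S \<subseteq># M N" using Suc.prems by (simp add: subset_eq_diff_conv add.commute)
  then have "\<forall>i<Suc N. ?E i \<subseteq># M i" using E(1) by (simp add: less_Suc_eq)
  moreover have "D = (\<Sum>i<Suc N. ?E i)"
  proof -
    have "(\<Sum>i<N. ?E i) = (\<Sum>i<N. E i)" by (intro sum.cong) auto
    moreover have "D = (D \<inter># ?S) + (D - ?S)" by (simp add: multiset_eq_iff min_def)
    ultimately show ?thesis using E(2) by simp
  qed
  ultimately show ?case by blast
qed simp

section \<open>Graver elements have type at most nine\<close>

lemma layer_vec:
  assumes "i < N"
  shows "layer n (vec (N * n) (\<lambda>k. f (k div n) (k mod n))) i = vec n (f i)"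
  using layer_index_less[OF assms] by (intro eq_vecI) (auto simp: layer_def)

lemma primitive_type_le_9:
  assumes prim: "primitive_vec (higher_lawrence N transport33) x"
  shows "vec_type 9 N x \<le> 9"
proof (rule ccontr)
  assume "\<not> ?thesis"
  then have type: "vec_type 9 N x > 9" by simp
  have xk: "x \<in> int_kernel (higher_lawrence N transport33)" using prim by (simp add: primitive_vec_def)
  have x: "x \<in> carrier_vec (N * 9)" and colsum: "\<And>j. j < 9 \<Longrightarrow> (\<Sum>i<N. x $ (i * 9 + j)) = 0"
    and layers: "\<And>i. i < N \<Longrightarrow> layer 9 x i \<in> int_kernel transport33"
    using xk unfolding int_kernel_higher_lawrence by auto
  have "\<forall>i. \<exists>F. i < N \<longrightarrow> coherent F (\<lambda>c. layer 9 x i $ c) \<and> (\<forall>c<9. flow_table F c = layer 9 x i $ c)"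
    using coherent_decomposition[OF layers] by blast
  then obtain M where M: "\<And>i. i < N \<Longrightarrow> coherent (M i) (\<lambda>c. layer 9 x i $ c)"
    "\<And>i c. i < N \<Longrightarrow> c < 9 \<Longrightarrow> flow_table (M i) c = layer 9 x i $ c" by metis
  define F where "F = (\<Sum>i<N. M i)"
  have verts: "fst e < 6 \<and> snd e < 6" if "e \<in># F" for e
  proof -
    have "e \<in> (\<Union>i\<in>{..<N}. set_mset (M i))"
      using that unfolding F_def by (simp only: set_mset_sum finite_lessThan)
    then obtain i where "i < N" "e \<in># M i" by blast
    then show ?thesis using M(1) by (simp add: coherent_def)
  qed
  have "flow_table F c = 0" if "c < 9" for c
    using colsum[OF that] M(2) that by (simp add: F_def flow_table_sum layer_def)
  then obtain k where div: "\<And>v. v < 6 \<Longrightarrow> divergence F v = k * parity_charge v"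
    using flow_table_zero_iff[of F] verts by blast
  have "size F > 9"
  proof -
    have "(if layer 9 x i \<noteq> 0\<^sub>v 9 then 1 else 0) \<le> size (M i)" if "i < N" for i
    proof (cases "M i = {#}")
      case True
      then have "layer 9 x i $ c = 0" if "c < 9" for c using M(2)[OF \<open>i < N\<close> that] by simp
      then have "layer 9 x i = 0\<^sub>v 9" by (intro eq_vecI) (auto simp: layer_def)
      then show ?thesis by simp
    next
      case False
      then have "size (M i) > 0" by (simp add: nonempty_has_size)
      then show ?thesis by simp
    qed
    then have "(\<Sum>i<N. if layer 9 x i \<noteq> 0\<^sub>v 9 then 1 else 0) \<le> (\<Sum>i<N. size (M i))"
      by (intro sum_mono) simp
    moreover have "(\<Sum>i<N. if layer 9 x i \<noteq> 0\<^sub>v 9 then 1 else 0) = vec_type 9 N x"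
      by (simp add: vec_type_def sum.If_cases Int_def)
    moreover have "size F = (\<Sum>i<N. size (M i))" by (simp add: F_def size_multiset_sum)
    ultimately show ?thesis using type by simp
  qed
  from verts div this obtain D l where D: "D \<subseteq># F" "D \<noteq> {#}" "D \<noteq> F"
    "\<And>v. v < 6 \<Longrightarrow> divergence D v = l * parity_charge v"
    by (rule proper_subflow[of F k]) blast+
  obtain E where E: "\<And>i. i < N \<Longrightarrow> E i \<subseteq># M i" "D = (\<Sum>i<N. E i)"
    using subseteq_mset_sum_split D(1) unfolding F_def by blast
  have vertsE: "fst e < 6 \<and> snd e < 6" if "i < N" "e \<in># E i" for i e
    using M(1)[OF that(1)] mset_subset_eqD[OF E(1)[OF that(1)] that(2)] by (simp add: coherent_def)
  have coE: "coherent (E i) (\<lambda>c. layer 9 x i $ c)" if "i < N" for i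
    using coherent_mono[OF M(1)[OF that] E(1)[OF that]] .
  have coR: "coherent (M i - E i) (\<lambda>c. layer 9 x i $ c)" if "i < N" for i
    using coherent_mono[OF M(1)[OF that]] by simp
  have split: "flow_table (E i) c + flow_table (M i - E i) c = layer 9 x i $ c" if "i < N" "c < 9" for i c
    using M(2)[OF that] E(1)[OF that(1)] by (metis flow_table_union subset_mset.add_diff_inverse)
  have "\<And>e. e \<in># D \<Longrightarrow> fst e < 6 \<and> snd e < 6" using verts D(1) by (meson mset_subset_eqD)
  then have Dzero: "flow_table D c = 0" if "c < 9" for c
    using flow_table_zero_iff[of D] D(4) that by blast
  \<comment> \<open>The subflow returns to the layers. Both \<open>E i\<close> and
    \<open>M i - E i\<close> are coherent with layer \<open>i\<close> of \<open>x\<close>, which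
    makes \<open>y\<close> conformal to \<open>x\<close>.\<close>
  define y where "y = vec (N * 9) (\<lambda>k. flow_table (E (k div 9)) (k mod 9))"
  have y: "y \<in> carrier_vec (N * 9)" by (simp add: y_def)
  have ylayer: "layer 9 y i = vec 9 (flow_table (E i))" if "i < N" for i
    unfolding y_def by (rule layer_vec[OF that])
  have yat: "y $ (i * 9 + c) = flow_table (E i) c" if "i < N" "c < 9" for i c
    using layer_index_less[OF that] that by (simp add: y_def)
  have "y \<in> int_kernel (higher_lawrence N transport33)"
    unfolding int_kernel_higher_lawrence
  proof (intro conjI allI impI)
    fix j assume "j < dim_col transport33"
    then show "(\<Sum>i<N. y $ (i * dim_col transport33 + j)) = 0"
      using Dzero[of j] by (simp add: yat E(2) flow_table_sum)
  next
    fix i assume "i < N"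
    then show "layer (dim_col transport33) y i \<in> int_kernel transport33"
      using ylayer vertsE by (simp add: flow_table_kernel)
  qed (use y in simp)
  moreover have "conformal y x"
    unfolding conformal_def
  proof (intro conjI allI impI)
    show "dim_vec y = dim_vec x" using x y by simp
    fix k assume "k < dim_vec x"
    then have k: "k < N * 9" using x by simp
    define i c where "i = k div 9" and "c = k mod 9"
    have i: "i < N" "c < 9" and k_eq: "k = i * 9 + c"
      using k by (auto simp: i_def c_def less_mult_imp_div_less)
    have "x $ k = layer 9 x i $ c" using i by (simp add: layer_def k_eq)
    then show "0 \<le> y $ k \<and> y $ k \<le> x $ k \<or> x $ k \<le> y $ k \<and> y $ k \<le> 0"
      using split[OF i] coherent_flow_sign[OF coE[OF i(1)] i(2)] coherent_flow_sign[OF coR[OF i(1)] i(2)]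
        yat[OF i] unfolding k_eq by linarith
  qed
  ultimately have "y = 0\<^sub>v (N * 9) \<or> y = x"
    using prim by (simp add: primitive_vec_def)
  \<comment> \<open>As coherent arcs do not cancel, \<open>y = 0\<close> would make \<open>D\<close>
    empty, and \<open>y = x\<close> would make it all of \<open>F\<close>.\<close>
  then show False
  proof
    assume y0: "y = 0\<^sub>v (N * 9)"
    have "E i = {#}" if "i < N" for i
    proof (rule coherent_flow_zero[OF coE[OF that]])
      fix c :: nat assume "c < 9"
      then show "flow_table (E i) c = 0"
        using yat[OF that] layer_index_less[OF that] y0 by simp
    qed
    then show False using D(2) E(2) by simp
  next
    assume yx: "y = x"
    have "E i = M i" if "i < N" for i
    proof -
      have "M i - E i = {#}"
      proof (rule coherent_flow_zero[OF coR[OF that]])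
        fix c :: nat assume c: "c < 9"
        have "layer 9 x i $ c = flow_table (E i) c"
          using yat[OF that c] yx c by (simp add: layer_def)
        then show "flow_table (M i - E i) c = 0" using split[OF that c] by simp
      qed
      then show ?thesis using E(1)[OF that] by (simp add: Diff_eq_empty_iff_mset subset_mset.antisym)
    qed
    then show False using D(3) E(2) by (simp add: F_def)
  qed
qed

section \<open>Weighted term orderings\<close>

definition pp_weight :: "nat \<Rightarrow> (nat \<Rightarrow> nat) \<Rightarrow> pp \<Rightarrow> nat" where
  "pp_weight n wt t = (\<Sum>k<n. wt k * Poly_Mapping.lookup t k)"

text \<open>Ties are broken by \<open>\<le>\<close> on finitely supported functions, which is
  lexicographic with the smallest differing index deciding. The tie-break matters because the two
  monomials of interest will both have weight 0.\<close>

definition weight_ordering :: "nat \<Rightarrow> (nat \<Rightarrow> nat) \<Rightarrow> pp rel" where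
  "weight_ordering n wt = {(s, t). s \<in> pps n \<and> t \<in> pps n \<and>
     (pp_weight n wt s < pp_weight n wt t \<or> pp_weight n wt s = pp_weight n wt t \<and> s \<le> t)}"

lemma pp_weight_add: "pp_weight n wt (s + t) = pp_weight n wt s + pp_weight n wt t"
  by (simp add: pp_weight_def lookup_add algebra_simps sum.distrib)

lemma pp_zero_le: "0 \<le> (t :: pp)"
proof -
  have "\<not> t < 0" by (auto simp: less_poly_mapping.rep_eq less_fun_def)
  then show ?thesis by simp
qed

lemma term_ordering_weight: "term_ordering n (weight_ordering n wt)"
proof -
  have "linear_order_on (pps n) (weight_ordering n wt)"
    unfolding linear_order_on_def partial_order_on_def preorder_on_def
  proof (intro conjI)
    show "refl_on (pps n) (weight_ordering n wt)" by (auto simp: refl_on_def weight_ordering_def)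
    show "trans (weight_ordering n wt)" by (auto simp: trans_def weight_ordering_def)
    show "antisym (weight_ordering n wt)" by (auto simp: antisym_def weight_ordering_def)
    show "total_on (pps n) (weight_ordering n wt)" by (auto simp: total_on_def weight_ordering_def)
  qed (auto simp: weight_ordering_def)
  moreover have "(0, t) \<in> weight_ordering n wt" if "t \<in> pps n" for t
    using that pp_zero_le[of t] by (cases "pp_weight n wt t") (auto simp: weight_ordering_def pp_weight_def)
  moreover have "(s + c, t + c) \<in> weight_ordering n wt"
    if "(s, t) \<in> weight_ordering n wt" "c \<in> pps n" for s t c
    using that by (auto simp: weight_ordering_def pps_add_iff pp_weight_add)
  ultimately show ?thesis by (simp add: term_ordering_def)
qed

text \<open>Geometrically, the assumption on the weight says that the segment from $w^+$ to $w^-$ is an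
  edge of the convex hull of its fiber.\<close>

lemma fiber_edge_groebner_vector:
  fixes K :: "'k::field itself"
  assumes w: "w \<in> int_kernel A"
    and fin: "\<And>t. t \<in> pps (dim_col A) \<Longrightarrow> finite {s \<in> pps (dim_col A). same_fiber A s t}"
    and wt: "\<And>k. k < dim_col A \<Longrightarrow> w $ k \<noteq> 0 \<Longrightarrow> wt k = 0"
    and less: "exponent (neg_part w) < exponent (pos_part w)"
    and edge: "\<And>s. s \<in> pps (dim_col A) \<Longrightarrow> same_fiber A s (exponent (pos_part w)) \<Longrightarrow>
      pp_weight (dim_col A) wt s = 0 \<Longrightarrow> s = exponent (pos_part w) \<or> s = exponent (neg_part w)"
  shows "w \<in> groebner_vectors K A (weight_ordering (dim_col A) wt)"
proof -
  define n where "n = dim_col A"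
  define r where "r = weight_ordering n wt"
  define p where "p = exponent (pos_part w)"
  define q where "q = exponent (neg_part w)"
  have order: "term_ordering (dim_col A) r" unfolding r_def n_def by (rule term_ordering_weight)
  have wc: "w \<in> carrier_vec n" using int_kernel_carrier[OF w] by (simp add: n_def)
  have pq: "p \<in> pps n" "q \<in> pps n" using wc by (simp_all add: p_def q_def)
  have fib: "same_fiber A p q" unfolding p_def q_def by (rule same_fiber_parts[OF w])
  have weight: "pp_weight n wt p = 0" "pp_weight n wt q = 0"
    unfolding pp_weight_def p_def q_def using wc wt
    by (auto simp: lookup_exponent_parts n_def)
  \<comment> \<open>Being below \<open>p\<close> forces weight 0, so \<open>edge\<close> leaves only
    \<open>p\<close> and \<open>q\<close> as candidates in the fiber.\<close>
  have le_p: "s = p \<or> s = q" if "(s, p) \<in> r" "same_fiber A s p" for s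
    using edge[of s] that weight unfolding r_def weight_ordering_def n_def p_def q_def by auto
  have qp: "(q, p) \<in> r" using pq weight less by (simp add: r_def weight_ordering_def p_def q_def)
  have "q \<noteq> p" using less by (simp add: p_def q_def)
  have ns_p: "nonstandard A r p"
    unfolding nonstandard_def using pq(2) same_fiber_sym[OF fib] qp \<open>q \<noteq> p\<close> n_def by blast
  have st_q: "\<not> nonstandard A r q"
  proof
    assume "nonstandard A r q"
    then obtain s where s: "same_fiber A s q" "s \<noteq> q" "(s, q) \<in> r" unfolding nonstandard_def by blast
    have "(s, p) \<in> r" using term_ordering_trans[OF order s(3) qp] .
    then have "s = p" using le_p same_fiber_trans[OF s(1) same_fiber_sym[OF fib]] s(2) by blast
    then show False using s(3) qp term_ordering_antisym[OF order] \<open>q \<noteq> p\<close> by blast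
  qed
  have "minimal_nonstandard A r p"
    unfolding minimal_nonstandard_def
  proof (intro conjI allI impI ns_p)
    show "p \<in> pps (dim_col A)" using pq by (simp add: n_def)
    fix u assume u: "nonstandard A r u" "pp_dvd u p"
    then obtain c where c: "p = u + c" by (auto simp: pp_dvd_def)
    then have cn: "c \<in> pps n" using pq by (simp add: pps_add_iff)
    obtain v where v: "same_fiber A v u" "v \<noteq> u" "(v, u) \<in> r" using u(1) unfolding nonstandard_def by blast
    have "(v + c, p) \<in> r" using term_ordering_add[OF order v(3), of c] cn c by (simp add: n_def)
    moreover have "same_fiber A (v + c) p"
      using v(1) same_fiber_add_cancel[of A c v u] c by (simp add: add.commute)
    ultimately have "v + c = p \<or> v + c = q" by (rule le_p)
    \<comment> \<open>The step from \<open>u\<close> down to \<open>v\<close>, multiplied by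
      \<open>c\<close>, goes down from \<open>p\<close> and can only end in \<open>q\<close>. So
      \<open>c\<close> divides both \<open>p\<close> and \<open>q\<close>, which are
      coprime.\<close>
    then have q: "q = v + c" using v(2) c by auto
    have "Poly_Mapping.lookup c i = 0" for i
    proof -
      have "Poly_Mapping.lookup p i = 0 \<or> Poly_Mapping.lookup q i = 0"
        unfolding p_def q_def by (cases "i < dim_vec w") (auto simp: lookup_exponent_parts)
      then show ?thesis using c q by (auto simp: lookup_add)
    qed
    then have "c = 0" by (intro poly_mapping_eqI) simp
    then show "u = p" using c by simp
  qed
  then obtain G where "is_reduced_groebner_basis (dim_col A) r (toric_ideal K A) G"
    "power_product p - power_product q \<in> G"
    using reduced_groebner_basis_exists[OF order fin, where K = K] pq(2) same_fiber_sym[OF fib] st_q n_def by metis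
  then show ?thesis
    using w unfolding groebner_vectors_def int_kernel_def p_def q_def r_def n_def by blast
qed

text \<open>Comparable members of a fiber differ by a nonnegative kernel vector. Its layers sum to
  zero, so it vanishes; the fiber is an antichain and finite by Dickson's lemma.\<close>

lemma finite_fiber_higher_lawrence:
  "finite {s \<in> pps (dim_col (higher_lawrence N A)). same_fiber (higher_lawrence N A) s t}"
proof (rule finite_pp_antichain[of _ "N * dim_col A"])
  let ?L = "higher_lawrence N A" and ?n = "dim_col A"
  fix s s' assume s: "s \<in> {s \<in> pps (dim_col ?L). same_fiber ?L s t}"
    and s': "s' \<in> {s \<in> pps (dim_col ?L). same_fiber ?L s t}" and dvd: "pp_dvd s s'"
  obtain c where c: "s' = s + c" using dvd by (auto simp: pp_dvd_def)
  have "same_fiber ?L s' s" using s s' same_fiber_trans same_fiber_sym by blast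
  then have "pp_vec (N * ?n) s' - pp_vec (N * ?n) s \<in> int_kernel ?L" by (simp add: same_fiber_def)
  moreover have "pp_vec (N * ?n) s' - pp_vec (N * ?n) s = pp_vec (N * ?n) c"
    by (intro eq_vecI) (auto simp: pp_vec_def c lookup_add)
  ultimately have kernel: "pp_vec (N * ?n) c \<in> int_kernel ?L" by simp
  have "Poly_Mapping.lookup c k = 0" for k
  proof (cases "k < N * ?n")
    case True
    then have "?n > 0" by (cases ?n) auto
    then have k: "k div ?n < N" "k mod ?n < ?n" using True by (auto simp: less_mult_imp_div_less)
    have "(\<Sum>i<N. pp_vec (N * ?n) c $ (i * ?n + k mod ?n)) = 0"
      using kernel k(2) unfolding int_kernel_higher_lawrence by blast
    moreover have "pp_vec (N * ?n) c $ (i * ?n + k mod ?n) = int (Poly_Mapping.lookup c (i * ?n + k mod ?n))"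
      if "i < N" for i
      using layer_index_less[OF that k(2)] by (simp add: pp_vec_def)
    ultimately have "(\<Sum>i<N. int (Poly_Mapping.lookup c (i * ?n + k mod ?n))) = 0" by simp
    then have "\<forall>i\<in>{..<N}. int (Poly_Mapping.lookup c (i * ?n + k mod ?n)) = 0"
      by (subst (asm) sum_nonneg_eq_0_iff) simp_all
    then have "int (Poly_Mapping.lookup c (k div ?n * ?n + k mod ?n)) = 0" using k(1) by blast
    then show ?thesis by (simp only: div_mult_mod_eq of_nat_eq_0_iff)
  next
    case False
    have "c \<in> pps (N * ?n)" using s' c by (simp add: pps_add_iff)
    then show ?thesis using False by (auto simp: pps_def in_keys_iff)
  qed
  then have "c = 0" by (intro poly_mapping_eqI) simp
  then show "s = s'" by (simp add: c)
qed auto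

section \<open>A Groebner basis element of type nine\<close>

text \<open>The arcs of an extremal flow: along the path \<open>0 \<rightarrow> 1 \<rightarrow> 2 \<rightarrow> 3 \<rightarrow> 4 \<rightarrow> 5\<close> the successive arcs
  carry 1, 2, 3, 2 and 1 units. This attains the bound in \<open>size_acyclic_flow_le\<close>.\<close>

definition extremal_arc :: "nat \<Rightarrow> nat" where
  "extremal_arc i = [0, 1, 1, 2, 2, 2, 3, 3, 4] ! i"

definition arc_table :: "nat \<Rightarrow> nat \<Rightarrow> int" where
  "arc_table a c = perm_table a c - perm_table (Suc a) c"

definition extremal_vec :: "int vec" where
  "extremal_vec = vec (9 * 9) (\<lambda>k. arc_table (extremal_arc (k div 9)) (k mod 9))"

lemma arc_table_eq_flow: "arc_table a c = flow_table {#(a, Suc a)#} c"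
  by (simp add: arc_table_def flow_table_def)

lemma all_less_5: "(\<forall>a<5. P a) \<longleftrightarrow> P 0 \<and> P 1 \<and> P 2 \<and> P 3 \<and> P (4 :: nat)"
  by (simp add: All_less_Suc numeral_eq_Suc conj_ac)

lemma extremal_arc_less: "i < 9 \<Longrightarrow> extremal_arc i < 5"
proof -
  have "\<forall>i<9. extremal_arc i < 5" unfolding all_less_9 by (simp add: extremal_arc_def)
  then show "i < 9 \<Longrightarrow> extremal_arc i < 5" by blast
qed

lemma arc_table_has_one: "a < 5 \<Longrightarrow> \<exists>c<9. arc_table a c = 1"
  and arc_table_has_minus_one: "a < 5 \<Longrightarrow> \<exists>c<9. arc_table a c = - 1"
proof -
  have "\<forall>a<5. \<not> (\<forall>c<9. arc_table a c \<noteq> 1) \<and> \<not> (\<forall>c<9. arc_table a c \<noteq> - 1)"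
    unfolding all_less_5 all_less_9 by (simp add: arc_table_def perm_table_def)
  then show "a < 5 \<Longrightarrow> \<exists>c<9. arc_table a c = 1" "a < 5 \<Longrightarrow> \<exists>c<9. arc_table a c = - 1" by blast+
qed

text \<open>The support of each arc is a single cycle in the bipartite graph of rows and columns,
  and zero line sums determine a table on a cycle up to a factor.\<close>

lemma kernel_on_arc_support:
  assumes "a < 5" "z \<in> int_kernel transport33"
    and supp: "\<And>c. c < 9 \<Longrightarrow> arc_table a c = 0 \<Longrightarrow> z $ c = 0"
  obtains t where "\<And>c. c < 9 \<Longrightarrow> z $ c = t * arc_table a c"
proof -
  have supp9: "\<forall>c<9. arc_table a c = 0 \<longrightarrow> z $ c = 0" using supp by blast
  \<comment> \<open>The factor is read off at a cell where the arc has entry 1: cell 0, 1, 2, 0, 1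
    for the five arcs.\<close>
  have "a = 0 \<or> a = 1 \<or> a = 2 \<or> a = 3 \<or> a = 4" using assms(1) by linarith
  then have "\<exists>t. \<forall>c<9. z $ c = t * arc_table a c"
  proof (elim disjE)
    assume a: "a = 0"
    show ?thesis
      using supp9 assms(2) unfolding all_less_9 int_kernel_transport33 a
      by (intro exI[of _ "z $ 0"]) (auto simp: arc_table_def perm_table_def)
  next
    assume a: "a = 1"
    show ?thesis
      using supp9 assms(2) unfolding all_less_9 int_kernel_transport33 a
      by (intro exI[of _ "z $ 1"]) (auto simp: arc_table_def perm_table_def)
  next
    assume a: "a = 2"
    show ?thesis
      using supp9 assms(2) unfolding all_less_9 int_kernel_transport33 a
      by (intro exI[of _ "z $ 2"]) (auto simp: arc_table_def perm_table_def)
  next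
    assume a: "a = 3"
    show ?thesis
      using supp9 assms(2) unfolding all_less_9 int_kernel_transport33 a
      by (intro exI[of _ "z $ 0"]) (auto simp: arc_table_def perm_table_def)
  next
    assume a: "a = 4"
    show ?thesis
      using supp9 assms(2) unfolding all_less_9 int_kernel_transport33 a
      by (intro exI[of _ "z $ 1"]) (auto simp: arc_table_def perm_table_def)
  qed
  then show ?thesis using that by blast
qed

text \<open>Up to scaling, \<open>1, 2, 3, 2, 1\<close> is the only linear relation between the five arcs; as
  the first and the last arc occur once, a subfamily of the nine arcs sums to zero only if it is
  empty or full.\<close>

lemma extremal_arc_relation:
  fixes t :: "nat \<Rightarrow> int"
  assumes range: "\<And>i. i < 9 \<Longrightarrow> t i = 0 \<or> t i = - 1"
    and zero: "\<And>c. c < 9 \<Longrightarrow> (\<Sum>i<9. t i * arc_table (extremal_arc i) c) = 0"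
  shows "(\<forall>i<9. t i = 0) \<or> (\<forall>i<9. t i = - 1)"
proof -
  have eqs: "\<forall>c<9. t 0 * arc_table 0 c + t 1 * arc_table 1 c + t 2 * arc_table 1 c
      + t 3 * arc_table 2 c + t 4 * arc_table 2 c + t 5 * arc_table 2 c
      + t 6 * arc_table 3 c + t 7 * arc_table 3 c + t 8 * arc_table 4 c = 0"
    using zero by (simp add: sum_lessThan_9 extremal_arc_def)
  have "t 1 + t 2 = 2 * t 0 \<and> t 3 + t 4 + t 5 = 3 * t 0 \<and> t 6 + t 7 = 2 * t 0 \<and> t 8 = t 0"
    using eqs unfolding all_less_9 by (simp add: arc_table_def perm_table_def)
  then have sums: "t 1 + t 2 = 2 * t 0" "t 3 + t 4 + t 5 = 3 * t 0" "t 6 + t 7 = 2 * t 0" "t 8 = t 0"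
    by blast+
  \<comment> \<open>With all \<open>t i\<close> in \<open>{-1, 0}\<close>, a sum of m of them that
    equals m times \<open>t 0\<close> is extremal, so each of its terms is
    \<open>t 0\<close>.\<close>
  have "\<forall>i<9. -1 \<le> t i \<and> t i \<le> 0" using range by force
  note bounds = this[unfolded all_less_9]
  have "t 0 = 0 \<or> t 0 = - 1" using range by simp
  then show ?thesis
  proof
    assume "t 0 = 0"
    then have "\<forall>i<9. t i = 0"
      using sums bounds unfolding all_less_9 by (elim conjE, intro conjI; linarith)
    then show ?thesis by blast
  next
    assume "t 0 = - 1"
    then have "\<forall>i<9. t i = - 1"
      using sums bounds unfolding all_less_9 by (elim conjE, intro conjI; linarith)
    then show ?thesis by blast
  qed
qed

lemma extremal_vec_carrier: "extremal_vec \<in> carrier_vec (9 * 9)"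
  unfolding extremal_vec_def by (rule vec_carrier)

lemma extremal_vec_index:
  "i < 9 \<Longrightarrow> c < 9 \<Longrightarrow> extremal_vec $ (i * 9 + c) = arc_table (extremal_arc i) c"
  using layer_index_less[of i 9 c 9] by (simp add: extremal_vec_def)

lemma layer_extremal_vec: "i < 9 \<Longrightarrow> layer 9 extremal_vec i = vec 9 (arc_table (extremal_arc i))"
  unfolding extremal_vec_def by (rule layer_vec)

lemma extremal_vec_kernel: "extremal_vec \<in> int_kernel (higher_lawrence 9 transport33)"
  unfolding int_kernel_higher_lawrence
proof (intro conjI allI impI)
  show "extremal_vec \<in> carrier_vec (9 * dim_col transport33)" using extremal_vec_carrier by simp
  fix j assume "j < dim_col transport33"
  then have j: "j < 9" by simp
  have "\<forall>j<9. (\<Sum>i<9. arc_table (extremal_arc i) j) = 0"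
    unfolding all_less_9 sum_lessThan_9 by (simp add: extremal_arc_def arc_table_def perm_table_def)
  then show "(\<Sum>i<9. extremal_vec $ (i * dim_col transport33 + j)) = 0"
    using extremal_vec_index j by simp
next
  fix i :: nat assume "i < 9"
  then have "extremal_arc i < 5" by (rule extremal_arc_less)
  then have "vec 9 (arc_table (extremal_arc i)) \<in> int_kernel transport33"
    unfolding arc_table_eq_flow by (intro flow_table_kernel) auto
  then show "layer (dim_col transport33) extremal_vec i \<in> int_kernel transport33"
    using layer_extremal_vec[OF \<open>i < 9\<close>] by simp
qed

lemma vec_type_extremal_vec: "vec_type 9 9 extremal_vec = 9"
proof -
  have "layer 9 extremal_vec i \<noteq> 0\<^sub>v 9" if i: "i < 9" for i
  proof
    assume zero: "layer 9 extremal_vec i = 0\<^sub>v 9"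
    obtain c where c: "c < 9" "arc_table (extremal_arc i) c = 1"
      using arc_table_has_one[OF extremal_arc_less[OF i]] by blast
    have "layer 9 extremal_vec i $ c = 1" using layer_extremal_vec[OF i] c by simp
    then show False using zero c(1) by simp
  qed
  then have "{i \<in> {..<9}. layer 9 extremal_vec i \<noteq> 0\<^sub>v 9} = {..<9}" by blast
  then show ?thesis by (simp add: vec_type_def)
qed

text \<open>A weight-zero member of the fiber lives on the support of the vector, so each layer of
  its difference from the positive part is a multiple \<open>t i\<close> of the arc there.
  Nonnegativity leaves only 0 and -1, and the relation between the arcs makes all \<open>t i\<close>
  equal; the two choices are the two ends of the edge.\<close>

lemma extremal_vec_groebner:
  fixes K :: "'k::field itself"
  shows "extremal_vec \<in> universal_groebner_basis K (higher_lawrence 9 transport33)"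
proof -
  let ?L = "higher_lawrence 9 transport33" and ?w = extremal_vec
  let ?p = "exponent (pos_part ?w)" and ?q = "exponent (neg_part ?w)"
  define wt :: "nat \<Rightarrow> nat" where "wt k = of_bool (?w $ k = 0)" for k
  have dim: "dim_col ?L = 9 * 9" by simp
  have dimw: "dim_vec ?w = 9 * 9" using extremal_vec_carrier by (rule carrier_vecD)
  have "?w \<in> groebner_vectors K ?L (weight_ordering (dim_col ?L) wt)"
  proof (rule fiber_edge_groebner_vector[OF extremal_vec_kernel finite_fiber_higher_lawrence])
    show "wt k = 0" if "?w $ k \<noteq> 0" for k using that by (simp add: wt_def)
    \<comment> \<open>The lexicographic tie-break is decided at index 0, where the vector is
      positive, so its positive part leads.\<close>
    have "?w $ 0 = 1" using extremal_vec_index[of 0 0] by (simp add: extremal_arc_def arc_table_def perm_table_def)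
    then have "Poly_Mapping.lookup ?q 0 < Poly_Mapping.lookup ?p 0" using dimw by (simp add: lookup_exponent_parts)
    then show "?q < ?p" by (auto simp: less_poly_mapping.rep_eq less_fun_def)
  next
    fix s assume s: "s \<in> pps (dim_col ?L)" and fib: "same_fiber ?L s ?p"
      and weight: "pp_weight (dim_col ?L) wt s = 0"
    let ?s = "\<lambda>i c. int (Poly_Mapping.lookup s (i * 9 + c))"
    let ?a = "\<lambda>i c. arc_table (extremal_arc i) c"
    define u where "u = pp_vec (9 * 9) s - pp_vec (9 * 9) ?p"
    have u: "u \<in> int_kernel ?L" using fib unfolding same_fiber_def dim u_def .
    have idx: "i * 9 + c < 9 * 9" if "i < 9" "c < 9" for i c :: nat using layer_index_less[OF that] .
    have u_index: "u $ (i * 9 + c) = ?s i c - max (?a i c) 0" if "i < 9" "c < 9" for i c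
      using idx[OF that] extremal_vec_index[OF that] dimw by (simp add: u_def pp_vec_def lookup_exponent_parts)
    have supp: "?s i c = 0" if "i < 9" "c < 9" "?a i c = 0" for i c
    proof -
      have "wt (i * 9 + c) * Poly_Mapping.lookup s (i * 9 + c) = 0"
        using weight idx[OF that(1,2)] unfolding pp_weight_def dim by simp
      then show ?thesis using extremal_vec_index[OF that(1,2)] that(3) by (simp add: wt_def)
    qed
    have "\<exists>t. \<forall>c<9. u $ (i * 9 + c) = t * ?a i c" if i: "i < 9" for i
    proof -
      have "layer 9 u i \<in> int_kernel transport33" using u i unfolding int_kernel_higher_lawrence by simp
      moreover have "layer 9 u i $ c = 0" if "c < 9" "?a i c = 0" for c
        using u_index[OF i that(1)] supp[OF i that] that by (simp add: layer_def)
      ultimately obtain t where "\<And>c. c < 9 \<Longrightarrow> layer 9 u i $ c = t * ?a i c"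
        using kernel_on_arc_support[OF extremal_arc_less[OF i]] by blast
      then show ?thesis by (intro exI[of _ t]) (simp add: layer_def)
    qed
    then obtain t where t: "\<And>i c. i < 9 \<Longrightarrow> c < 9 \<Longrightarrow> u $ (i * 9 + c) = t i * ?a i c" by metis
    have val: "?s i c = max (?a i c) 0 + t i * ?a i c" if "i < 9" "c < 9" for i c
      using t[OF that] u_index[OF that] by simp
    \<comment> \<open>At a cell with entry 1 the exponent of \<open>s\<close> is
      \<open>1 + t i\<close>, at a cell with entry -1 it is \<open>- t i\<close>; both are
      nonnegative.\<close>
    have "t i = 0 \<or> t i = - 1" if i: "i < 9" for i
    proof -
      obtain c where c: "c < 9" "?a i c = 1" using arc_table_has_one[OF extremal_arc_less[OF i]] by blast
      have "t i \<ge> - 1" using val[OF i c(1)] c(2) by simp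
      obtain d where d: "d < 9" "?a i d = - 1"
        using arc_table_has_minus_one[OF extremal_arc_less[OF i]] by blast
      have "t i \<le> 0" using val[OF i d(1)] d(2) by simp
      with \<open>t i \<ge> - 1\<close> show ?thesis by linarith
    qed
    moreover have "(\<Sum>i<9. t i * ?a i c) = 0" if "c < 9" for c
    proof -
      have "(\<Sum>i<9. u $ (i * 9 + c)) = 0" using u that unfolding int_kernel_higher_lawrence by simp
      then show ?thesis using t that by simp
    qed
    ultimately have "(\<forall>i<9. t i = 0) \<or> (\<forall>i<9. t i = - 1)" by (rule extremal_arc_relation)
    then show "s = ?p \<or> s = ?q"
    proof
      assume t0: "\<forall>i<9. t i = 0"
      have "s = ?p"
      proof (rule poly_mapping_eqI)
        fix k
        show "Poly_Mapping.lookup s k = Poly_Mapping.lookup ?p k"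
        proof (cases "k < 9 * 9")
          case True
          have k: "k div 9 < 9" "k mod 9 < 9" "k = k div 9 * 9 + k mod 9" using True by auto
          have "?w $ k = ?a (k div 9) (k mod 9)" using extremal_vec_index[OF k(1,2)] k(3) by simp
          then have "int (Poly_Mapping.lookup s k) = max (?w $ k) 0" using val[OF k(1,2)] t0 k(1,3) by simp
          then show ?thesis using True dimw by (simp add: lookup_exponent_parts)
        next
          case False
          then show ?thesis using s dimw by (auto simp: lookup_exponent_parts pps_def in_keys_iff subset_eq)
        qed
      qed
      then show ?thesis by blast
    next
      assume t1: "\<forall>i<9. t i = - 1"
      have "s = ?q"
      proof (rule poly_mapping_eqI)
        fix k
        show "Poly_Mapping.lookup s k = Poly_Mapping.lookup ?q k"
        proof (cases "k < 9 * 9")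
          case True
          have k: "k div 9 < 9" "k mod 9 < 9" "k = k div 9 * 9 + k mod 9" using True by auto
          have "?w $ k = ?a (k div 9) (k mod 9)" using extremal_vec_index[OF k(1,2)] k(3) by simp
          then have "int (Poly_Mapping.lookup s k) = max (?w $ k) 0 - ?w $ k" using val[OF k(1,2)] t1 k(1,3) by simp
          then show ?thesis using True dimw by (simp add: lookup_exponent_parts)
        next
          case False
          then show ?thesis using s dimw by (auto simp: lookup_exponent_parts pps_def in_keys_iff subset_eq)
        qed
      qed
      then show ?thesis by blast
    qed
  qed
  then show ?thesis
    unfolding universal_groebner_basis_def using term_ordering_weight by blast
qed

section \<open>Both complexities equal nine\<close>

lemma vec_type_uminus:
  assumes "x \<in> carrier_vec (N * n)"
  shows "vec_type n N (- x) = vec_type n N x"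
proof -
  have "layer n (- x) i = - layer n x i" if "i < N" for i
    using assms layer_index_less[OF that] by (intro eq_vecI) (auto simp: layer_def)
  then have "layer n (- x) i = 0\<^sub>v n \<longleftrightarrow> layer n x i = 0\<^sub>v n" if "i < N" for i
    using that by (metis uminus_uminus_vec uminus_zero_vec)
  then have "{i \<in> {..<N}. layer n (- x) i \<noteq> 0\<^sub>v n} = {i \<in> {..<N}. layer n x i \<noteq> 0\<^sub>v n}" by blast
  then show ?thesis unfolding vec_type_def by simp
qed

lemma universal_groebner_type_le_9:
  fixes K :: "'k::field itself"
  assumes "x \<in> universal_groebner_basis K (higher_lawrence N transport33)"
  shows "vec_type 9 N x \<le> 9"
proof -
  obtain r w where r: "term_ordering (dim_col (higher_lawrence N transport33)) r"
    and w: "w \<in> groebner_vectors K (higher_lawrence N transport33) r" and x: "x = w \<or> x = - w"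
    using assms unfolding universal_groebner_basis_def by blast
  have prim: "primitive_vec (higher_lawrence N transport33) w" by (rule groebner_vector_primitive[OF r w])
  then have "w \<in> carrier_vec (N * 9)"
    using int_kernel_carrier[of w "higher_lawrence N transport33"] by (simp add: primitive_vec_def)
  then show ?thesis using x primitive_type_le_9[OF prim] vec_type_uminus by auto
qed

theorem mainTheorem3:
  shows "groebner_complexity TYPE('k::field) transport33 = graver_complexity transport33 \<and>
         graver_complexity transport33 = 9"
proof -
  have dim: "dim_col transport33 = 9" by simp
  have u9: "extremal_vec \<in> universal_groebner_basis TYPE('k) (higher_lawrence 9 transport33)"
    by (rule extremal_vec_groebner)
  \<comment> \<open>The universal basis includes negatives, so the extremal vector may be the
    negative of a Groebner vector \<open>w\<close>. Primitivity, and with it membership in the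
    Graver basis, is derived for \<open>w\<close>, which has the same type.\<close>
  then obtain r w where r: "term_ordering (dim_col (higher_lawrence 9 transport33)) r"
    and w: "w \<in> groebner_vectors TYPE('k) (higher_lawrence 9 transport33) r"
    and x: "extremal_vec = w \<or> extremal_vec = - w"
    unfolding universal_groebner_basis_def by blast
  have prim: "primitive_vec (higher_lawrence 9 transport33) w" by (rule groebner_vector_primitive[OF r w])
  have wc: "w \<in> carrier_vec (9 * 9)"
    using int_kernel_carrier[of w "higher_lawrence 9 transport33"] prim by (simp add: primitive_vec_def)
  have type_w: "vec_type 9 9 w = 9" using x vec_type_extremal_vec vec_type_uminus[OF wc] by auto
  have graver_w: "w \<in> graver_basis (higher_lawrence 9 transport33)" using prim by (rule primitive_imp_graver)
  have "groebner_complexity TYPE('k) transport33 = enat 9"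
    unfolding groebner_complexity_def dim
  proof (rule antisym)
    show "Sup {enat (vec_type 9 N x) |N x. N > 0 \<and>
        x \<in> universal_groebner_basis TYPE('k) (higher_lawrence N transport33)} \<le> enat 9"
      using universal_groebner_type_le_9 by (intro Sup_least) auto
    show "enat 9 \<le> Sup {enat (vec_type 9 N x) |N x. N > 0 \<and>
        x \<in> universal_groebner_basis TYPE('k) (higher_lawrence N transport33)}"
      using u9 vec_type_extremal_vec by (intro Sup_upper CollectI exI[of _ 9] exI[of _ extremal_vec]) simp
  qed
  moreover have "graver_complexity transport33 = enat 9"
    unfolding graver_complexity_def dim
  proof (rule antisym)
    show "Sup {enat (vec_type 9 N x) |N x. N > 0 \<and> x \<in> graver_basis (higher_lawrence N transport33)} \<le> enat 9"
      using primitive_type_le_9 graver_imp_primitive by (intro Sup_least) auto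
    show "enat 9 \<le> Sup {enat (vec_type 9 N x) |N x. N > 0 \<and> x \<in> graver_basis (higher_lawrence N transport33)}"
      using graver_w type_w by (intro Sup_upper CollectI exI[of _ 9] exI[of _ w]) simp
  qed
  ultimately show ?thesis by (simp add: numeral_eq_enat)
qed

end
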